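(* Let $H$ be the graph defined by the array \[ \begin{array}{rrrrrr} 0&1&2&3&4&0\\ 4&5&6&7&8&1\\ 3&9&10&11&12&2\\ 2&13&14&15&16&3\\ 1&17&18&19&20&4\\ 0&4&3&2&1&0 \end{array} \] where equal labels denote the same vertex and two vertices are adjacent exactly when their labels occur horizontally or vertically next to each other somewhere in the array. Then $\Pi_1^*(H)\cong\mathbb Z/4\mathbb Z$, with the length-parity homomorphism $\Pi_1^*(H)\to\mathbb Z/2\mathbb Z$ corresponding to reduction modulo two. In particular $H$ contains no odd closed walk $\gamma$ with $[\gamma]^2=1$ in $\Pi_1^*(H)$. Nevertheless, for every $d\ge1$, every free continuous $\mathbb Z^d$-action on a zero-dimensional Polish space admits a continuous homomorphism from its standard Schreier graph to $H$.
   Context: A walk in $H$ is a finite sequence $(v_0,\dots,v_m)$ of vertices with consecutive ones adjacent (repetitions allowed); its length is $m$; it is closed if $v_0=v_m$, odd if $m$ is odd. For a vertex $b$ of a connected graph $H$, $\Pi_1(H,b)$ is the group of closed walks based at $b$ modulo insertion and deletion of spurs $(u,v,u)$, with concatenation as multiplication. $\Pi_1^*(H,b)$ is its quotient by the normal subgroup generated by all classes $[\lambda\sigma\lambda^{-1}]$, where $\sigma$ is any closed walk of length four (possibly with repeated vertices) and $\lambda$ is a walk from $b$ to the start of $\sigma$. Changing the base point conjugates classes, so the base point is omitted. The length-parity homomorphism sends $[\gamma]$ to the length of $\gamma$ modulo $2$ (well defined). A space is zero-dimensional if it has a base of clopen sets. An action is free if $g\cdot x=x$ implies $g=0$. The standard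 Schreier graph of a free $\mathbb Z^d$-space $X$ joins $x$ to $e_i\cdot x$ for $1\le i\le d$. A continuous homomorphism to $H$ is a continuous map $c:X\to V(H)$ ($V(H)$ discrete) taking adjacent points to adjacent vertices. *)

theory Defs
  imports "HOL-Analysis.Analysis" "HOL-Algebra.Product_Groups" "HOL-Algebra.Group_Action"
begin

section \<open>Graphs and walks\<close>

record 'a graph =
  verts :: "'a set"
  adj :: "'a \<Rightarrow> 'a \<Rightarrow> bool"

text \<open>A walk is given by its nonempty list of vertices; a walk of length \<open>m\<close> is a list with
  \<open>m + 1\<close> entries.\<close>

definition walk :: "('a, 'm) graph_scheme \<Rightarrow> 'a list \<Rightarrow> bool" where
  "walk G p \<longleftrightarrow> p \<noteq> [] \<and> set p \<subseteq> verts G \<and> successively (adj G) p"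

definition walk_length :: "'a list \<Rightarrow> nat" where
  "walk_length p = length p - 1"

definition walk_concat :: "'a list \<Rightarrow> 'a list \<Rightarrow> 'a list" where
  "walk_concat p q = p @ tl q"

definition closed_walks :: "('a, 'm) graph_scheme \<Rightarrow> 'a \<Rightarrow> 'a list set" where
  "closed_walks G b = {p. walk G p \<and> hd p = b \<and> last p = b}"

section \<open>The groups \<open>\<Pi>\<^sub>1\<close> and \<open>\<Pi>\<^sub>1\<^sup>*\<close>\<close>

text \<open>\<open>q\<close> arises from the walk \<open>p\<close> by deleting one spur \<open>(u, v, u)\<close>.\<close>

definition spur_del :: "('a, 'm) graph_scheme \<Rightarrow> 'a list \<Rightarrow> 'a list \<Rightarrow> bool" where
  "spur_del G p q \<longleftrightarrow>
     walk G p \<and> (\<exists>xs u v ys. p = xs @ [u, v, u] @ ys \<and> q = xs @ [u] @ ys)"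

definition spur_equiv :: "('a, 'm) graph_scheme \<Rightarrow> 'a \<Rightarrow> ('a list \<times> 'a list) set" where
  "spur_equiv G b =
     {(p, q). p \<in> closed_walks G b \<and> q \<in> closed_walks G b \<and> equivclp (spur_del G) p q}"

definition pi1_class :: "('a, 'm) graph_scheme \<Rightarrow> 'a \<Rightarrow> 'a list \<Rightarrow> 'a list set" where
  "pi1_class G b p = spur_equiv G b `` {p}"

definition pi1 :: "('a, 'm) graph_scheme \<Rightarrow> 'a \<Rightarrow> 'a list set monoid" where
  "pi1 G b =
     \<lparr>carrier = closed_walks G b // spur_equiv G b,
      monoid.mult = (\<lambda>A B. \<Union>p\<in>A. \<Union>q\<in>B. pi1_class G b (walk_concat p q)),
      one = pi1_class G b [b]\<rparr>"

definition normal_closure :: "('g, 'm) monoid_scheme \<Rightarrow> 'g set \<Rightarrow> 'g set" where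
  "normal_closure G S = \<Inter>{N. N \<lhd> G \<and> S \<subseteq> N}"

text \<open>The classes \<open>[\<lambda> \<sigma> \<lambda>\<inverse>]\<close>, where \<open>\<sigma>\<close> is a closed walk of length four,
  possibly with repeated vertices, and \<open>\<lambda>\<close> is a walk from \<open>b\<close> to its start.\<close>

definition square_classes :: "('a, 'm) graph_scheme \<Rightarrow> 'a \<Rightarrow> 'a list set set" where
  "square_classes G b =
     {pi1_class G b (walk_concat (walk_concat l s) (rev l)) | l s.
        walk G l \<and> hd l = b \<and> s \<in> closed_walks G (last l) \<and> walk_length s = 4}"

definition pi1_star :: "('a, 'm) graph_scheme \<Rightarrow> 'a \<Rightarrow> 'a list set set monoid" where
  "pi1_star G b = pi1 G b Mod normal_closure (pi1 G b) (square_classes G b)"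

definition pi1_star_class :: "('a, 'm) graph_scheme \<Rightarrow> 'a \<Rightarrow> 'a list \<Rightarrow> 'a list set set" where
  "pi1_star_class G b p =
     normal_closure (pi1 G b) (square_classes G b) #>\<^bsub>pi1 G b\<^esub> pi1_class G b p"

text \<open>The common value of \<open>length mod 2\<close> over all closed walks representing \<open>A\<close>.\<close>

definition length_parity :: "('a, 'm) graph_scheme \<Rightarrow> 'a \<Rightarrow> 'a list set set \<Rightarrow> int" where
  "length_parity G b A =
     the_elem ((\<lambda>p. int (walk_length p) mod 2) ` {p \<in> closed_walks G b. pi1_star_class G b p = A})"

section \<open>The graph \<open>H\<close>\<close>

definition H_array :: "nat list list" where
  "H_array =
    [[0,  1,  2,  3,  4, 0],
     [4,  5,  6,  7,  8, 1],
     [3,  9, 10, 11, 12, 2],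
     [2, 13, 14, 15, 16, 3],
     [1, 17, 18, 19, 20, 4],
     [0,  4,  3,  2,  1, 0]]"

definition H_graph :: "nat graph" where
  "H_graph =
     \<lparr>verts = {H_array ! i ! j | i j. i < 6 \<and> j < 6},
      adj = (\<lambda>u v.
        (\<exists>i<6. \<exists>j<5. {u, v} = {H_array ! i ! j, H_array ! i ! Suc j}) \<or>
        (\<exists>i<5. \<exists>j<6. {u, v} = {H_array ! i ! j, H_array ! Suc i ! j}))\<rparr>"

section \<open>Free \<open>\<int>\<^sup>d\<close>-actions on zero-dimensional Polish spaces\<close>

definition polish :: "'a topology \<Rightarrow> bool" where
  "polish X \<longleftrightarrow> completely_metrizable_space X \<and> separable_space X"

definition zero_dimensional :: "'a topology \<Rightarrow> bool" where
  "zero_dimensional X \<longleftrightarrow>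
     (\<exists>\<B>. (\<forall>V\<in>\<B>. openin X V \<and> closedin X V) \<and>
          (\<forall>U x. openin X U \<and> x \<in> U \<longrightarrow> (\<exists>V\<in>\<B>. x \<in> V \<and> V \<subseteq> U)))"

definition Zd :: "nat \<Rightarrow> (nat \<Rightarrow> int) monoid" where
  "Zd d = product_group {..<d} (\<lambda>_. integer_group)"

text \<open>Coordinates are indexed from \<open>0\<close>, so the standard generators are
  \<open>unit_vec d i\<close> for \<open>i < d\<close>.\<close>

definition unit_vec :: "nat \<Rightarrow> nat \<Rightarrow> nat \<Rightarrow> int" where
  "unit_vec d i = (\<lambda>j\<in>{..<d}. if j = i then 1 else 0)"

definition continuous_Zd_action ::
    "nat \<Rightarrow> 'a topology \<Rightarrow> ((nat \<Rightarrow> int) \<Rightarrow> 'a \<Rightarrow> 'a) \<Rightarrow> bool" where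
  "continuous_Zd_action d X act \<longleftrightarrow>
     group_action (Zd d) (topspace X) act \<and>
     (\<forall>g\<in>carrier (Zd d). continuous_map X X (act g))"

definition free_Zd_action ::
    "nat \<Rightarrow> 'a topology \<Rightarrow> ((nat \<Rightarrow> int) \<Rightarrow> 'a \<Rightarrow> 'a) \<Rightarrow> bool" where
  "free_Zd_action d X act \<longleftrightarrow>
     (\<forall>g\<in>carrier (Zd d). \<forall>x\<in>topspace X. act g x = x \<longrightarrow> g = \<one>\<^bsub>Zd d\<^esub>)"

definition schreier_graph ::
    "nat \<Rightarrow> 'a topology \<Rightarrow> ((nat \<Rightarrow> int) \<Rightarrow> 'a \<Rightarrow> 'a) \<Rightarrow> 'a graph" where
  "schreier_graph d X act =
     \<lparr>verts = topspace X,
      adj = (\<lambda>x y. x \<in> topspace X \<and> y \<in> topspace X \<and>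
               (\<exists>i<d. y = act (unit_vec d i) x \<or> x = act (unit_vec d i) y))\<rparr>"

text \<open>The topology \<open>X\<close> lives on the vertex set of \<open>\<Gamma>\<close>.\<close>

definition continuous_graph_hom ::
    "'a topology \<Rightarrow> ('a, 'm) graph_scheme \<Rightarrow> ('b, 'n) graph_scheme \<Rightarrow> ('a \<Rightarrow> 'b) \<Rightarrow> bool" where
  "continuous_graph_hom X \<Gamma> K c \<longleftrightarrow>
     continuous_map X (discrete_topology (verts K)) c \<and>
     (\<forall>x\<in>verts \<Gamma>. \<forall>y\<in>verts \<Gamma>. adj \<Gamma> x y \<longrightarrow> adj K (c x) (c y))"

end

(* The coloring. Suppose a slowly varying z rotates by 1/q^2 of a turn under every generator, and u
   by 1/q^2 - 1/q of a turn. Then z^q - u^q rotates by 1/q of a turn, and near its zeros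
   z = u * zeta^a, where it carries no information, the residue a in Z/q is defined instead and
   increases by one under every generator. Markers colored with boundedly many colors give, for all
   q, many Z/q-valued labels defined on overlapping pieces with slowly varying weights; two labels
   combine into a number u rotating by any prescribed multiple of 1/q. So the number of labels can
   be reduced to one, at the cost of passing from q to q^2, whatever d is. A circle rotating by a
   quarter turn joined with a single Z/4-label is the universal cover of H: four copies of the
   square, glued along their boundary.

   The group. Signs on the edges whose sum around every 4-cycle is divisible by four define a map to
   Z/4. Conversely, modulo 4-cycles, the faces determine all edges from a spanning tree and one
   further edge, and the last face makes the fourth power of that edge trivial. *)

theory Submission
  imports Defs "HOL-Number_Theory.Cong" "HOL-Computational_Algebra.Fundamental_Theorem_Algebra"
begin

section \<open>Locally constant functions\<close>

text \<open>Read clockwise, each side of the array spells 0 1 2 3 4 0. So H is the 1-skeleton of a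
  disc of 25 faces attached to a 5-cycle wrapped around four times. This gives the order four, and
  since 5 is odd the generator is an odd walk. The passage from q to q^2 is dictated by two
  requirements on the rotation numbers of z and u: q times each must be 1/q modulo 1, so that z^q -
  u^q turns by 1/q, and their difference must be 1/q, so that the index a of the zero grows by
  exactly one. Equivariance holds only up to an error, and each reduction lowers the bound below
  which a weight counts as small. The bound must therefore be fixed before the error, and the
  markers must give arbitrarily slow data with a number of colors independent of their scale. All
  data are locally constant instead of merely continuous, so that maxima, case distinctions and
  arbitrary choices made from them keep this property.\<close>

definition locally_constant :: "'a topology \<Rightarrow> ('a \<Rightarrow> 'b) \<Rightarrow> bool" where
  "locally_constant X f \<longleftrightarrow>
     (\<forall>x\<in>topspace X. \<exists>U. openin X U \<and> x \<in> U \<and> (\<forall>y\<in>U. f y = f x))"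

lemma locally_constantI:
  assumes "\<And>x. x \<in> topspace X \<Longrightarrow> \<exists>U. openin X U \<and> x \<in> U \<and> (\<forall>y\<in>U. f y = f x)"
  shows "locally_constant X f"
  using assms unfolding locally_constant_def by blast

lemma locally_constant_const: "locally_constant X (\<lambda>x. c)"
  unfolding locally_constant_def by blast

lemma locally_constant_comp:
  assumes "locally_constant X f"
  shows "locally_constant X (\<lambda>x. F (f x))"
  using assms unfolding locally_constant_def by metis

lemma locally_constant_comp2:
  assumes "locally_constant X f" "locally_constant X g"
  shows "locally_constant X (\<lambda>x. F (f x) (g x))"
proof (rule locally_constantI)
  fix x assume x: "x \<in> topspace X"
  obtain U where "openin X U" "x \<in> U" "\<forall>y\<in>U. f y = f x"
    using assms(1) x unfolding locally_constant_def by blast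
  moreover obtain V where "openin X V" "x \<in> V" "\<forall>y\<in>V. g y = g x"
    using assms(2) x unfolding locally_constant_def by blast
  ultimately show "\<exists>U. openin X U \<and> x \<in> U \<and> (\<forall>y\<in>U. F (f y) (g y) = F (f x) (g x))"
    by (intro exI[of _ "U \<inter> V"] conjI ballI openin_Int) (blast | metis Int_iff)+
qed

text \<open>Allows the whole pattern seen on a finite window around \<open>x\<close> to be treated
  as a single locally constant datum.\<close>

lemma locally_constant_restrict:
  assumes "finite I" "\<And>i. i \<in> I \<Longrightarrow> locally_constant X (f i)"
  shows "locally_constant X (\<lambda>x. \<lambda>i\<in>I. f i x)"
  using assms
proof (induction I)
  case empty
  show ?case by (simp add: locally_constant_const)
next
  case (insert j I)
  have lc: "locally_constant X (\<lambda>x. \<lambda>i\<in>I. f i x)" and lcj: "locally_constant X (f j)"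
    using insert.IH insert.prems by blast+
  have "locally_constant X (\<lambda>x. (\<lambda>i\<in>I. f i x)(j := f j x))"
    using locally_constant_comp2[OF lc lcj, of "\<lambda>a b. a(j := b)"] .
  moreover have "(\<lambda>i\<in>I. f i x)(j := f j x) = (\<lambda>i\<in>insert j I. f i x)" for x
    using insert.hyps by (auto simp: fun_eq_iff restrict_def)
  ultimately show ?case by (simp only:)
qed

lemma locally_constant_pullback:
  assumes "locally_constant X f" "continuous_map X X g"
  shows "locally_constant X (\<lambda>x. f (g x))"
proof (rule locally_constantI)
  fix x assume x: "x \<in> topspace X"
  then have "g x \<in> topspace X"
    using assms(2) by (auto simp: continuous_map_def)
  then obtain U where "openin X U" "g x \<in> U" "\<forall>y\<in>U. f y = f (g x)"
    using assms(1) unfolding locally_constant_def by blast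
  then show "\<exists>U. openin X U \<and> x \<in> U \<and> (\<forall>y\<in>U. f (g y) = f (g x))"
    using openin_continuous_map_preimage[OF assms(2), of U] x by blast
qed

section \<open>Roots of unity\<close>

definition unit_root :: "nat \<Rightarrow> int \<Rightarrow> complex" where
  "unit_root n a = cis (2 * pi * real_of_int a / real n)"

lemma norm_unit_root [simp]: "cmod (unit_root n a) = 1"
  by (simp add: unit_root_def)

lemma unit_root_add: "unit_root n (a + b) = unit_root n a * unit_root n b"
  by (simp add: unit_root_def cis_mult add_divide_distrib algebra_simps)

lemma unit_root_0 [simp]: "unit_root n 0 = 1"
  by (simp add: unit_root_def)

lemma unit_root_mult_left:
  assumes "n > 0" "m > 0"
  shows "unit_root (n * m) (int m * a) = unit_root n a"
  using assms by (simp add: unit_root_def field_simps)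

lemma unit_root_power: "unit_root n a ^ m = unit_root n (int m * a)"
  by (simp add: unit_root_def Complex.DeMoivre algebra_simps)

lemma unit_root_eq_1:
  assumes "n > 0" shows "unit_root n a = 1 \<longleftrightarrow> int n dvd a"
proof
  assume "unit_root n a = 1"
  then have "exp (\<i> * (2 * pi * real_of_int a / real n)) = 1"
    by (simp add: unit_root_def cis_conv_exp)
  then obtain k :: int where "2 * pi * real_of_int a / real n = real_of_int (2 * k) * pi"
    by (auto simp: exp_eq_1)
  then have "real_of_int a = real_of_int (k * int n)"
    using assms by (simp add: field_simps)
  then show "int n dvd a" by (metis dvd_triv_right of_int_eq_iff)
next
  assume "int n dvd a"
  then obtain k where "a = int n * k" ..
  then have "unit_root n a = cis (2 * pi * real_of_int k)"
    using assms by (simp add: unit_root_def mult.assoc)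
  then show "unit_root n a = 1" using cis_multiple_2pi[OF Ints_of_int, of k] by simp
qed

lemma unit_root_cong:
  assumes "n > 0" "[a = b] (mod int n)"
  shows "unit_root n a = unit_root n b"
proof -
  have "unit_root n (a - b) = 1"
    using assms by (simp add: unit_root_eq_1 cong_iff_dvd_diff)
  then show ?thesis
    using unit_root_add[of n "a - b" b] by simp
qed

lemma unit_root_mod:
  assumes "n > 0" shows "unit_root n (a mod int n) = unit_root n a"
  by (rule unit_root_cong[OF assms]) (simp add: cong_def)

lemma unit_root_gap:
  assumes "n > 0"
  obtains \<eta> where "0 < \<eta>" "\<eta> \<le> 1"
    "\<And>a b. \<not> [a = b] (mod int n) \<Longrightarrow> 3 * \<eta> \<le> cmod (unit_root n a - unit_root n b)"
proof -
  \<comment> \<open>The inserted 3 keeps the set nonempty when \<open>n = 1\<close> and makes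
    \<open>Min S / 3\<close> at most 1.\<close>
  define S where "S = insert 3 ((\<lambda>a. cmod (unit_root n a - 1)) ` {1..<int n})"
  have S: "finite S" "S \<noteq> {}" by (auto simp: S_def)
  have pos: "s > 0" if "s \<in> S" for s
    using that assms by (auto simp: S_def unit_root_eq_1 zdvd_not_zless)
  show ?thesis
  proof (rule that[of "Min S / 3"])
    show "0 < Min S / 3" using Min_in[OF S] pos by auto
    show "Min S / 3 \<le> 1" using Min_le[OF S(1), of 3] by (simp add: S_def)
    fix a b assume ne: "\<not> [a = b] (mod int n)"
    then have "(a - b) mod int n \<noteq> 0"
      by (simp add: cong_iff_dvd_diff dvd_eq_mod_eq_0)
    moreover have "0 \<le> (a - b) mod int n" "(a - b) mod int n < int n"
      using assms by auto
    ultimately have "(a - b) mod int n \<in> {1..<int n}"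
      unfolding atLeastLessThan_iff by linarith
    then have "cmod (unit_root n ((a - b) mod int n) - 1) \<in> S"
      unfolding S_def by blast
    then have "Min S \<le> cmod (unit_root n (a - b) - 1)"
      using S(1) assms by (simp add: unit_root_mod)
    also have "cmod (unit_root n (a - b) - 1) = cmod (unit_root n b * (unit_root n (a - b) - 1))"
      by (simp add: norm_mult)
    also have "unit_root n b * (unit_root n (a - b) - 1) = unit_root n a - unit_root n b"
      using unit_root_add[of n b "a - b"] by (simp add: algebra_simps)
    finally show "3 * (Min S / 3) \<le> cmod (unit_root n a - unit_root n b)" by simp
  qed
qed

text \<open>The only real 2n-th roots of unity are 1 and -1. Their exponents are multiples of
  \<open>n\<close>, hence even.\<close>

lemma Im_odd_unit_root_nonzero:
  assumes "even n" "n > 0" "odd a"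
  shows "Im (unit_root (2 * n) a) \<noteq> 0"
proof
  assume "Im (unit_root (2 * n) a) = 0"
  then have "sin (pi * real_of_int a / real n) = 0" by (simp add: unit_root_def)
  then obtain k :: int where "pi * real_of_int a / real n = of_int k * pi"
    by (auto simp: sin_zero_iff_int2)
  then have "real_of_int a = real_of_int (k * int n)"
    using assms(2) by (simp add: field_simps)
  then have "a = k * int n" by linarith
  then show False using assms by simp
qed

text \<open>The half-step offset \<open>unit_root (2 * n) 1\<close> keeps the two summands from ever being
  antipodal, so their sum degenerates only when both weights do.\<close>

lemma offset_sum_lower_bound:
  assumes "even n" "n > 0"
  obtains \<kappa> where "0 < \<kappa>" "\<kappa> \<le> 1"
    "\<And>s t a b. 0 \<le> s \<Longrightarrow> 0 \<le> t \<Longrightarrow>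
       \<kappa> * max s t \<le> cmod (of_real s * unit_root n a + of_real t * unit_root (2 * n) 1 * unit_root n b)"
proof -
  define S where "S = insert 1 ((\<lambda>a. \<bar>Im (unit_root (2 * n) a)\<bar>) ` ({0..<2 * int n} \<inter> {a. odd a}))"
  have S: "finite S" "S \<noteq> {}" by (simp_all add: S_def)
  have pos: "s > 0" if "s \<in> S" for s
    using that assms by (auto simp: S_def Im_odd_unit_root_nonzero)
  show ?thesis
  proof (rule that[of "Min S"])
    show "0 < Min S" using Min_in[OF S] pos by auto
    show "Min S \<le> 1" using Min_le[OF S(1), of 1] by (simp add: S_def)
    fix s t :: real and a b :: int assume st: "0 \<le> s" "0 \<le> t"
    \<comment> \<open>The ratio of the two directions. Its exponent is odd for all \<open>a\<close>
      and \<open>b\<close>, so its imaginary part is bounded away from 0.\<close>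
    define v where "v = unit_root (2 * n) (1 + 2 * (b - a))"
    have r2: "unit_root n x = unit_root (2 * n) (2 * x)" for x
      using unit_root_mult_left[of n 2 x] assms by (simp add: mult.commute)
    have "of_real s * unit_root n a + of_real t * unit_root (2 * n) 1 * unit_root n b
        = unit_root n a * (of_real s + of_real t * v)"
      by (simp add: v_def r2 algebra_simps flip: unit_root_add)
    then have eq: "cmod (of_real s * unit_root n a + of_real t * unit_root (2 * n) 1 * unit_root n b)
        = cmod (of_real s + of_real t * v)"
      by (simp add: norm_mult)
    have "Min S \<le> \<bar>Im (unit_root (2 * n) ((1 + 2 * (b - a)) mod (2 * int n)))\<bar>"
      using S(1) assms by (intro Min_le) (auto simp: S_def even_mod_2_iff intro!: imageI simp: dvd_mod_iff)
    also have "\<dots> = \<bar>Im v\<bar>"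
      using unit_root_mod[of "2 * n" "1 + 2 * (b - a)"] assms by (simp add: v_def)
    finally have m: "Min S \<le> \<bar>Im v\<bar>" .
    have "Im (of_real s + of_real t * v) = t * Im v" by simp
    then have 1: "t * \<bar>Im v\<bar> \<le> cmod (of_real s + of_real t * v)"
      using abs_Im_le_cmod[of "of_real s + of_real t * v"] st by (simp add: abs_mult)
    have vc: "v * cnj v = 1"
      by (simp add: complex_norm_square[symmetric] v_def)
    \<comment> \<open>Multiplying by \<open>cnj v\<close> makes the second summand real, so that
      \<open>s\<close> can be bounded just as \<open>t\<close> was.\<close>
    have "Im ((of_real s + of_real t * v) * cnj v) = - s * Im v"
    proof -
      have "(of_real s + of_real t * v) * cnj v = of_real s * cnj v + of_real t * (v * cnj v)"
        by (simp add: algebra_simps)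
      then show ?thesis by (simp add: vc)
    qed
    then have "s * \<bar>Im v\<bar> \<le> cmod ((of_real s + of_real t * v) * cnj v)"
      using abs_Im_le_cmod[of "(of_real s + of_real t * v) * cnj v"] st by (simp add: abs_mult)
    then have 2: "s * \<bar>Im v\<bar> \<le> cmod (of_real s + of_real t * v)"
      by (simp add: norm_mult v_def)
    have "Min S * max s t \<le> \<bar>Im v\<bar> * max s t"
      using m st by (intro mult_right_mono) auto
    also have "\<dots> \<le> cmod (of_real s + of_real t * v)"
      using 1 2 by (auto simp: max_def mult.commute)
    finally show "Min S * max s t \<le> cmod (of_real s * unit_root n a
        + of_real t * unit_root (2 * n) 1 * unit_root n b)"
      by (simp only: eq)
  qed
qed

text \<open>When x^n - u^n is split into linear factors, every root is u times an n-th root of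
  unity, so each of the n factors at z has modulus at least \<open>\<eta>\<close>.\<close>

lemma power_diff_lower_bound:
  assumes n: "n > 0" and \<eta>: "0 \<le> \<eta>"
    and far: "\<And>a. \<eta> \<le> cmod (z - u * unit_root n a)"
  shows "\<eta> ^ n \<le> cmod (z ^ n - u ^ n)"
proof (cases "u = 0")
  case True
  then show ?thesis
    using far[of 0] n \<eta> by (auto simp: norm_power zero_power intro!: power_mono)
next
  case False
  define p where "p = monom 1 n - [:u ^ n:]"
  have deg: "degree p = n"
    unfolding p_def diff_conv_add_uminus
    using n by (subst degree_add_eq_left) (auto simp: degree_monom_eq)
  have lc: "lead_coeff p = 1"
    unfolding deg using n by (cases n) (auto simp: p_def)
  obtain root where root: "smult (lead_coeff p) (\<Prod>i<degree p. [:-root i, 1:]) = p"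
    using complex_poly_decompose'[of p] by blast
  then have p_eq: "p = (\<Prod>i<n. [:-root i, 1:])" using lc by (simp add: deg)
  have poly: "poly p x = x ^ n - u ^ n" for x
    by (simp add: p_def poly_monom)
  have near: "\<eta> \<le> cmod (z - root i)" if "i < n" for i
  proof -
    have "poly p (root i) = 0"
      using that by (auto simp: p_eq poly_prod)
    then have "(root i / u) ^ n = 1"
      using False by (simp add: poly power_divide)
    then have "root i / u \<in> {z. z ^ n = 1}" by simp
    then obtain j where "root i / u = exp (2 * of_real pi * \<i> * of_nat j / of_nat n)"
      using n complex_roots_unity[of n] by auto
    also have "\<dots> = unit_root n (int j)"
      by (simp add: unit_root_def cis_conv_exp mult_ac)
    finally have "root i = u * unit_root n (int j)"
      using False by (simp add: field_simps)
    then show ?thesis using far by simp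
  qed
  have "\<eta> ^ n = (\<Prod>i<n. \<eta>)" by simp
  also have "\<dots> \<le> (\<Prod>i<n. cmod (z - root i))"
    using near \<eta> by (intro prod_mono) auto
  also have "\<dots> = cmod (poly p z)"
    by (simp add: p_eq poly_prod prod_norm)
  finally show ?thesis by (simp add: poly)
qed

section \<open>Slow structures\<close>

text \<open>\<open>E\<close> consists of the pairs \<open>(x, e\<^sub>j \<cdot> x)\<close>. Up to the error \<open>\<epsilon>\<close>, the data
  describe a map of \<open>X\<close> to the join of a circle and \<open>k\<close> copies of \<open>\<int>/q\<close>, on which every
  generator acts as rotation by \<open>1/q\<close> of a full turn on the circle and as \<open>+1\<close> on each
  \<open>\<int>/q\<close>. The weight of the circle is \<open>\<bar>w\<bar>\<close>, that of the \<open>i\<close>-th copy of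
  \<open>\<int>/q\<close> is \<open>l i\<close>.\<close>

definition slow_structure ::
    "'a topology \<Rightarrow> ('a \<times> 'a) set \<Rightarrow> nat \<Rightarrow> nat \<Rightarrow> real \<Rightarrow> real \<Rightarrow>
     ('a \<Rightarrow> complex) \<Rightarrow> (nat \<Rightarrow> 'a \<Rightarrow> real) \<Rightarrow> (nat \<Rightarrow> 'a \<Rightarrow> int) \<Rightarrow> bool" where
  "slow_structure X E q k \<delta> \<epsilon> w l h \<longleftrightarrow>
     locally_constant X w \<and>
     (\<forall>i<k. locally_constant X (l i) \<and> locally_constant X (h i)) \<and>
     (\<forall>x\<in>topspace X. cmod (w x) \<le> 1 \<and> (\<forall>i<k. 0 \<le> l i x \<and> l i x \<le> 1) \<and>
        (\<delta> \<le> cmod (w x) \<or> (\<exists>i<k. \<delta> \<le> l i x))) \<and>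
     (\<forall>(x, y)\<in>E. cmod (w y - unit_root q 1 * w x) \<le> \<epsilon> \<and>
        (\<forall>i<k. \<bar>l i y - l i x\<bar> \<le> \<epsilon> \<and>
           (0 < l i x \<and> 0 < l i y \<longrightarrow> [h i y = h i x + 1] (mod int q))))"

text \<open>The order of the quantifiers is the point: \<open>\<delta>\<close> comes first, so the
  error per generator can be made small compared with every constant derived from
  \<open>\<delta>\<close>.\<close>

definition has_slow_structures :: "'a topology \<Rightarrow> ('a \<times> 'a) set \<Rightarrow> nat \<Rightarrow> nat \<Rightarrow> bool" where
  "has_slow_structures X E q k \<longleftrightarrow> (\<exists>\<delta>>0. \<forall>\<epsilon>>0. \<exists>w l h. slow_structure X E q k \<delta> \<epsilon> w l h)"

lemma slow_structureD:
  assumes "slow_structure X E q k \<delta> \<epsilon> w l h"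
  shows "locally_constant X w"
    and "i < k \<Longrightarrow> locally_constant X (l i)" "i < k \<Longrightarrow> locally_constant X (h i)"
    and "x \<in> topspace X \<Longrightarrow> cmod (w x) \<le> 1"
    and "x \<in> topspace X \<Longrightarrow> i < k \<Longrightarrow> 0 \<le> l i x" "x \<in> topspace X \<Longrightarrow> i < k \<Longrightarrow> l i x \<le> 1"
    and "x \<in> topspace X \<Longrightarrow> \<delta> \<le> cmod (w x) \<or> (\<exists>i<k. \<delta> \<le> l i x)"
    and "(x, y) \<in> E \<Longrightarrow> cmod (w y - unit_root q 1 * w x) \<le> \<epsilon>"
    and "(x, y) \<in> E \<Longrightarrow> i < k \<Longrightarrow> \<bar>l i y - l i x\<bar> \<le> \<epsilon>"
    and "(x, y) \<in> E \<Longrightarrow> i < k \<Longrightarrow> 0 < l i x \<Longrightarrow> 0 < l i y \<Longrightarrow> [h i y = h i x + 1] (mod int q)"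
  using assms unfolding slow_structure_def by blast+

text \<open>Two weighted labels modulo \<open>n\<close> yield a number rotating by any prescribed multiple
  \<open>a/n\<close> of a turn.\<close>

lemma two_labels_to_circle:
  fixes s t s' t' :: real
  assumes "n > 0" "0 \<le> s" "0 \<le> t" "0 \<le> s'" "0 \<le> t'" "\<bar>s' - s\<bar> \<le> \<epsilon>" "\<bar>t' - t\<bar> \<le> \<epsilon>"
    and b: "0 < s \<Longrightarrow> 0 < s' \<Longrightarrow> [b' = b + 1] (mod int n)"
    and c: "0 < t \<Longrightarrow> 0 < t' \<Longrightarrow> [c' = c + 1] (mod int n)"
    and r: "cmod r = 1"
  shows "cmod ((of_real s' * unit_root n (a * b') + of_real t' * r * unit_root n (a * c'))
    - unit_root n a * (of_real s * unit_root n (a * b) + of_real t * r * unit_root n (a * c))) \<le> 2 * \<epsilon>"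
proof -
  have *: "cmod (of_real u' * unit_root n (a * d') - of_real u * unit_root n (a * (d + 1))) \<le> \<epsilon>"
    if "0 \<le> u" "0 \<le> u'" "\<bar>u' - u\<bar> \<le> \<epsilon>"
      and d: "0 < u \<Longrightarrow> 0 < u' \<Longrightarrow> [d' = d + 1] (mod int n)" for u u' :: real and d d'
  proof (cases "0 < u \<and> 0 < u'")
    case True
    then have "unit_root n (a * d') = unit_root n (a * (d + 1))"
      using d assms(1) by (intro unit_root_cong cong_scalar_left) auto
    then have "cmod (of_real u' * unit_root n (a * d') - of_real u * unit_root n (a * (d + 1)))
        = cmod (of_real (u' - u) * unit_root n (a * (d + 1)))"
      by (simp add: algebra_simps)
    then show ?thesis using that(3) by (simp add: norm_mult del: of_real_diff)
  next
    case False
    \<comment> \<open>Here nothing is known about the labels, but a weight vanishing at one end is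
      at most \<open>\<epsilon>\<close> at the other, so the jump is harmless.\<close>
    then have "u = 0 \<or> u' = 0" using that by linarith
    then show ?thesis using that by (auto simp: norm_mult)
  qed
  let ?A = "of_real s' * unit_root n (a * b') - of_real s * unit_root n (a * (b + 1))"
  let ?B = "of_real t' * unit_root n (a * c') - of_real t * unit_root n (a * (c + 1))"
  have "(of_real s' * unit_root n (a * b') + of_real t' * r * unit_root n (a * c'))
    - unit_root n a * (of_real s * unit_root n (a * b) + of_real t * r * unit_root n (a * c)) = ?A + r * ?B"
    by (simp add: algebra_simps unit_root_add)
  also have "cmod \<dots> \<le> cmod ?A + cmod (r * ?B)" by (rule norm_triangle_ineq)
  also have "\<dots> \<le> \<epsilon> + \<epsilon>"
    using *[of s s' b' b] *[of t t' c' c] assms by (intro add_mono) (auto simp: norm_mult)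
  finally show ?thesis by simp
qed

text \<open>How deep \<open>z\<close> lies in the disc of radius
  \<open>\<eta> * cmod u - \<theta>\<close> about the zero \<open>u * unit_root q a\<close> of z^q -
  u^q. A radius of at most \<eta> times |u| keeps the discs of different residues apart; the reserve
  \<open>\<theta>\<close> absorbs the error of one step.\<close>

definition vortex_depth :: "nat \<Rightarrow> real \<Rightarrow> real \<Rightarrow> complex \<Rightarrow> complex \<Rightarrow> int \<Rightarrow> real" where
  "vortex_depth q \<eta> \<theta> z u a = \<eta> * cmod u - \<theta> - cmod (z - u * unit_root q a)"

lemma vortex_depth_cong:
  assumes "q > 0" "[a = b] (mod int q)"
  shows "vortex_depth q \<eta> \<theta> z u a = vortex_depth q \<eta> \<theta> z u b"
  using unit_root_cong[OF assms] by (simp add: vortex_depth_def)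

text \<open>When z turns by \<open>r\<close> and u by \<open>s\<close>, the relation
  \<open>s * unit_root q 1 = r\<close> says that the zero with index a is carried to the one with
  index a + 1. The radius contributes one \<epsilon> to the error, the distance to the center
  two.\<close>

lemma vortex_depth_step:
  assumes "cmod (z' - r * z) \<le> \<epsilon>" "cmod (u' - s * u) \<le> \<epsilon>"
    and "s * unit_root q 1 = r" "cmod r = 1" "0 \<le> \<eta>" "\<eta> \<le> 1"
  shows "\<bar>vortex_depth q \<eta> \<theta> z' u' (a + 1) - vortex_depth q \<eta> \<theta> z u a\<bar> \<le> 3 * \<epsilon>"
proof -
  have s: "cmod s = 1"
    using assms(3,4) by (metis norm_mult norm_unit_root mult.right_neutral)
  have e: "0 \<le> \<epsilon>" using assms(1) norm_ge_zero order_trans by blast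
  have "\<bar>cmod u' - cmod u\<bar> \<le> \<epsilon>"
    using norm_triangle_ineq3[of u' "s * u"] assms(2) s by (simp add: norm_mult)
  then have 1: "\<bar>\<eta> * cmod u' - \<eta> * cmod u\<bar> \<le> \<epsilon>"
    using assms(5,6) e mult_mono[of \<eta> 1 "\<bar>cmod u' - cmod u\<bar>" \<epsilon>]
    by (simp add: abs_mult flip: right_diff_distrib)
  let ?P = "u * unit_root q a" and ?P' = "u' * unit_root q (a + 1)"
  have "z' - ?P' - r * (z - ?P) = (z' - r * z) - (u' - s * u) * unit_root q (a + 1)"
    by (simp add: algebra_simps unit_root_add flip: assms(3))
  also have "cmod \<dots> \<le> cmod (z' - r * z) + cmod ((u' - s * u) * unit_root q (a + 1))"
    by (rule norm_triangle_ineq4)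
  also have "\<dots> \<le> \<epsilon> + \<epsilon>"
    using assms(1,2) by (intro add_mono) (auto simp: norm_mult)
  finally have "cmod (z' - ?P' - r * (z - ?P)) \<le> 2 * \<epsilon>" by simp
  then have "\<bar>cmod (z' - ?P') - cmod (z - ?P)\<bar> \<le> 2 * \<epsilon>"
    using norm_triangle_ineq3[of "z' - ?P'" "r * (z - ?P)"] assms(4) by (simp add: norm_mult)
  with 1 show ?thesis by (simp add: vortex_depth_def abs_le_iff)
qed

lemma vortex_unique:
  assumes sep: "\<And>a b. \<not> [a = b] (mod int q) \<Longrightarrow> 3 * \<eta> \<le> cmod (unit_root q a - unit_root q b)"
    and "0 < \<eta>" "0 < \<theta>" "- \<theta> < vortex_depth q \<eta> \<theta> z u a" "- \<theta> < vortex_depth q \<eta> \<theta> z u b"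
  shows "[a = b] (mod int q)"
proof (rule ccontr)
  assume "\<not> [a = b] (mod int q)"
  then have "cmod u * (3 * \<eta>) \<le> cmod u * cmod (unit_root q a - unit_root q b)"
    using sep by (intro mult_left_mono) auto
  also have "\<dots> = cmod ((z - u * unit_root q b) - (z - u * unit_root q a))"
    by (simp add: norm_mult[symmetric] algebra_simps)
  also have "\<dots> \<le> cmod (z - u * unit_root q b) + cmod (z - u * unit_root q a)"
    by (rule norm_triangle_ineq4)
  also have "\<dots> < 2 * (\<eta> * cmod u)"
    using assms(4,5) by (simp add: vortex_depth_def)
  finally have "\<eta> * cmod u < 0" by (simp add: algebra_simps)
  then show False using assms(2) by (simp add: mult_less_0_iff)
qed


text \<open>Labels 0 and 1 are spent on u; the old circle w and u then give a new circle W and one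
  new label, while the other k labels are read modulo q instead of q^2. The total weight stays
  bounded below: if W is small then w is close to some zero u zeta^a. If u were small as well, w
  would be too, while a small u means that labels 0 and 1 carry little weight; so one of the other k
  labels must be heavy. Otherwise u is large and the new label has positive depth.\<close>

lemma has_slow_structures_reduce:
  assumes q: "even q" "q > 0"
    and E: "E \<subseteq> topspace X \<times> topspace X"
    and slow: "has_slow_structures X E (q\<^sup>2) (Suc (Suc k))"
  shows "has_slow_structures X E q (Suc k)"
proof -
  define Q where "Q = q\<^sup>2"
  have Q: "even Q" "Q > 0" "Q = q * q" using q by (auto simp: Q_def power2_eq_square)
  obtain \<delta> where \<delta>: "\<delta> > 0"
    and ex: "\<And>\<epsilon>. \<epsilon> > 0 \<Longrightarrow> \<exists>w l h. slow_structure X E Q (Suc (Suc k)) \<delta> \<epsilon> w l h"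
    using slow unfolding has_slow_structures_def Q_def by blast
  obtain \<kappa> where \<kappa>: "0 < \<kappa>" "\<kappa> \<le> 1"
    and \<kappa>_bound: "\<And>s t a b. 0 \<le> s \<Longrightarrow> 0 \<le> t \<Longrightarrow>
       \<kappa> * max s t \<le> cmod (of_real s * unit_root Q a + of_real t * unit_root (2 * Q) 1 * unit_root Q b)"
    using offset_sum_lower_bound[OF Q(1,2)] by blast
  obtain \<eta> where \<eta>: "0 < \<eta>" "\<eta> \<le> 1"
    and sep: "\<And>a b. \<not> [a = b] (mod int q) \<Longrightarrow> 3 * \<eta> \<le> cmod (unit_root q a - unit_root q b)"
    using unit_root_gap[OF q(2)] by blast
  \<comment> \<open>\<open>\<rho>\<close> bounds |u| from below wherever label 0 or 1 has weight at
    least \<open>\<delta>\<close>. With \<eta> \<rho> = 4 \<theta>, a point within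
    \<open>\<theta>\<close> of a zero has depth at least 4 \<theta> - \<theta> - \<theta> = 2
    \<theta>.\<close>
  define \<rho> where "\<rho> = \<kappa> * \<delta> / 2"
  define \<theta> where "\<theta> = \<eta> * \<rho> / 4"
  have \<rho>: "0 < \<rho>" "\<rho> \<le> \<delta> / 2" using \<kappa> \<delta> by (auto simp: \<rho>_def)
  have \<theta>: "0 < \<theta>" using \<rho> \<eta> by (auto simp: \<theta>_def)
  have \<theta>_le: "\<theta> \<le> \<delta> / 2"
    using mult_mono[of \<eta> 1 \<rho> "\<delta> / 2"] \<rho> \<eta> \<theta> \<delta> by (simp add: \<theta>_def)
  \<comment> \<open>The three entries serve the labels that are kept, the new label, and the new
    circle.\<close>
  define \<delta>' where "\<delta>' = min \<delta> (min (2 * \<theta>) (\<theta> ^ q / 2))"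
  have \<delta>': "0 < \<delta>'" using \<delta> \<theta> by (auto simp: \<delta>'_def)
  have "\<exists>w l h. slow_structure X E q (Suc k) \<delta>' \<epsilon>' w l h" if \<epsilon>': "\<epsilon>' > 0" for \<epsilon>'
  proof -
    \<comment> \<open>Taking q-th powers multiplies the error by q and the depth changes by up to 3
      \<epsilon>; both must stay below \<open>\<epsilon>'\<close>. Moreover 3 \<epsilon> must not
      exceed the reserve \<open>\<theta>\<close>.\<close>
    define \<epsilon> where "\<epsilon> = min (\<epsilon>' / (3 * q)) (\<theta> / 3)"
    have \<epsilon>: "0 < \<epsilon>" "3 * \<epsilon> \<le> \<theta>" using \<epsilon>' \<theta> q by (auto simp: \<epsilon>_def)
    have q\<epsilon>: "3 * (q * \<epsilon>) \<le> \<epsilon>'"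
    proof -
      have "\<epsilon> \<le> \<epsilon>' / (3 * q)" by (simp add: \<epsilon>_def)
      then show ?thesis using q by (simp add: field_simps)
    qed
    have third: "t \<le> \<epsilon>'" if "3 * t \<le> \<epsilon>'" "0 \<le> t" for t :: real using that by linarith
    have q\<epsilon>0: "0 \<le> real q * \<epsilon>" using \<epsilon> by simp
    have "1 * \<epsilon> \<le> q * \<epsilon>" using q \<epsilon> by (intro mult_right_mono) auto
    then have \<epsilon>3: "3 * \<epsilon> \<le> \<epsilon>'" "\<epsilon> \<le> \<epsilon>'" using q\<epsilon> \<epsilon> by linarith+
    obtain w l h where S: "slow_structure X E Q (Suc (Suc k)) \<delta> \<epsilon> w l h"
      using ex[OF \<epsilon>(1)] by blast
    note D = slow_structureD[OF S]
    \<comment> \<open>Congruent to 1 modulo q, so u^q turns like w^q, and q less than 1, so w turns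
      by exactly 1/q more than u.\<close>
    define b where "b = 1 - int q"
    define c where "c = unit_root (2 * Q) 1"
    define v where "v x = of_real (l 0 x) * unit_root Q (b * h 0 x)
        + of_real (l 1 x) * c * unit_root Q (b * h 1 x)" for x
    define u where "u x = v x / 2" for x
    have b1: "unit_root Q b * unit_root q 1 = unit_root Q 1"
    proof -
      have "unit_root q 1 = unit_root Q (int q)"
        using unit_root_mult_left[of q q 1] q by (simp add: Q)
      then show ?thesis by (simp add: b_def flip: unit_root_add)
    qed
    have bq: "unit_root Q b ^ q = unit_root q 1"
    proof -
      have "unit_root Q b ^ q = unit_root q b"
        using unit_root_mult_left[of q q b] q by (simp add: Q unit_root_power)
      also have "\<dots> = unit_root q 1"
        using q by (intro unit_root_cong) (auto simp: b_def cong_iff_dvd_diff)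
      finally show ?thesis .
    qed
    have zq: "unit_root Q 1 ^ q = unit_root q 1"
      using unit_root_mult_left[of q q 1] q by (simp add: Q unit_root_power)
    have v_bound: "\<kappa> * max (l 0 x) (l 1 x) \<le> cmod (v x)" if "x \<in> topspace X" for x
      using \<kappa>_bound D(5)[OF that, of 0] D(5)[OF that, of 1] by (simp add: v_def c_def)
    have u1: "cmod (u x) \<le> 1" if "x \<in> topspace X" for x
    proof -
      have "cmod (v x) \<le> cmod (of_real (l 0 x) * unit_root Q (b * h 0 x))
          + cmod (of_real (l 1 x) * c * unit_root Q (b * h 1 x))"
        unfolding v_def by (rule norm_triangle_ineq)
      also have "\<dots> \<le> 1 + 1"
        using D(5,6)[OF that, of 0] D(5,6)[OF that, of 1]
        by (intro add_mono) (auto simp: norm_mult c_def)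
      finally show ?thesis by (simp add: u_def norm_divide)
    qed
    have u_step: "cmod (u y - unit_root Q b * u x) \<le> \<epsilon>" if "(x, y) \<in> E" for x y
    proof -
      have xy: "x \<in> topspace X" "y \<in> topspace X" using that E by auto
      have "cmod (v y - unit_root Q b * v x) \<le> 2 * \<epsilon>"
        unfolding v_def
        using D(5)[OF xy(1), of 0] D(5)[OF xy(1), of 1] D(5)[OF xy(2), of 0] D(5)[OF xy(2), of 1]
          D(9,10)[OF that, of 0] D(9,10)[OF that, of 1] Q
        by (intro two_labels_to_circle) (auto simp: c_def)
      moreover have "u y - unit_root Q b * u x = (v y - unit_root Q b * v x) / 2"
        by (simp add: u_def diff_divide_distrib)
      then have "cmod (u y - unit_root Q b * u x) = cmod (v y - unit_root Q b * v x) / 2"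
        by (simp only: norm_divide norm_numeral)
      ultimately show ?thesis by linarith
    qed
    define W where "W x = (w x ^ q - u x ^ q) / 2" for x
    define dv where "dv a x = vortex_depth q \<eta> \<theta> (w x) (u x) a" for a x
    define \<mu> where "\<mu> x = Max (insert 0 ((\<lambda>a. dv a x) ` {0..<int q}))" for x
    \<comment> \<open>An arbitrary integer where no depth is positive; elsewhere determined modulo q
      by \<open>vortex_unique\<close>.\<close>
    define lab where "lab x = (SOME a. 0 < dv a x)" for x
    have dv_cong: "dv a x = dv a' x" if "[a = a'] (mod int q)" for a a' x
      using vortex_depth_cong[OF q(2) that] by (simp add: dv_def)
    have dv_le: "dv a x \<le> \<mu> x" for a x
    proof -
      have "dv a x = dv (a mod int q) x" by (rule dv_cong) (simp add: cong_def)
      also have "\<dots> \<le> \<mu> x" unfolding \<mu>_def using q by (intro Max_ge) auto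
      finally show ?thesis .
    qed
    have \<mu>0: "0 \<le> \<mu> x" for x by (simp add: \<mu>_def)
    have \<mu>_cases: "\<mu> x = 0 \<or> (\<exists>a. \<mu> x = dv a x)" for x
      using Max_in[of "insert 0 ((\<lambda>a. dv a x) ` {0..<int q})"] by (auto simp: \<mu>_def)
    have lab: "0 < dv (lab x) x" if "0 < \<mu> x" for x
      unfolding lab_def using \<mu>_cases[of x] that by (intro someI_ex[of "\<lambda>a. 0 < dv a x"]) auto
    have dv1: "dv a x \<le> 1" if "x \<in> topspace X" for a x
    proof -
      have "\<eta> * cmod (u x) \<le> 1 * 1" using u1[OF that] \<eta> by (intro mult_mono) auto
      then show ?thesis
        using \<theta> norm_ge_zero[of "w x - u x * unit_root q a"] unfolding dv_def vortex_depth_def by linarith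
    qed
    have dv_step: "\<bar>dv (a + 1) y - dv a x\<bar> \<le> 3 * \<epsilon>" if "(x, y) \<in> E" for a x y
      unfolding dv_def
      by (rule vortex_depth_step[OF D(8)[OF that] u_step[OF that] b1]) (use \<eta> in auto)
    have lc_u: "locally_constant X u"
    proof -
      have "locally_constant X (\<lambda>x. (l 0 x, h 0 x))" "locally_constant X (\<lambda>x. (l 1 x, h 1 x))"
        using locally_constant_comp2[OF D(2)[of 0] D(3)[of 0], of Pair]
          locally_constant_comp2[OF D(2)[of 1] D(3)[of 1], of Pair] by auto
      from locally_constant_comp2[OF this, of "\<lambda>(s, a) (t, a'). (of_real s * unit_root Q (b * a)
        + of_real t * c * unit_root Q (b * a')) / 2"]
      show ?thesis by (simp add: u_def[abs_def] v_def)
    qed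
    note lc = locally_constant_comp2[OF D(1) lc_u]
    have "slow_structure X E q (Suc k) \<delta>' \<epsilon>' W (case_nat \<mu> (\<lambda>i. l (i + 2))) (case_nat lab (\<lambda>i. h (i + 2)))"
      unfolding slow_structure_def
    proof (intro conjI ballI allI impI)
      show "locally_constant X W"
        using lc[of "\<lambda>z u. (z ^ q - u ^ q) / 2"] by (simp add: W_def[abs_def])
      have "locally_constant X \<mu>"
        using lc[of "\<lambda>z u. Max (insert 0 ((\<lambda>a. vortex_depth q \<eta> \<theta> z u a) ` {0..<int q}))"]
        by (simp add: \<mu>_def[abs_def] dv_def)
      then show "locally_constant X ((case_nat \<mu> (\<lambda>i. l (i + 2))) i)" if "i < Suc k" for i
        using that D(2) by (cases i) auto
      have "locally_constant X lab"
        using lc[of "\<lambda>z u. SOME a. 0 < vortex_depth q \<eta> \<theta> z u a"]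
        by (simp add: lab_def[abs_def] dv_def)
      then show "locally_constant X ((case_nat lab (\<lambda>i. h (i + 2))) i)" if "i < Suc k" for i
        using that D(3) by (cases i) auto
    next
      fix x assume x: "x \<in> topspace X"
      have "cmod (w x ^ q - u x ^ q) \<le> cmod (w x ^ q) + cmod (u x ^ q)"
        by (rule norm_triangle_ineq4)
      also have "\<dots> \<le> 1 + 1"
        using D(4)[OF x] u1[OF x] by (intro add_mono) (auto simp: norm_power power_le_one)
      finally show "cmod (W x) \<le> 1" by (simp add: W_def norm_divide)
      show "0 \<le> (case_nat \<mu> (\<lambda>i. l (i + 2))) i x" if "i < Suc k" for i
        using that D(5)[OF x] \<mu>0 by (cases i) auto
      have "\<mu> x \<le> 1" using \<mu>_cases[of x] dv1[OF x] by auto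
      then show "(case_nat \<mu> (\<lambda>i. l (i + 2))) i x \<le> 1" if "i < Suc k" for i
        using that D(6)[OF x] by (cases i) auto
      show "\<delta>' \<le> cmod (W x) \<or> (\<exists>i<Suc k. \<delta>' \<le> (case_nat \<mu> (\<lambda>i. l (i + 2))) i x)"
      proof (cases "\<exists>i<k. \<delta> \<le> l (i + 2) x")
        case True
        then obtain i where "i < k" "\<delta> \<le> l (i + 2) x" by blast
        then show ?thesis by (intro disjI2 exI[of _ "Suc i"]) (auto simp: \<delta>'_def)
      next
        case noL: False
        have main: "\<delta> \<le> cmod (w x) \<or> \<delta> \<le> max (l 0 x) (l 1 x)"
        proof -
          consider "\<delta> \<le> cmod (w x)" | i where "i < Suc (Suc k)" "\<delta> \<le> l i x"
            using D(7)[OF x] by blast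
          then show ?thesis
          proof cases
            case 2
            then have "i = 0 \<or> i = 1" using noL by (cases i; cases "i - 1") auto
            then show ?thesis using 2 by auto
          qed simp
        qed
        show ?thesis
        \<comment> \<open>Far from all zeros the circle W carries the weight, near a zero the new
          label does.\<close>
        proof (cases "\<forall>a. \<theta> \<le> cmod (w x - u x * unit_root q a)")
          case True
          then have "\<theta> ^ q \<le> cmod (w x ^ q - u x ^ q)"
            using q \<theta> by (intro power_diff_lower_bound) auto
          then have "\<delta>' \<le> cmod (W x)" by (simp add: W_def norm_divide \<delta>'_def)
          then show ?thesis ..
        next
          case False
          then obtain a where a: "cmod (w x - u x * unit_root q a) < \<theta>"
            by (meson not_le)
          have "\<rho> \<le> cmod (u x)"
          proof (rule ccontr)
            assume u: "\<not> \<rho> \<le> cmod (u x)"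
            have "\<not> \<delta> \<le> max (l 0 x) (l 1 x)"
            proof
              assume "\<delta> \<le> max (l 0 x) (l 1 x)"
              then have "\<kappa> * \<delta> \<le> \<kappa> * max (l 0 x) (l 1 x)" using \<kappa> by (intro mult_left_mono) auto
              then have "\<kappa> * \<delta> \<le> cmod (v x)" using v_bound[OF x] by linarith
              then show False using u by (simp add: u_def \<rho>_def norm_divide)
            qed
            then have "\<delta> \<le> cmod (w x)" using main by blast
            also have "\<dots> \<le> cmod (w x - u x * unit_root q a) + cmod (u x * unit_root q a)"
              using norm_triangle_ineq[of "w x - u x * unit_root q a" "u x * unit_root q a"] by simp
            also have "\<dots> < \<theta> + \<rho>" using a u by (simp add: norm_mult)
            finally show False using \<theta>_le \<rho> by linarith
          qed
          then have "\<eta> * \<rho> \<le> \<eta> * cmod (u x)" using \<eta> by (intro mult_left_mono) auto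
          then have "2 * \<theta> \<le> dv a x"
            using a by (simp add: dv_def vortex_depth_def \<theta>_def)
          then have "\<delta>' \<le> \<mu> x" using dv_le[of a x] by (simp add: \<delta>'_def)
          then show ?thesis by (intro disjI2 exI[of _ 0]) auto
        qed
      qed
    next
      fix p assume p: "p \<in> E"
      obtain x y where xy: "p = (x, y)" by (cases p)
      then have xyE: "(x, y) \<in> E" using p by simp
      then have xX: "x \<in> topspace X" and yX: "y \<in> topspace X" using E by auto
      have pow: "cmod (z' ^ q - (r * z) ^ q) \<le> q * \<epsilon>"
        if "cmod (z' - r * z) \<le> \<epsilon>" "cmod r = 1" "cmod z \<le> 1" "cmod z' \<le> 1" for z z' r
      proof -
        have "cmod (z' ^ q - (r * z) ^ q) \<le> q * cmod (z' - r * z)"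
          using that by (intro norm_power_diff) (auto simp: norm_mult)
        also have "\<dots> \<le> q * \<epsilon>" using that by (intro mult_left_mono) auto
        finally show ?thesis .
      qed
      have "W y - unit_root q 1 * W x
          = ((w y ^ q - (unit_root Q 1 * w x) ^ q) - (u y ^ q - (unit_root Q b * u x) ^ q)) / 2"
        by (simp add: W_def power_mult_distrib zq bq algebra_simps diff_divide_distrib)
      also have "cmod \<dots> \<le> (q * \<epsilon> + q * \<epsilon>) / 2"
        unfolding norm_divide norm_numeral
        by (intro divide_right_mono order_trans[OF norm_triangle_ineq4 add_mono]
            pow D(8)[OF xyE] u_step[OF xyE] D(4) u1 xX yX norm_unit_root) simp
      also have "(real q * \<epsilon> + real q * \<epsilon>) / 2 = real q * \<epsilon>" by simp
      also have "real q * \<epsilon> \<le> \<epsilon>'" by (rule third[OF q\<epsilon> q\<epsilon>0])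
      finally have W_step: "cmod (W y - unit_root q 1 * W x) \<le> \<epsilon>'" .
      have \<mu>_step: "\<bar>\<mu> y - \<mu> x\<bar> \<le> 3 * \<epsilon>"
      proof -
        have "\<mu> x \<le> \<mu> y + 3 * \<epsilon>"
        proof (cases "\<mu> x = 0")
          case True
          then show ?thesis using \<mu>0[of y] \<epsilon> by simp
        next
          case False
          then obtain a where "\<mu> x = dv a x" using \<mu>_cases[of x] by blast
          then show ?thesis using dv_step[OF xyE, of a] dv_le[of "a + 1" y] by simp
        qed
        moreover have "\<mu> y \<le> \<mu> x + 3 * \<epsilon>"
        proof (cases "\<mu> y = 0")
          case True
          then show ?thesis using \<mu>0[of x] \<epsilon> by simp
        next
          case False
          then obtain a where "\<mu> y = dv a y" using \<mu>_cases[of y] by blast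
          then show ?thesis using dv_step[OF xyE, of "a - 1"] dv_le[of "a - 1" x] by simp
        qed
        ultimately show ?thesis by linarith
      qed
      have lab_step: "[lab y = lab x + 1] (mod int q)" if "0 < \<mu> x" "0 < \<mu> y"
      proof (rule vortex_unique[OF sep \<eta>(1) \<theta>, of "w y" "u y"])
        show "- \<theta> < vortex_depth q \<eta> \<theta> (w y) (u y) (lab y)"
          using lab[OF that(2)] \<theta> by (simp add: dv_def)
        \<comment> \<open>The depth was positive at x and drops by at most 3 \<epsilon>, hence by at
          most \<open>\<theta>\<close>.\<close>
        show "- \<theta> < vortex_depth q \<eta> \<theta> (w y) (u y) (lab x + 1)"
          using lab[OF that(1)] dv_step[OF xyE, of "lab x"] \<epsilon> by (simp add: dv_def)
      qed
      have "cmod (W y - unit_root q 1 * W x) \<le> \<epsilon>' \<and>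
        (\<forall>i<Suc k. \<bar>case_nat \<mu> (\<lambda>i. l (i + 2)) i y - case_nat \<mu> (\<lambda>i. l (i + 2)) i x\<bar> \<le> \<epsilon>' \<and>
           (0 < case_nat \<mu> (\<lambda>i. l (i + 2)) i x \<and> 0 < case_nat \<mu> (\<lambda>i. l (i + 2)) i y \<longrightarrow>
            [case_nat lab (\<lambda>i. h (i + 2)) i y = case_nat lab (\<lambda>i. h (i + 2)) i x + 1] (mod int q)))"
      proof (intro conjI allI impI W_step)
        fix i assume i: "i < Suc k"
        show "\<bar>case_nat \<mu> (\<lambda>i. l (i + 2)) i y - case_nat \<mu> (\<lambda>i. l (i + 2)) i x\<bar> \<le> \<epsilon>'"
        proof (cases i)
          case 0
          then show ?thesis using \<mu>_step \<epsilon>3 by simp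
        next
          case (Suc j)
          then show ?thesis using D(9)[OF xyE, of "j + 2"] i \<epsilon>3 by simp
        qed
        assume pos: "0 < case_nat \<mu> (\<lambda>i. l (i + 2)) i x \<and> 0 < case_nat \<mu> (\<lambda>i. l (i + 2)) i y"
        show "[case_nat lab (\<lambda>i. h (i + 2)) i y = case_nat lab (\<lambda>i. h (i + 2)) i x + 1] (mod int q)"
        proof (cases i)
          case 0
          then show ?thesis using lab_step pos by simp
        next
          case (Suc j)
          then have "[h (j + 2) y = h (j + 2) x + 1] (mod int Q)"
            using D(10)[OF xyE, of "j + 2"] i pos by simp
          then show ?thesis
            using Suc cong_modulus_mult[of _ _ "int q" "int q"] by (simp add: Q)
        qed
      qed
      then show "case p of (x, y) \<Rightarrow> cmod (W y - unit_root q 1 * W x) \<le> \<epsilon>' \<and>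
        (\<forall>i<Suc k. \<bar>case_nat \<mu> (\<lambda>i. l (i + 2)) i y - case_nat \<mu> (\<lambda>i. l (i + 2)) i x\<bar> \<le> \<epsilon>' \<and>
           (0 < case_nat \<mu> (\<lambda>i. l (i + 2)) i x \<and> 0 < case_nat \<mu> (\<lambda>i. l (i + 2)) i y \<longrightarrow>
            [case_nat lab (\<lambda>i. h (i + 2)) i y = case_nat lab (\<lambda>i. h (i + 2)) i x + 1] (mod int q)))"
        using xy by simp
    qed
    then show ?thesis by blast
  qed
  then show ?thesis unfolding has_slow_structures_def using \<delta>' by blast
qed

text \<open>Induction on k for all even q at once, because removing a label at modulus q uses
  structures at modulus q^2.\<close>

lemma has_slow_structures_one_label:
  assumes E: "E \<subseteq> topspace X \<times> topspace X"
    and slow: "\<And>q. even q \<Longrightarrow> q > 0 \<Longrightarrow> has_slow_structures X E q (Suc k)"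
    and q: "even q" "q > 0"
  shows "has_slow_structures X E q 1"
  using slow q
proof (induction k arbitrary: q)
  case 0
  then show ?case by simp
next
  case (Suc k)
  have "has_slow_structures X E q' (Suc k)" if "even q'" "q' > 0" for q'
    using that Suc.prems(1)[of "q'\<^sup>2"] by (intro has_slow_structures_reduce[OF that E]) auto
  then show ?case using Suc by blast
qed

section \<open>Slow structures with one label give homomorphisms to \<open>H\<close>\<close>

text \<open>The array is placed on the square \<open>[-5, 5]\<^sup>2\<close> in the complex plane. Multiplication by
  \<open>-\<i>\<close> preserves the labels of the boundary.\<close>

definition grid_pos :: "nat \<Rightarrow> nat \<Rightarrow> complex" where
  "grid_pos m n = Complex (2 * real m - 5) (2 * real n - 5)"

text \<open>Grid points are 2 apart, so the bound is one grid step in the l1 norm.\<close>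

definition near_grid :: "nat \<Rightarrow> nat \<Rightarrow> complex \<Rightarrow> bool" where
  "near_grid m n p \<longleftrightarrow> m \<le> 5 \<and> n \<le> 5 \<and> \<bar>Re (grid_pos m n - p)\<bar> + \<bar>Im (grid_pos m n - p)\<bar> \<le> 2"

definition on_boundary :: "nat \<Rightarrow> nat \<Rightarrow> bool" where
  "on_boundary m n \<longleftrightarrow> m = 0 \<or> m = 5 \<or> n = 0 \<or> n = 5"

lemma interval_step:
  assumes "\<bar>t\<bar> \<le> (5::real)"
  obtains m :: nat where "m \<le> 4" "2 * real m - 5 \<le> t" "t \<le> 2 * real m - 3"
proof -
  consider "t \<le> -3" | "-3 \<le> t" "t \<le> -1" | "-1 \<le> t" "t \<le> 1" | "1 \<le> t" "t \<le> 3" | "3 \<le> t"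
    by linarith
  then show ?thesis
    by cases (use assms that[of 0] that[of 1] that[of 2] that[of 3] that[of 4] in auto)
qed

text \<open>Opposite corners of a cell have the same parity, and their l1 distances to a point of
  the cell add up to 4, so one of them is within 2.\<close>

lemma near_grid_exists:
  assumes "\<bar>Re p\<bar> \<le> 5" "\<bar>Im p\<bar> \<le> 5"
  shows "\<exists>m n. near_grid m n p \<and> (even (m + n) \<longleftrightarrow> e)"
proof -
  obtain m where m: "m \<le> 4" "2 * real m - 5 \<le> Re p" "Re p \<le> 2 * real m - 3"
    using interval_step[OF assms(1)] by blast
  obtain n where n: "n \<le> 4" "2 * real n - 5 \<le> Im p" "Im p \<le> 2 * real n - 3"
    using interval_step[OF assms(2)] by blast
  have "near_grid m n p \<or> near_grid (Suc m) (Suc n) p"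
    using m n unfolding near_grid_def grid_pos_def by simp linarith
  moreover have "near_grid m (Suc n) p \<or> near_grid (Suc m) n p"
    using m n unfolding near_grid_def grid_pos_def by simp linarith
  moreover have "even (m + n) = even (Suc m + Suc n)" "even (m + Suc n) = even (Suc m + n)"
    "even (m + n) \<noteq> even (m + Suc n)"
    by auto
  ultimately show ?thesis by metis
qed

text \<open>A point on a side lies between two consecutive grid points of that side; both are near,
  and one of them is even.\<close>

lemma near_grid_boundary_exists:
  assumes "\<bar>Re p\<bar> \<le> 5" "\<bar>Im p\<bar> \<le> 5" "\<bar>Re p\<bar> = 5 \<or> \<bar>Im p\<bar> = 5"
  shows "\<exists>m n. near_grid m n p \<and> even (m + n) \<and> on_boundary m n"
  using assms(3)
proof
  assume r: "\<bar>Re p\<bar> = 5"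
  obtain m :: nat where m: "m = 0 \<or> m = 5" "2 * real m - 5 = Re p"
    using r by (cases "Re p < 0") auto
  obtain n where n: "n \<le> 4" "2 * real n - 5 \<le> Im p" "Im p \<le> 2 * real n - 3"
    using interval_step[OF assms(2)] by blast
  have "near_grid m n p" "near_grid m (Suc n) p"
    using m n unfolding near_grid_def grid_pos_def by auto
  moreover have "even (m + n) \<or> even (m + Suc n)" by auto
  ultimately show ?thesis using m unfolding on_boundary_def by blast
next
  assume r: "\<bar>Im p\<bar> = 5"
  obtain n :: nat where n: "n = 0 \<or> n = 5" "2 * real n - 5 = Im p"
    using r by (cases "Im p < 0") auto
  obtain m where m: "m \<le> 4" "2 * real m - 5 \<le> Re p" "Re p \<le> 2 * real m - 3"
    using interval_step[OF assms(1)] by blast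
  have "near_grid m n p" "near_grid (Suc m) n p"
    using m n unfolding near_grid_def grid_pos_def by auto
  moreover have "even (m + n) \<or> even (Suc m + n)" by auto
  ultimately show ?thesis using n unfolding on_boundary_def by blast
qed

lemma le_5_cases: "n \<le> 5 \<Longrightarrow> n = 0 \<or> n = 1 \<or> n = 2 \<or> n = 3 \<or> n = 4 \<or> n = (5::nat)"
  by linarith

text \<open>All four sides spell the same word in the same cyclic direction, so a quarter turn
  carries boundary positions to positions with equal labels.\<close>

lemma H_array_rotate:
  assumes "m \<le> 5" "n \<le> 5" "on_boundary m n"
  shows "H_array ! n ! (5 - m) = H_array ! m ! n"
  using le_5_cases[OF assms(1)] le_5_cases[OF assms(2)] assms(3)
  by (elim disjE) (simp_all add: H_array_def on_boundary_def)

lemma near_grid_rotate: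
  assumes "near_grid m n p"
  shows "near_grid n (5 - m) (- \<i> * p)"
proof -
  have le: "m \<le> 5" "n \<le> 5"
    and N: "\<bar>2 * real m - 5 - Re p\<bar> + \<bar>2 * real n - 5 - Im p\<bar> \<le> 2"
    using assms by (simp_all add: near_grid_def grid_pos_def)
  have "real (5 - m) = 5 - real m" using le by (simp add: of_nat_diff)
  then have "Re (grid_pos n (5 - m) - - \<i> * p) = 2 * real n - 5 - Im p"
    "Im (grid_pos n (5 - m) - - \<i> * p) = - (2 * real m - 5 - Re p)"
    by (simp_all add: grid_pos_def)
  then show ?thesis using le N unfolding near_grid_def by (simp only: abs_minus_cancel) simp
qed

text \<open>Each approximation costs at most one grid step and \<open>p\<close>, \<open>p'\<close>
  differ by less than one, so the grid points are fewer than three steps apart. Different parity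
  leaves exactly one step.\<close>

lemma near_grid_adj:
  assumes "near_grid m n p" "near_grid m' n' p'" "even (m + n) \<noteq> even (m' + n')"
    and "\<bar>Re (p - p')\<bar> + \<bar>Im (p - p')\<bar> < 2"
  shows "adj H_graph (H_array ! m ! n) (H_array ! m' ! n')"
proof -
  have le: "m \<le> 5" "n \<le> 5" "m' \<le> 5" "n' \<le> 5" using assms by (auto simp: near_grid_def)
  have tri: "2 * \<bar>a - a'\<bar> \<le> \<bar>2 * a - 5 - r\<bar> + \<bar>2 * a' - 5 - r'\<bar> + \<bar>r - r'\<bar>" for a a' r r' :: real
    using abs_triangle_ineq[of "(2 * a - 5 - r) - (2 * a' - 5 - r')" "r - r'"]
      abs_triangle_ineq4[of "2 * a - 5 - r" "2 * a' - 5 - r'"] abs_mult[of 2 "a - a'"]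
    by (simp add: algebra_simps)
  have six: "x + y < 6" if "x \<le> a + b + c" "y \<le> a' + b' + c'" "a + a' \<le> 2" "b + b' \<le> 2" "c + c' < 2"
    for x y a b c a' b' c' :: real
    using that by linarith
  have "2 * \<bar>real m - real m'\<bar> + 2 * \<bar>real n - real n'\<bar> < 6"
  proof (rule six[OF tri tri])
    show "\<bar>2 * real m - 5 - Re p\<bar> + \<bar>2 * real n - 5 - Im p\<bar> \<le> 2"
      "\<bar>2 * real m' - 5 - Re p'\<bar> + \<bar>2 * real n' - 5 - Im p'\<bar> \<le> 2"
      using assms(1,2) by (simp_all add: near_grid_def grid_pos_def)
    show "\<bar>Re p - Re p'\<bar> + \<bar>Im p - Im p'\<bar> < 2" using assms(4) by simp
  qed
  then have "real_of_int (\<bar>int m - int m'\<bar> + \<bar>int n - int n'\<bar>) < 3" by simp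
  then have "\<bar>int m - int m'\<bar> + \<bar>int n - int n'\<bar> < 3" by linarith
  moreover have "odd (\<bar>int m - int m'\<bar> + \<bar>int n - int n'\<bar>)"
  proof -
    have "even (\<bar>int a - int b\<bar>) \<longleftrightarrow> (even a \<longleftrightarrow> even b)" for a b by simp
    then show ?thesis using assms(3) by auto
  qed
  moreover have "k = 1" if "odd k" "k < 3" "0 \<le> k" for k :: int
    using that by presburger
  ultimately have "\<bar>int m - int m'\<bar> + \<bar>int n - int n'\<bar> = 1" by simp
  then have "(m = m' \<and> \<bar>int n - int n'\<bar> = 1) \<or> (n = n' \<and> \<bar>int m - int m'\<bar> = 1)"
    by (cases "m = m'"; cases "n = n'") auto
  then consider "m = m'" "n' = Suc n" | "m = m'" "n = Suc n'" | "n = n'" "m' = Suc m" | "n = n'" "m = Suc m'"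
    by linarith
  then show ?thesis
  proof cases
    case 1
    then show ?thesis using le unfolding H_graph_def graph.simps
      by (intro disjI1 exI[of _ m] exI[of _ n] conjI) auto
  next
    case 2
    then show ?thesis using le unfolding H_graph_def graph.simps
      by (intro disjI1 exI[of _ m] exI[of _ n'] conjI) auto
  next
    case 3
    then show ?thesis using le unfolding H_graph_def graph.simps
      by (intro disjI2 exI[of _ m] exI[of _ n] conjI) auto
  next
    case 4
    then show ?thesis using le unfolding H_graph_def graph.simps
      by (intro disjI2 exI[of _ m'] exI[of _ n] conjI) auto
  qed
qed

definition clamp_square :: "complex \<Rightarrow> complex" where
  "clamp_square z = Complex (max (-5) (min 5 (Re z))) (max (-5) (min 5 (Im z)))"

lemma clamp_square_bound: "\<bar>Re (clamp_square z)\<bar> \<le> 5" "\<bar>Im (clamp_square z)\<bar> \<le> 5"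
  by (auto simp: clamp_square_def)

lemma clamp_square_rotate: "clamp_square (- \<i> * z) = - \<i> * clamp_square z"
  by (auto simp: clamp_square_def complex_eq_iff max_def min_def)

lemma clamp_square_diff:
  "\<bar>Re (clamp_square z - clamp_square z')\<bar> + \<bar>Im (clamp_square z - clamp_square z')\<bar>
     \<le> 2 * cmod (z - z')"
proof -
  have "\<bar>Re (clamp_square z - clamp_square z')\<bar> \<le> \<bar>Re (z - z')\<bar>"
    "\<bar>Im (clamp_square z - clamp_square z')\<bar> \<le> \<bar>Im (z - z')\<bar>"
    by (auto simp: clamp_square_def)
  then show ?thesis
    using abs_Re_le_cmod[of "z - z'"] abs_Im_le_cmod[of "z - z'"] by linarith
qed

text \<open>\<open>a\<close> is the sheet of the universal cover and \<open>z\<close> the position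
  on it; turning by \<open>unit_root 4 (- a)\<close> projects the sheet to the array. A generator
  adds one to \<open>a\<close> and turns \<open>z\<close> by about \<i>, so the projected position
  hardly moves and only the prescribed parity of the grid point flips. This is what makes the new
  label adjacent to the old one.\<close>

definition grid_label :: "int \<Rightarrow> complex \<Rightarrow> nat \<Rightarrow> bool" where
  "grid_label a z c \<longleftrightarrow>
     (\<exists>m n. near_grid m n (clamp_square (unit_root 4 (- a) * z)) \<and> even (int (m + n) - a) \<and>
        c = H_array ! m ! n)"

lemma grid_label_cong:
  assumes "[a = b] (mod 4)" "grid_label a z c"
  shows "grid_label b z c"
proof -
  have r: "unit_root 4 (- a) = unit_root 4 (- b)"
    using assms(1) by (intro unit_root_cong) (auto simp: cong_minus_minus_iff)
  have e: "even (k - a) \<longleftrightarrow> even (k - b)" for k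
    using assms(1) unfolding cong_iff_dvd_diff by presburger
  show ?thesis
    using assms(2) by (simp only: grid_label_def r e)
qed

lemma grid_label_exists: "\<exists>c. grid_label a z c"
  using near_grid_exists[OF clamp_square_bound, of "unit_root 4 (- a) * z" "even a"]
  unfolding grid_label_def by (auto simp: even_diff)

lemma unit_root_4_minus_1: "unit_root 4 (- 1) = - \<i>"
  by (simp add: unit_root_def complex_eq_iff)

text \<open>The sheets share their boundary, so one vertex can serve them all: going from sheet k to
  k + 1 replaces (m, n) by (n, 5 - m), which keeps the label and, 5 being odd, flips the parity as
  required.\<close>

lemma grid_label_boundary_exists:
  assumes "5 \<le> \<bar>Re z\<bar> \<or> 5 \<le> \<bar>Im z\<bar>"
  shows "\<exists>c. \<forall>a. grid_label a z c"
proof -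
  have "\<bar>Re (clamp_square z)\<bar> = 5 \<or> \<bar>Im (clamp_square z)\<bar> = 5"
    using assms by (auto simp: clamp_square_def)
  then obtain m n where mn: "near_grid m n (clamp_square z)" "even (m + n)" "on_boundary m n"
    using near_grid_boundary_exists[OF clamp_square_bound] by blast
  define c where "c = H_array ! m ! n"
  have nat: "\<exists>m' n'. near_grid m' n' (clamp_square (unit_root 4 (- int k) * z)) \<and>
      even (int (m' + n') - int k) \<and> on_boundary m' n' \<and> c = H_array ! m' ! n'" for k
  proof (induction k)
    case 0
    show ?case using mn by (intro exI[of _ m] exI[of _ n]) (auto simp: c_def)
  next
    case (Suc k)
    then obtain m' n' where IH: "near_grid m' n' (clamp_square (unit_root 4 (- int k) * z))"
      "even (int (m' + n') - int k)" "on_boundary m' n'" "c = H_array ! m' ! n'"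
      by blast
    have le: "m' \<le> 5" "n' \<le> 5" using IH(1) by (auto simp: near_grid_def)
    have "unit_root 4 (- int (Suc k)) * z = - \<i> * (unit_root 4 (- int k) * z)"
      using unit_root_add[of 4 "-1" "- int k"] by (simp add: unit_root_4_minus_1)
    then have "near_grid n' (5 - m') (clamp_square (unit_root 4 (- int (Suc k)) * z))"
      using near_grid_rotate[OF IH(1)] by (simp only: clamp_square_rotate)
    moreover have "even (int (n' + (5 - m')) - int (Suc k))"
      using IH(2) le(1) by (auto simp: of_nat_diff)
    moreover have "on_boundary n' (5 - m')" using IH(3) le by (auto simp: on_boundary_def)
    moreover have "c = H_array ! n' ! (5 - m')" using H_array_rotate[OF le IH(3)] IH(4) by simp
    ultimately show ?case by blast
  qed
  have "grid_label a z c" for a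
  proof (rule grid_label_cong)
    show "[int (nat (a mod 4)) = a] (mod 4)" by (simp add: cong_def)
    show "grid_label (int (nat (a mod 4))) z c"
      using nat[of "nat (a mod 4)"] unfolding grid_label_def by blast
  qed
  then show ?thesis by blast
qed

lemma grid_label_adj:
  assumes "grid_label a z c" "grid_label (a + 1) z' c'" "cmod (z' - \<i> * z) < 1"
  shows "adj H_graph c c'"
proof -
  obtain m n where 1: "near_grid m n (clamp_square (unit_root 4 (- a) * z))"
    "even (int (m + n) - a)" "c = H_array ! m ! n"
    using assms(1) unfolding grid_label_def by blast
  obtain m' n' where 2: "near_grid m' n' (clamp_square (unit_root 4 (- (a + 1)) * z'))"
    "even (int (m' + n') - (a + 1))" "c' = H_array ! m' ! n'"
    using assms(2) unfolding grid_label_def by blast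
  have par: "even (m + n) \<noteq> even (m' + n')" using 1(2) 2(2) by auto
  have "unit_root 4 (- a) * z - unit_root 4 (- (a + 1)) * z'
      = - unit_root 4 (- (a + 1)) * (z' - \<i> * z)"
    using unit_root_add[of 4 "-1" "- a"] by (simp add: unit_root_4_minus_1 algebra_simps)
  then have "cmod (unit_root 4 (- a) * z - unit_root 4 (- (a + 1)) * z') < 1"
    using assms(3) by (simp add: norm_mult)
  then show ?thesis
    unfolding 1(3) 2(3)
    using clamp_square_diff[of "unit_root 4 (- a) * z" "unit_root 4 (- (a + 1)) * z'"]
    by (intro near_grid_adj[OF 1(1) 2(1) par]) linarith
qed

lemma grid_label_verts:
  assumes "grid_label a z c" shows "c \<in> verts H_graph"
  using assms unfolding grid_label_def near_grid_def H_graph_def graph.simps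
  by (force simp: less_Suc_eq_le numeral_eq_Suc)

text \<open>Where |w| is below \<open>\<delta>\<close> the label has positive weight and can be
  trusted as the sheet. Elsewhere the rescaled w is at or beyond the boundary of the square, and a
  vertex valid on all sheets makes the untrustworthy label irrelevant.\<close>

lemma H_coloring_of_slow_structures:
  assumes E: "E \<subseteq> topspace X \<times> topspace X" and slow: "has_slow_structures X E 4 1"
  shows "\<exists>c. locally_constant X c \<and> (\<forall>x. c x \<in> verts H_graph) \<and> (\<forall>(x, y)\<in>E. adj H_graph (c x) (c y))"
proof -
  obtain \<delta> where \<delta>: "\<delta> > 0"
    and ex: "\<And>\<epsilon>. \<epsilon> > 0 \<Longrightarrow> \<exists>w l h. slow_structure X E 4 1 \<delta> \<epsilon> w l h"
    using slow unfolding has_slow_structures_def by blast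
  \<comment> \<open>After scaling by 10 / \<delta>, a point inside the open square has modulus below
    10, hence |w| below \<open>\<delta>\<close>, and the error per step is 1/2, below the bound 1 of
    \<open>grid_label_adj\<close>.\<close>
  obtain w l h where S: "slow_structure X E 4 1 \<delta> (\<delta> / 20) w l h"
    using ex[of "\<delta> / 20"] \<delta> by auto
  note D = slow_structureD[OF S]
  define z where "z x = of_real (10 / \<delta>) * w x" for x
  define big where "big z \<longleftrightarrow> 5 \<le> \<bar>Re z\<bar> \<or> 5 \<le> \<bar>Im z\<bar>" for z
  define C where "C z a = (if big z then SOME c. \<forall>a. grid_label a z c else SOME c. grid_label a z c)"
    for z a
  define c where "c x = C (z x) (h 0 x)" for x
  have C_big: "grid_label a z (C z b)" if "big z" for a b z
    using someI_ex[OF grid_label_boundary_exists[of z]] that by (auto simp: C_def big_def)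
  have C: "grid_label a z (C z a)" for a z
    using C_big[of z a a] someI_ex[OF grid_label_exists[of a z]] by (auto simp: C_def)
  have "locally_constant X (\<lambda>x. C (of_real (10 / \<delta>) * w x) (h 0 x))"
    using locally_constant_comp2[OF D(1) D(3)[of 0], of "\<lambda>w a. C (of_real (10 / \<delta>) * w) a"] by simp
  then have lc: "locally_constant X c" by (simp add: c_def[abs_def] z_def)
  have pos: "0 < l 0 x" if x: "x \<in> topspace X" and small: "\<not> big (z x)" for x
  proof -
    have "cmod (z x) < 10"
      using cmod_le[of "z x"] small by (simp add: big_def)
    then have "cmod (w x) < \<delta>" using \<delta> by (simp add: z_def norm_mult norm_divide field_simps)
    then show ?thesis using D(7)[OF x] \<delta> by auto
  qed
  have "adj H_graph (c x) (c y)" if xy: "(x, y) \<in> E" for x y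
  proof -
    have X: "x \<in> topspace X" "y \<in> topspace X" using xy E by auto
    have "unit_root 4 1 = \<i>" by (simp add: unit_root_def complex_eq_iff)
    then have "z y - \<i> * z x = of_real (10 / \<delta>) * (w y - unit_root 4 1 * w x)"
      unfolding z_def by (simp only: right_diff_distrib mult.left_commute)
    then have "cmod (z y - \<i> * z x) = \<bar>10 / \<delta>\<bar> * cmod (w y - unit_root 4 1 * w x)"
      by (simp only: norm_mult norm_of_real)
    also have "\<bar>10 / \<delta>\<bar> = 10 / \<delta>" using \<delta> by simp
    also have "10 / \<delta> * cmod (w y - unit_root 4 1 * w x) \<le> 10 / \<delta> * (\<delta> / 20)" using D(8)[OF xy] \<delta> by (intro mult_left_mono) auto
    also have "\<dots> < 1" using \<delta> by simp
    finally have step: "cmod (z y - \<i> * z x) < 1" .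
    have "\<exists>a. grid_label a (z x) (c x) \<and> grid_label (a + 1) (z y) (c y)"
    proof (cases "big (z x)")
      case True
      \<comment> \<open>The color of x is valid on every sheet, so the sheet may be dictated by
        y.\<close>
      then show ?thesis
        using C_big[OF True] C[of "h 0 y" "z y"] by (intro exI[of _ "h 0 y - 1"]) (simp add: c_def)
    next
      case small: False
      show ?thesis
      proof (cases "big (z y)")
        case True
        then show ?thesis
          using C_big[OF True] C[of "h 0 x" "z x"] by (intro exI[of _ "h 0 x"]) (simp add: c_def)
      next
        case False
        then have "[h 0 y = h 0 x + 1] (mod 4)"
          using D(10)[OF xy, of 0] pos[OF X(1) small] pos[OF X(2)] by simp
        then show ?thesis
          using C[of "h 0 x" "z x"] grid_label_cong[OF _ C[of "h 0 y" "z y"]]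
          by (intro exI[of _ "h 0 x"]) (simp add: c_def)
      qed
    qed
    then show ?thesis using grid_label_adj step by blast
  qed
  moreover have "c x \<in> verts H_graph" for x
    using grid_label_verts[OF C] by (simp add: c_def)
  ultimately show ?thesis using lc by blast
qed

section \<open>Zero-dimensional Polish spaces\<close>

lemma metrizable_separable_imp_second_countable:
  assumes "metrizable_space X" "separable_space X"
  shows "second_countable X"
proof -
  obtain M m where M: "Metric_space M m" and X: "X = Metric_space.mtopology M m"
    using assms(1) unfolding metrizable_space_def by blast
  interpret Metric_space M m by (rule M)
  obtain C where C: "countable C" "C \<subseteq> M" "mtopology closure_of C = M"
    using assms(2) unfolding separable_space_def X by auto
  define \<B> where "\<B> = (\<lambda>(c, n). mball c (1 / real (Suc n))) ` (C \<times> (UNIV :: nat set))"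
  have "\<exists>V\<in>\<B>. x \<in> V \<and> V \<subseteq> U" if U: "openin mtopology U" "x \<in> U" for U x
  proof -
    have x: "x \<in> M" using U openin_subset by fastforce
    obtain e where e: "e > 0" "mball x e \<subseteq> U"
      using U unfolding openin_mtopology by blast
    obtain n where n: "1 / real (Suc n) < e / 2"
      using reals_Archimedean[of "e / 2"] e by (auto simp: inverse_eq_divide)
    have "\<forall>r>0. \<exists>c\<in>C. c \<in> mball x r" using C(3) x unfolding metric_closure_of by blast
    moreover have "0 < 1 / real (Suc n)" by simp
    ultimately obtain c where c: "c \<in> C" "c \<in> mball x (1 / real (Suc n))" by blast
    have "mball c (1 / real (Suc n)) \<subseteq> mball x e"
    proof
      fix y assume y: "y \<in> mball c (1 / real (Suc n))"
      then have "m x y \<le> m x c + m c y" using c x by (intro triangle) auto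
      also have "\<dots> < e / 2 + e / 2" using y c n by (intro add_strict_mono) (auto intro: less_trans)
      finally show "y \<in> mball x e" using y x by auto
    qed
    then show ?thesis
      using c e x unfolding \<B>_def by (intro bexI[of _ "mball c (1 / real (Suc n))"]) (auto simp: commute)
  qed
  moreover have "countable \<B>" using C(1) by (auto simp: \<B>_def)
  moreover have "openin mtopology V" if "V \<in> \<B>" for V using that by (auto simp: \<B>_def)
  ultimately show ?thesis unfolding second_countable_def X by metis
qed

text \<open>The index is the first member of a countable clopen subcover containing the point. Its
  level sets are open because the finitely many earlier members are closed.\<close>

lemma clopen_countable_index:
  assumes "Lindelof_space X"
    and cover: "\<And>x. x \<in> topspace X \<Longrightarrow> \<exists>V. openin X V \<and> closedin X V \<and> x \<in> V \<and> R V"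
  shows "\<exists>\<nu> :: 'a \<Rightarrow> nat. locally_constant X \<nu> \<and>
    (\<forall>x\<in>topspace X. \<exists>V. R V \<and> x \<in> V \<and> (\<forall>y\<in>topspace X. \<nu> y = \<nu> x \<longrightarrow> y \<in> V))"
proof (cases "topspace X = {}")
  case True
  then show ?thesis by (auto simp: locally_constant_def)
next
  case False
  define \<U> where "\<U> = {V. openin X V \<and> closedin X V \<and> R V}"
  have "\<Union>\<U> = topspace X"
    using cover by (auto simp: \<U>_def dest: openin_subset)
  then obtain \<V> where \<V>: "countable \<V>" "\<V> \<subseteq> \<U>" "\<Union>\<V> = topspace X"
    using Lindelof_spaceD[OF assms(1), of \<U>] by (auto simp: \<U>_def)
  have ne: "\<V> \<noteq> {}" using \<V>(3) False by (metis Union_empty)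
  define V where "V = from_nat_into \<V>"
  have V: "openin X (V n)" "closedin X (V n)" "R (V n)" for n
    using from_nat_into[OF ne, of n] \<V>(2) by (auto simp: V_def \<U>_def)
  have Un: "\<exists>n. x \<in> V n" if "x \<in> topspace X" for x
    using that \<V> range_from_nat_into[OF ne \<V>(1)] unfolding V_def by (metis UnionE image_iff)
  define \<nu> where "\<nu> x = (LEAST n. x \<in> V n)" for x
  have \<nu>: "x \<in> V (\<nu> x)" if "x \<in> topspace X" for x
    unfolding \<nu>_def by (rule LeastI_ex) (rule Un[OF that])
  have "locally_constant X \<nu>"
  proof (rule locally_constantI)
    fix x assume x: "x \<in> topspace X"
    define U where "U = V (\<nu> x) \<inter> (topspace X - (\<Union>n<\<nu> x. V n))"
    have "openin X U"
      unfolding U_def using V by (intro openin_Int openin_diff closedin_Union) auto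
    moreover have "x \<notin> V n" if "n < \<nu> x" for n
      using that unfolding \<nu>_def by (rule not_less_Least)
    then have "x \<in> U" using \<nu>[OF x] x by (simp add: U_def)
    moreover have "\<nu> y = \<nu> x" if "y \<in> U" for y
      unfolding \<nu>_def[of y] using that by (intro Least_equality) (auto simp: U_def not_less[symmetric])
    ultimately show "\<exists>U. openin X U \<and> x \<in> U \<and> (\<forall>y\<in>U. \<nu> y = \<nu> x)" by blast
  qed
  moreover have "\<exists>W. R W \<and> x \<in> W \<and> (\<forall>y\<in>topspace X. \<nu> y = \<nu> x \<longrightarrow> y \<in> W)" if "x \<in> topspace X" for x
    using \<nu> V that by (intro exI[of _ "V (\<nu> x)"]) metis
  ultimately show ?thesis by blast
qed

section \<open>Greedy colorings for free actions\<close>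

locale free_Zd_space =
  fixes d :: nat and X :: "'a topology" and act :: "(nat \<Rightarrow> int) \<Rightarrow> 'a \<Rightarrow> 'a"
  assumes polish: "polish X" and zero_dim: "zero_dimensional X"
    and action: "continuous_Zd_action d X act" and free: "free_Zd_action d X act"
begin

abbreviation G where "G \<equiv> carrier (Zd d)"

definition plus_Zd :: "(nat \<Rightarrow> int) \<Rightarrow> (nat \<Rightarrow> int) \<Rightarrow> nat \<Rightarrow> int" where
  "plus_Zd g h = (\<lambda>i\<in>{..<d}. g i + h i)"

definition minus_Zd :: "(nat \<Rightarrow> int) \<Rightarrow> (nat \<Rightarrow> int) \<Rightarrow> nat \<Rightarrow> int" where
  "minus_Zd g h = (\<lambda>i\<in>{..<d}. g i - h i)"

definition zero_Zd :: "nat \<Rightarrow> int" where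
  "zero_Zd = (\<lambda>i\<in>{..<d}. 0)"

lemma G_iff: "g \<in> G \<longleftrightarrow> g \<in> extensional {..<d}"
  by (auto simp: Zd_def PiE_def)

lemma G_closed [simp]: "plus_Zd g h \<in> G" "minus_Zd g h \<in> G" "zero_Zd \<in> G" "unit_vec d j \<in> G"
  by (auto simp: G_iff plus_Zd_def minus_Zd_def zero_Zd_def unit_vec_def)

lemma Zd_nth [simp]:
  assumes "i < d"
  shows "plus_Zd g h i = g i + h i" "minus_Zd g h i = g i - h i" "zero_Zd i = 0"
  using assms by (simp_all add: plus_Zd_def minus_Zd_def zero_Zd_def)

lemma G_eqI: "g \<in> G \<Longrightarrow> h \<in> G \<Longrightarrow> (\<And>i. i < d \<Longrightarrow> g i = h i) \<Longrightarrow> g = h"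
  by (auto simp: G_iff intro: extensionalityI)

lemma plus_minus_Zd: "g \<in> G \<Longrightarrow> plus_Zd (minus_Zd g h) h = g"
  by (rule G_eqI) simp_all

lemma group_act: "group_action (Zd d) (topspace X) act"
  and continuous_act: "g \<in> G \<Longrightarrow> continuous_map X X (act g)"
  using action by (auto simp: continuous_Zd_action_def)

lemma act_closed [simp]: "g \<in> G \<Longrightarrow> x \<in> topspace X \<Longrightarrow> act g x \<in> topspace X"
  using continuous_act by (auto simp: continuous_map_def)

lemma act_plus: "g \<in> G \<Longrightarrow> h \<in> G \<Longrightarrow> x \<in> topspace X \<Longrightarrow> act g (act h x) = act (plus_Zd g h) x"
  using group_action.composition_rule[OF group_act, of x g h] by (simp add: Zd_def plus_Zd_def)

lemma act_zero [simp]: "x \<in> topspace X \<Longrightarrow> act zero_Zd x = x"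
  using group_action.id_eq_one[OF group_act] by (simp add: Zd_def zero_Zd_def fun_eq_iff) metis

lemma act_eqD:
  assumes "g \<in> G" "h \<in> G" "x \<in> topspace X" "act g x = act h x"
  shows "g = h"
proof -
  have "act (minus_Zd g h) (act h x) = act h x"
    using assms by (simp add: act_plus plus_minus_Zd)
  then have "minus_Zd g h = \<one>\<^bsub>Zd d\<^esub>"
    using free act_closed[OF assms(2,3)] G_closed(2)[of g h] unfolding free_Zd_action_def by blast
  then have "minus_Zd g h = zero_Zd" by (simp add: Zd_def zero_Zd_def)
  then have "g i - h i = 0" if "i < d" for i
    using Zd_nth(2,3)[OF that] by metis
  then show ?thesis using assms by (intro G_eqI) auto
qed

lemma act_minus:
  "g \<in> G \<Longrightarrow> h \<in> G \<Longrightarrow> x \<in> topspace X \<Longrightarrow> act (minus_Zd g h) (act h x) = act g x"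
  by (simp add: act_plus plus_minus_Zd)

lemma Lindelof: "Lindelof_space X"
  using polish unfolding polish_def
  by (intro second_countable_imp_Lindelof_space metrizable_separable_imp_second_countable
      completely_metrizable_imp_metrizable_space) auto

lemma Hausdorff: "Hausdorff_space X"
  using polish unfolding polish_def
  by (intro metrizable_imp_Hausdorff_space completely_metrizable_imp_metrizable_space) auto

text \<open>Freeness and the Hausdorff property give every point a clopen neighborhood that each of
  the finitely many nonzero \<open>g\<close> moves off itself.\<close>

lemma separating_index:
  assumes "finite B" "B \<subseteq> G"
  shows "\<exists>\<nu> :: 'a \<Rightarrow> nat. locally_constant X \<nu> \<and>
    (\<forall>x\<in>topspace X. \<forall>g\<in>B. g \<noteq> zero_Zd \<longrightarrow> \<nu> (act g x) \<noteq> \<nu> x)"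
proof -
  define R where "R V \<longleftrightarrow> (\<forall>g\<in>B. g \<noteq> zero_Zd \<longrightarrow> (\<forall>y\<in>V. act g y \<notin> V))" for V
  have "\<exists>V. openin X V \<and> closedin X V \<and> x \<in> V \<and> R V" if x: "x \<in> topspace X" for x
  proof -
    have "\<exists>U. openin X U \<and> x \<in> U \<and> (\<forall>y\<in>U. act g y \<notin> U)" if g: "g \<in> B" "g \<noteq> zero_Zd" for g
    proof -
      have gG: "g \<in> G" using g assms by auto
      have "act g x \<noteq> x" using act_eqD[OF gG, of zero_Zd x] g x by auto
      then obtain U V where UV: "openin X U" "openin X V" "x \<in> U" "act g x \<in> V" "disjnt U V"
        using Hausdorff x gG unfolding Hausdorff_space_def by (metis act_closed)
      have "openin X {y \<in> topspace X. act g y \<in> V}"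
        using openin_continuous_map_preimage[OF continuous_act[OF gG] UV(2)] .
      then show ?thesis
        using UV x by (intro exI[of _ "U \<inter> {y \<in> topspace X. act g y \<in> V}"]) (auto simp: disjnt_iff)
    qed
    then obtain U where U: "\<And>g. g \<in> B - {zero_Zd} \<Longrightarrow> openin X (U g) \<and> x \<in> U g \<and> (\<forall>y\<in>U g. act g y \<notin> U g)"
      by (metis DiffE insertI1)
    define W where "W = topspace X \<inter> (\<Inter>g\<in>B - {zero_Zd}. U g)"
    have "openin X W \<and> x \<in> W"
    proof (cases "B - {zero_Zd} = {}")
      case True
      then show ?thesis using x unfolding W_def True by simp
    next
      case False
      then have "openin X (\<Inter>g\<in>B - {zero_Zd}. U g)"
        using assms(1) U by (intro openin_INT2) auto
      then show ?thesis using x U by (auto simp: W_def)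
    qed
    then obtain V where V: "openin X V" "closedin X V" "x \<in> V" "V \<subseteq> W"
      using zero_dim unfolding zero_dimensional_def by (metis (no_types, lifting))
    have "R V"
      unfolding R_def
    proof (intro ballI impI notI)
      fix g y assume "g \<in> B" "g \<noteq> zero_Zd" "y \<in> V" "act g y \<in> V"
      then have "g \<in> B - {zero_Zd}" "y \<in> U g" "act g y \<in> U g" using V(4) by (auto simp: W_def)
      then show False using U by blast
    qed
    then show ?thesis using V by blast
  qed
  from clopen_countable_index[OF Lindelof this]
  obtain \<nu> :: "'a \<Rightarrow> nat" where \<nu>: "locally_constant X \<nu>"
    "\<And>x. x \<in> topspace X \<Longrightarrow> \<exists>V. R V \<and> x \<in> V \<and> (\<forall>y\<in>topspace X. \<nu> y = \<nu> x \<longrightarrow> y \<in> V)"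
    by blast
  have "\<nu> (act g x) \<noteq> \<nu> x" if "x \<in> topspace X" "g \<in> B" "g \<noteq> zero_Zd" for x g
  proof
    assume "\<nu> (act g x) = \<nu> x"
    moreover have "act g x \<in> topspace X" using that assms by auto
    ultimately show False using \<nu>(2)[OF that(1)] that unfolding R_def by blast
  qed
  then show ?thesis using \<nu>(1) by blast
qed

text \<open>Points are processed in the order of a separating index \<open>\<nu>\<close>, each
  taking the least color absent from its neighbors of smaller index in \<open>P\<close>. Neighbors
  never share an index, so of any two the later one avoids the color of the earlier. Each stage
  consults finitely many translates, which preserves local constancy.\<close>

lemma greedy_coloring:
  assumes B: "finite B" "B \<subseteq> G" "\<And>g. g \<in> B \<Longrightarrow> minus_Zd zero_Zd g \<in> B"
    and P: "locally_constant X P"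
  obtains col :: "'a \<Rightarrow> nat" where "locally_constant X col"
    "\<And>x g. x \<in> topspace X \<Longrightarrow> P x \<Longrightarrow> g \<in> B \<Longrightarrow> P (act g x) \<Longrightarrow> col (act g x) = col x \<Longrightarrow> g = zero_Zd"
    "\<And>x c. x \<in> topspace X \<Longrightarrow> c < col x \<Longrightarrow> \<exists>g\<in>B. P (act g x) \<and> col (act g x) = c"
proof -
  obtain \<nu> :: "'a \<Rightarrow> nat" where \<nu>: "locally_constant X \<nu>"
    and sep: "\<And>x g. x \<in> topspace X \<Longrightarrow> g \<in> B \<Longrightarrow> g \<noteq> zero_Zd \<Longrightarrow> \<nu> (act g x) \<noteq> \<nu> x"
    using separating_index[OF B(1,2)] by blast
  \<comment> \<open>A function of the pattern \<open>f\<close> on the window \<open>B\<close> alone,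
    as local constancy requires.\<close>
  define pick :: "nat \<Rightarrow> ((nat \<Rightarrow> int) \<Rightarrow> bool \<times> nat \<times> nat) \<Rightarrow> nat" where
    "pick n f = (LEAST c. \<forall>g\<in>B. g \<noteq> zero_Zd \<and> fst (f g) \<and> fst (snd (f g)) < n \<longrightarrow> snd (snd (f g)) \<noteq> c)" for n f
  \<comment> \<open>\<open>C n\<close> is final at points of index below \<open>n\<close>; elsewhere
    the value 0 is a placeholder, which \<open>pick\<close> ignores.\<close>
  define C where "C = rec_nat (\<lambda>_. 0 :: nat) (\<lambda>n c x. if \<nu> x = n
    then pick n (\<lambda>g\<in>B. (P (act g x), \<nu> (act g x), c (act g x))) else c x)"
  have C0: "C 0 = (\<lambda>_. 0)" by (simp add: C_def)
  have CS: "C (Suc n) = (\<lambda>x. if \<nu> x = n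
      then pick n (\<lambda>g\<in>B. (P (act g x), \<nu> (act g x), C n (act g x))) else C n x)" for n
    unfolding C_def by simp
  have lcC: "locally_constant X (C n)" for n
  proof (induction n)
    case 0
    show ?case by (simp add: C0 locally_constant_const)
  next
    case (Suc n)
    have "locally_constant X (\<lambda>x. (P (act g x), \<nu> (act g x), C n (act g x)))" if "g \<in> B" for g
    proof -
      have g: "continuous_map X X (act g)" using that B(2) continuous_act by blast
      show ?thesis
        using locally_constant_comp2[OF locally_constant_pullback[OF P g]
            locally_constant_comp2[OF locally_constant_pullback[OF \<nu> g] locally_constant_pullback[OF Suc g],
              of Pair], of Pair] .
    qed
    then have "locally_constant X (\<lambda>x. \<lambda>g\<in>B. (P (act g x), \<nu> (act g x), C n (act g x)))"
      by (intro locally_constant_restrict B(1))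
    from locally_constant_comp2[OF locally_constant_comp2[OF \<nu> Suc, of Pair] this,
      of "\<lambda>(k, c) f. if k = n then pick n f else c"]
    show ?case by (simp add: CS)
  qed
  have stable: "C n x = C (Suc (\<nu> x)) x" if "\<nu> x < n" for n x
    using that
  proof (induction n)
    case (Suc n)
    then show ?case by (cases "\<nu> x = n") (auto simp: CS)
  qed simp
  define col where "col x = C (Suc (\<nu> x)) x" for x
  have lc: "locally_constant X col"
  proof (rule locally_constantI)
    fix x assume x: "x \<in> topspace X"
    obtain U where "openin X U" "x \<in> U" "\<forall>y\<in>U. (\<nu> y, C (Suc (\<nu> x)) y) = (\<nu> x, C (Suc (\<nu> x)) x)"
      using locally_constant_comp2[OF \<nu> lcC, of Pair] x unfolding locally_constant_def by blast
    then show "\<exists>U. openin X U \<and> x \<in> U \<and> (\<forall>y\<in>U. col y = col x)"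
      unfolding col_def prod.inject by metis
  qed
  define ok where "ok x c \<longleftrightarrow> (\<forall>g\<in>B. g \<noteq> zero_Zd \<and> P (act g x) \<and> \<nu> (act g x) < \<nu> x \<longrightarrow> col (act g x) \<noteq> c)"
    for x c
  have col: "col x = (LEAST c. ok x c)" for x
  proof -
    have "(\<forall>g\<in>B. g \<noteq> zero_Zd \<and> P (act g x) \<and> \<nu> (act g x) < \<nu> x \<longrightarrow> C (\<nu> x) (act g x) \<noteq> c) \<longleftrightarrow> ok x c" for c
      unfolding ok_def col_def using stable by metis
    then show ?thesis by (simp add: col_def[of x] CS pick_def)
  qed
  have ok: "ok x (col x)" for x
  proof -
    \<comment> \<open>\<open>B\<close> is finite, so some color is free and the least one is
      meaningful.\<close>
    obtain c where "c \<notin> (\<lambda>g. col (act g x)) ` B"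
      using ex_new_if_finite[OF infinite_UNIV_nat finite_imageI[OF B(1)]] by blast
    then have "ok x c" by (auto simp: ok_def)
    then show ?thesis unfolding col by (rule LeastI)
  qed
  show ?thesis
  proof (rule that[OF lc])
    fix x c assume "x \<in> topspace X" "c < col x"
    then have "\<not> ok x c" unfolding col by (intro not_less_Least)
    then show "\<exists>g\<in>B. P (act g x) \<and> col (act g x) = c" unfolding ok_def by blast
  next
    fix x g assume x: "x \<in> topspace X" "P x" and g: "g \<in> B" "P (act g x)" and eq: "col (act g x) = col x"
    show "g = zero_Zd"
    proof (rule ccontr)
      assume ne: "g \<noteq> zero_Zd"
      have gG: "g \<in> G" using g B by auto
      define y where "y = act g x"
      define h where "h = minus_Zd zero_Zd g"
      have y: "y \<in> topspace X" and h: "h \<in> B" and hy: "act h y = x"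
        using act_minus[of zero_Zd g x] x gG g B(3) by (auto simp: y_def h_def)
      have hne: "h \<noteq> zero_Zd"
      proof
        assume "h = zero_Zd"
        then have "y = x" using hy y by simp
        then show False using sep[OF x(1) g(1) ne] by (simp add: y_def)
      qed
      have "\<nu> y \<noteq> \<nu> x" using sep[OF x(1) g(1) ne] by (simp add: y_def)
      then consider "\<nu> y < \<nu> x" | "\<nu> x < \<nu> y" by linarith
      then show False
      proof cases
        case 1
        then show False using ok[of x] g ne eq unfolding ok_def y_def by blast
      next
        case 2
        then show False using ok[of y] h hne eq x hy unfolding ok_def y_def by metis
      qed
    qed
  qed
qed


section \<open>Boxes in Z^d and markers at scale r\<close>

definition Zd_box :: "int \<Rightarrow> (nat \<Rightarrow> int) set" where
  "Zd_box r = {g \<in> G. \<forall>i<d. \<bar>g i\<bar> \<le> r}"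

lemma Zd_box_subset: "Zd_box r \<subseteq> G"
  by (auto simp: Zd_box_def)

lemma finite_box: "finite (Zd_box r)"
proof (rule finite_subset)
  show "Zd_box r \<subseteq> (\<Pi>\<^sub>E i\<in>{..<d}. {-r..r})"
    by (auto simp: Zd_box_def G_iff PiE_def abs_le_iff minus_le_iff)
  show "finite (\<Pi>\<^sub>E i\<in>{..<d}. {-r..r})" by (intro finite_PiE) auto
qed

lemma Zd_box_mono: "r \<le> s \<Longrightarrow> Zd_box r \<subseteq> Zd_box s"
  by (force simp: Zd_box_def)

lemma minus_box: "g \<in> Zd_box r \<Longrightarrow> h \<in> Zd_box s \<Longrightarrow> minus_Zd g h \<in> Zd_box (r + s)"
  unfolding Zd_box_def by simp (smt (verit))

lemma zero_box: "0 \<le> r \<Longrightarrow> zero_Zd \<in> Zd_box r"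
  by (simp add: Zd_box_def)

lemma zero_minus_box: "g \<in> Zd_box r \<Longrightarrow> minus_Zd zero_Zd g \<in> Zd_box r"
  unfolding Zd_box_def by simp

definition sup_norm :: "(nat \<Rightarrow> int) \<Rightarrow> int" where
  "sup_norm g = Max (insert 0 ((\<lambda>i. \<bar>g i\<bar>) ` {..<d}))"

lemma sup_norm_le_iff: "sup_norm g \<le> t \<longleftrightarrow> 0 \<le> t \<and> (\<forall>i<d. \<bar>g i\<bar> \<le> t)"
  by (auto simp: sup_norm_def)

lemma Zd_box_iff: "0 \<le> r \<Longrightarrow> g \<in> Zd_box r \<longleftrightarrow> g \<in> G \<and> sup_norm g \<le> r"
  by (auto simp: Zd_box_def sup_norm_le_iff)

lemma sup_norm_step:
  assumes "\<And>i. i < d \<Longrightarrow> \<bar>g i - h i\<bar> \<le> 1"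
  shows "sup_norm g \<le> sup_norm h + 1"
proof -
  have h: "0 \<le> sup_norm h" "\<And>i. i < d \<Longrightarrow> \<bar>h i\<bar> \<le> sup_norm h"
    using sup_norm_le_iff[of h "sup_norm h"] by auto
  have "\<bar>g i\<bar> \<le> sup_norm h + 1" if "i < d" for i
    using assms[OF that] h(2)[OF that] by linarith
  then show ?thesis using h(1) by (simp add: sup_norm_le_iff)
qed

text \<open>The number of colors must not depend on the scale \<open>r\<close>: markers are more than \<open>r\<close>
  apart, so those in a Zd_box of radius \<open>6r\<close> are told apart by dividing their coordinates by
  \<open>r + 1\<close>, which leaves 13 values for each.\<close>

lemma colored_markers:
  assumes "0 \<le> r"
  obtains M :: "'a \<Rightarrow> bool" and col :: "'a \<Rightarrow> nat" where
    "locally_constant X M" "locally_constant X col"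
    "\<And>x. x \<in> topspace X \<Longrightarrow> \<exists>g\<in>Zd_box r. M (act g x)"
    "\<And>x. x \<in> topspace X \<Longrightarrow> col x \<le> 13 ^ d"
    "\<And>x g. x \<in> topspace X \<Longrightarrow> M x \<Longrightarrow> g \<in> Zd_box (6 * r) \<Longrightarrow> M (act g x) \<Longrightarrow> col (act g x) = col x
       \<Longrightarrow> g = zero_Zd"
proof -
  obtain col1 :: "'a \<Rightarrow> nat" where col1: "locally_constant X col1"
    "\<And>x g. x \<in> topspace X \<Longrightarrow> g \<in> Zd_box r \<Longrightarrow> col1 (act g x) = col1 x \<Longrightarrow> g = zero_Zd"
    "\<And>x c. x \<in> topspace X \<Longrightarrow> c < col1 x \<Longrightarrow> \<exists>g\<in>Zd_box r. col1 (act g x) = c"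
    using greedy_coloring[OF finite_box Zd_box_subset zero_minus_box locally_constant_const, of r True]
    by auto
  \<comment> \<open>Color class 0 of a greedy coloring is a maximal r-separated set: every point of
    a larger color sees color 0 in its box.\<close>
  define M where "M x \<longleftrightarrow> col1 x = 0" for x
  have lcM: "locally_constant X M"
    using locally_constant_comp[OF col1(1), of "\<lambda>c. c = 0"] by (simp add: M_def[abs_def])
  have sep: "g = zero_Zd" if "x \<in> topspace X" "M x" "g \<in> Zd_box r" "M (act g x)" for x g
    using col1(2)[OF that(1,3)] that by (simp add: M_def)
  have dense: "\<exists>g\<in>Zd_box r. M (act g x)" if x: "x \<in> topspace X" for x
  proof (cases "col1 x = 0")
    case True
    then show ?thesis using x zero_box[OF assms] by (intro bexI[of _ zero_Zd]) (auto simp: M_def)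
  next
    case False
    then show ?thesis using col1(3)[OF x, of 0] by (auto simp: M_def)
  qed
  obtain col :: "'a \<Rightarrow> nat" where col: "locally_constant X col"
    "\<And>x g. x \<in> topspace X \<Longrightarrow> M x \<Longrightarrow> g \<in> Zd_box (6 * r) \<Longrightarrow> M (act g x) \<Longrightarrow> col (act g x) = col x
       \<Longrightarrow> g = zero_Zd"
    "\<And>x c. x \<in> topspace X \<Longrightarrow> c < col x \<Longrightarrow> \<exists>g\<in>Zd_box (6 * r). M (act g x) \<and> col (act g x) = c"
    using greedy_coloring[OF finite_box Zd_box_subset zero_minus_box lcM, of "6 * r"] by blast
  have "col x \<le> 13 ^ d" if x: "x \<in> topspace X" for x
  proof -
    \<comment> \<open>Every color below \<open>col x\<close> occurs at a marker counted here, so it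
      suffices to bound the size of this set.\<close>
    define T where "T = {g \<in> Zd_box (6 * r). M (act g x)}"
    define D where "D = (\<Pi>\<^sub>E i\<in>{..<d}. {-6..6 :: int})"
    define f where "f g = (\<lambda>i\<in>{..<d}. g i div (r + 1))" for g :: "nat \<Rightarrow> int"
    have "inj_on f T"
    proof (rule inj_onI)
      fix g h assume g: "g \<in> T" and h: "h \<in> T" and eq: "f g = f h"
      have gh: "g \<in> G" "h \<in> G" using g h Zd_box_subset by (auto simp: T_def)
      have "\<bar>g i - h i\<bar> \<le> r" if "i < d" for i
      proof -
        have pos: "0 < r + 1" using assms by simp
        have "g i div (r + 1) = h i div (r + 1)"
          using fun_cong[OF eq, of i] that by (simp add: f_def)
        then have "g i - h i = g i mod (r + 1) - h i mod (r + 1)"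
          by (metis add_diff_cancel_left div_mult_mod_eq mult.commute)
        moreover have "0 \<le> g i mod (r + 1)" "g i mod (r + 1) < r + 1"
          "0 \<le> h i mod (r + 1)" "h i mod (r + 1) < r + 1"
          by (rule pos_mod_sign[OF pos] pos_mod_bound[OF pos])+
        ultimately show ?thesis by linarith
      qed
      then have "minus_Zd g h \<in> Zd_box r" by (simp add: Zd_box_def)
      moreover have "act (minus_Zd g h) (act h x) = act g x" using act_minus gh x by simp
      ultimately have "minus_Zd g h = zero_Zd"
        using sep[of "act h x" "minus_Zd g h"] g h gh x by (simp add: T_def)
      then have "act g x = act h x" using act_minus[OF gh x] gh x by simp
      then show "g = h" using act_eqD gh x by blast
    qed
    moreover have "f ` T \<subseteq> D"
    proof
      fix k assume "k \<in> f ` T"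
      then obtain g where g: "g \<in> T" "k = f g" by blast
      have "g i div (r + 1) \<in> {-6..6}" if "i < d" for i
      proof -
        have b: "\<bar>g i\<bar> \<le> 6 * r" using g that by (auto simp: T_def Zd_box_def)
        have "(- 6 * (r + 1)) div (r + 1) \<le> g i div (r + 1)"
          using b assms by (intro zdiv_mono1) auto
        moreover have "g i div (r + 1) \<le> (6 * (r + 1)) div (r + 1)"
          using b assms by (intro zdiv_mono1) auto
        ultimately show ?thesis using assms
          by (simp only: nonzero_mult_div_cancel_right) simp
      qed
      then show "k \<in> D" by (simp add: g(2) f_def D_def)
    qed
    moreover have "finite D" unfolding D_def by (intro finite_PiE) auto
    ultimately have "card T \<le> card D" by (metis card_inj_on_le)
    also have "card D = 13 ^ d" by (simp add: D_def card_PiE)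
    finally have T: "card T \<le> 13 ^ d" .
    have "{..<col x} \<subseteq> (\<lambda>g. col (act g x)) ` T"
      using col(3)[OF x] by (force simp: T_def)
    then have "card {..<col x} \<le> card T"
      by (rule surj_card_le[rotated]) (simp add: T_def finite_box)
    then show ?thesis using T by simp
  qed
  from dense this col(2) show ?thesis by (rule that[OF lcM col(1)])
qed

definition generator_pairs :: "('a \<times> 'a) set" where
  "generator_pairs = {(x, act (unit_vec d j) x) | x j. x \<in> topspace X \<and> j < d}"

text \<open>Meant for the set of displacements to markers of one color, which has at most one
  element. The weight is 1 up to distance r and falls linearly to 0 at distance 2r; as a function of
  the set it inherits local constancy.\<close>

definition marker_weight :: "int \<Rightarrow> (nat \<Rightarrow> int) set \<Rightarrow> real" where
  "marker_weight r A = (if A = {} then 0 else min 1 ((2 * r - sup_norm (SOME g. g \<in> A)) / r))"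

text \<open>The minus sign is due to the displacement pointing from the point to the marker:
  applying a generator shortens it by a unit vector, so the height grows by one.\<close>

definition marker_height :: "(nat \<Rightarrow> int) set \<Rightarrow> int" where
  "marker_height A = - (\<Sum>i<d. (SOME g. g \<in> A) i)"

lemma marker_singleton:
  "marker_weight r {g} = min 1 ((2 * r - sup_norm g) / r)" "marker_height {g} = - (\<Sum>i<d. g i)"
  by (simp_all add: marker_weight_def marker_height_def)

text \<open>Equally colored markers within 6r coincide, so a point sees at most one of each color
  within 2r, and adjacent points seeing one see the same. A marker comes into sight or disappears
  only at distance exactly 2r, where its weight is 0.\<close>

lemma marker_weights:
  fixes r :: int
  assumes "1 \<le> r"
  obtains l :: "nat \<Rightarrow> 'a \<Rightarrow> real" and h :: "nat \<Rightarrow> 'a \<Rightarrow> int" where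
    "\<And>i. locally_constant X (l i)" "\<And>i. locally_constant X (h i)"
    "\<And>i x. x \<in> topspace X \<Longrightarrow> 0 \<le> l i x" "\<And>i x. x \<in> topspace X \<Longrightarrow> l i x \<le> 1"
    "\<And>x. x \<in> topspace X \<Longrightarrow> \<exists>i\<le>13 ^ d. l i x = 1"
    "\<And>i x y. (x, y) \<in> generator_pairs \<Longrightarrow> \<bar>l i y - l i x\<bar> \<le> 1 / r"
    "\<And>i x y. (x, y) \<in> generator_pairs \<Longrightarrow> 0 < l i x \<Longrightarrow> 0 < l i y \<Longrightarrow> h i y = h i x + 1"
proof -
  have r0: "0 \<le> r" using assms by simp
  obtain M :: "'a \<Rightarrow> bool" and col :: "'a \<Rightarrow> nat" where M:
    "locally_constant X M" "locally_constant X col"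
    "\<And>x. x \<in> topspace X \<Longrightarrow> \<exists>g\<in>Zd_box r. M (act g x)"
    "\<And>x. x \<in> topspace X \<Longrightarrow> col x \<le> 13 ^ d"
    "\<And>x g. x \<in> topspace X \<Longrightarrow> M x \<Longrightarrow> g \<in> Zd_box (6 * r) \<Longrightarrow> M (act g x) \<Longrightarrow> col (act g x) = col x
       \<Longrightarrow> g = zero_Zd"
    using colored_markers[OF r0] by blast
  define A where "A i x = {g \<in> Zd_box (2 * r). M (act g x) \<and> col (act g x) = i}" for i x
  define l where "l i x = marker_weight r (A i x)" for i x
  define h where "h i x = marker_height (A i x)" for i x
  have uniq: "g = k"
    if "x \<in> topspace X" "g \<in> Zd_box (2 * r + 1)" "k \<in> Zd_box (2 * r)" "M (act g x)" "M (act k x)"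
      "col (act g x) = col (act k x)" for x g k
  proof -
    have gk: "g \<in> G" "k \<in> G" using that Zd_box_subset by auto
    have "minus_Zd g k \<in> Zd_box (2 * r + 1 + 2 * r)" by (rule minus_box[OF that(2,3)])
    \<comment> \<open>The extra 1 covers comparison across a generator; 4r + 1 is at most 6r because
      r is at least 1.\<close>
    then have "minus_Zd g k \<in> Zd_box (6 * r)" using Zd_box_mono[of "2 * r + 1 + 2 * r" "6 * r"] assms by auto
    then have "minus_Zd g k = zero_Zd"
      using M(5)[of "act k x" "minus_Zd g k"] act_minus[OF gk that(1)] gk that by simp
    then have "act g x = act k x" using act_minus[OF gk that(1)] gk that(1) by simp
    then show ?thesis using act_eqD gk that(1) by blast
  qed
  have single: "A i x = {g}" if "x \<in> topspace X" "g \<in> A i x" for i x g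
    using uniq[OF that(1)] that(2) Zd_box_mono[of "2 * r" "2 * r + 1"] by (fastforce simp: A_def)
  have lcA: "locally_constant X (A i)" for i
  proof -
    have "locally_constant X (\<lambda>x. (M (act g x), col (act g x)))" if "g \<in> Zd_box (2 * r)" for g
      using locally_constant_comp2[OF locally_constant_pullback[OF M(1)] locally_constant_pullback[OF M(2)],
          of "act g" "act g" Pair] continuous_act that Zd_box_subset by blast
    from locally_constant_restrict[OF finite_box this]
    have "locally_constant X (\<lambda>x. \<lambda>g\<in>Zd_box (2 * r). (M (act g x), col (act g x)))" .
    from locally_constant_comp[OF this, of "\<lambda>f. {g \<in> Zd_box (2 * r). fst (f g) \<and> snd (f g) = i}"]
    show ?thesis by (simp add: A_def[abs_def] cong: conj_cong)
  qed
  have norm_A: "0 \<le> sup_norm g" "sup_norm g \<le> 2 * r" if "g \<in> A i x" for g i x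
    using that r0 sup_norm_le_iff[of g "sup_norm g"] by (auto simp: A_def Zd_box_iff)
  have step: "\<bar>l i y - l i x\<bar> \<le> 1 / r \<and> (0 < l i x \<and> 0 < l i y \<longrightarrow> h i y = h i x + 1)"
    if xy: "(x, y) \<in> generator_pairs" for i x y
  proof -
    obtain j where j: "j < d" and x: "x \<in> topspace X" and y_eq: "y = act (unit_vec d j) x"
      using xy by (auto simp: generator_pairs_def)
    have y: "y \<in> topspace X" using x by (simp add: y_eq)
    define e where "e = unit_vec d j"
    have e: "e \<in> G" by (simp add: e_def)
    have e_val: "e k = (if k = j then 1 else 0)" if "k < d" for k
      using that by (simp add: e_def unit_vec_def)
    have xy_act: "act (minus_Zd g e) y = act g x" if "g \<in> G" for g
      using act_minus[OF that e x] by (simp add: y_eq e_def)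
    have yx_act: "act (plus_Zd g e) x = act g y" if "g \<in> G" for g
      using act_plus[OF that e x] by (simp add: y_eq e_def)
    have lip: "\<bar>min 1 ((2 * r - a) / r) - min 1 ((2 * r - b) / r)\<bar> \<le> 1 / r"
      if "\<bar>a - b\<bar> \<le> 1" for a b :: int
    proof -
      have "\<bar>(2 * r - a) / r - (2 * r - b) / r\<bar> = \<bar>b - a\<bar> / r"
        using assms by (simp add: abs_divide flip: diff_divide_distrib)
      also have "\<dots> \<le> 1 / r" using that assms by (intro divide_right_mono) auto
      finally have "\<bar>(2 * r - a) / r - (2 * r - b) / r\<bar> \<le> 1 / r" .
      moreover have "\<bar>min 1 u - min 1 v\<bar> \<le> \<bar>u - v\<bar>" for u v :: real by (auto simp: min_def)
      ultimately show ?thesis using order_trans by blast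
    qed
    consider "A i x = {}" "A i y = {}" | g k where "g \<in> A i x" "k \<in> A i y"
      | g where "g \<in> A i x" "A i y = {}" | k where "A i x = {}" "k \<in> A i y"
      by blast
    then show ?thesis
    proof cases
      case 1
      then show ?thesis using assms by (simp add: l_def marker_weight_def)
    next
      case (2 g k)
      have g: "g \<in> Zd_box (2 * r)" "M (act g x)" "col (act g x) = i"
        and k: "k \<in> Zd_box (2 * r)" "M (act k y)" "col (act k y) = i"
        using 2 by (auto simp: A_def)
      have gk: "g \<in> G" "k \<in> G" using g k Zd_box_subset by auto
      \<comment> \<open>The displacement k from y is k + e when measured from x, possibly just
        outside the box of radius 2r.\<close>
      have "plus_Zd k e \<in> Zd_box (2 * r + 1)"
        using k(1) by (auto simp: Zd_box_def e_val)
      then have eq: "plus_Zd k e = g"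
        using uniq[OF x _ g(1)] g k yx_act[OF gk(2)] by metis
      have gv: "g i = k i + e i" if "i < d" for i
        using that by (simp flip: eq)
      have "(\<Sum>i<d. g i) = (\<Sum>i<d. k i) + (\<Sum>i<d. e i)"
        using gv by (simp flip: sum.distrib)
      also have "(\<Sum>i<d. e i) = 1" using j by (simp add: e_val)
      finally have "h i y = h i x + 1"
        by (simp add: h_def single[OF x 2(1)] single[OF y 2(2)] marker_singleton)
      moreover have "\<bar>sup_norm k - sup_norm g\<bar> \<le> 1"
      proof -
        have "sup_norm g \<le> sup_norm k + 1" "sup_norm k \<le> sup_norm g + 1"
          by (rule sup_norm_step; simp add: gv e_val)+
        then show ?thesis by linarith
      qed
      ultimately show ?thesis
        using lip by (simp add: l_def single[OF x 2(1)] single[OF y 2(2)] marker_singleton)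
    next
      case (3 g)
      have g: "g \<in> Zd_box (2 * r)" "M (act g x)" "col (act g x) = i" "g \<in> G"
        using 3 Zd_box_subset by (auto simp: A_def)
      have "minus_Zd g e \<notin> Zd_box (2 * r)"
      proof
        assume "minus_Zd g e \<in> Zd_box (2 * r)"
        then have "minus_Zd g e \<in> A i y" using g xy_act[OF g(4)] by (simp add: A_def)
        then show False using 3 by simp
      qed
      then have "\<not> sup_norm (minus_Zd g e) \<le> 2 * r" using r0 by (simp add: Zd_box_iff)
      moreover have "sup_norm (minus_Zd g e) \<le> sup_norm g + 1"
        by (rule sup_norm_step) (simp add: e_val)
      \<comment> \<open>A step changes the norm by at most 1, so a marker lost by this step was at
        the rim, with weight 0.\<close>
      ultimately have "sup_norm g = 2 * r" using norm_A[OF 3(1)] by linarith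
      then show ?thesis
        using 3 assms by (simp add: l_def single[OF x 3(1)] marker_singleton) (simp add: marker_weight_def)
    next
      case (4 k)
      have k: "k \<in> Zd_box (2 * r)" "M (act k y)" "col (act k y) = i" "k \<in> G"
        using 4 Zd_box_subset by (auto simp: A_def)
      have "plus_Zd k e \<notin> Zd_box (2 * r)"
      proof
        assume "plus_Zd k e \<in> Zd_box (2 * r)"
        then have "plus_Zd k e \<in> A i x" using k yx_act[OF k(4)] by (simp add: A_def)
        then show False using 4 by simp
      qed
      then have "\<not> sup_norm (plus_Zd k e) \<le> 2 * r" using r0 by (simp add: Zd_box_iff)
      moreover have "sup_norm (plus_Zd k e) \<le> sup_norm k + 1"
        by (rule sup_norm_step) (simp add: e_val)
      ultimately have "sup_norm k = 2 * r" using norm_A[OF 4(2)] by linarith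
      then show ?thesis
        using 4 assms by (simp add: l_def single[OF y 4(2)] marker_singleton) (simp add: marker_weight_def)
    qed
  qed
  have range: "0 \<le> l i x \<and> l i x \<le> 1" if x: "x \<in> topspace X" for i x
  proof (cases "A i x = {}")
    case True
    then show ?thesis by (simp add: l_def marker_weight_def)
  next
    case False
    then obtain g where g: "g \<in> A i x" by blast
    show ?thesis
      using norm_A[OF g] assms by (simp add: l_def single[OF x g] marker_singleton)
  qed
  have cover: "\<exists>i\<le>13 ^ d. l i x = 1" if x: "x \<in> topspace X" for x
  proof -
    obtain g where g: "g \<in> Zd_box r" "M (act g x)" using M(3)[OF x] by blast
    have gG: "g \<in> G" using g Zd_box_subset by auto
    define i where "i = col (act g x)"
    have "g \<in> A i x" using g Zd_box_mono[of r "2 * r"] r0 by (auto simp: A_def i_def)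
    from single[OF x this] have "A i x = {g}" .
    moreover have "1 \<le> (2 * r - sup_norm g) / r"
      using g assms by (simp add: Zd_box_iff field_simps)
    ultimately have "l i x = 1"
      by (simp add: l_def marker_singleton)
    moreover have "i \<le> 13 ^ d" using M(4)[of "act g x"] x gG by (simp add: i_def)
    ultimately show ?thesis by blast
  qed
  show ?thesis
    using that[of l h] step range cover locally_constant_comp[OF lcA, of "marker_weight r"]
      locally_constant_comp[OF lcA, of marker_height]
    by (simp add: l_def[abs_def] h_def[abs_def])
qed

lemma generator_pairs_subset: "generator_pairs \<subseteq> topspace X \<times> topspace X"
  by (auto simp: generator_pairs_def)

text \<open>Of the 13^d + 1 colors, color 0 is turned into the initial circle and the others become
  labels. Since some weight is always 1, \<open>\<delta>\<close> is 1 whatever the scale.\<close>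

lemma has_slow_structures_markers:
  assumes "q > 0"
  shows "has_slow_structures X generator_pairs q (13 ^ d)"
proof -
  have "\<exists>w l h. slow_structure X generator_pairs q (13 ^ d) 1 \<epsilon> w l h" if \<epsilon>: "\<epsilon> > 0" for \<epsilon>
  proof -
    \<comment> \<open>The weights change by 1/r per step, and the circle built from them by at most
      twice that.\<close>
    define r where "r = max 1 \<lceil>2 / \<epsilon>\<rceil>"
    have r: "1 \<le> r" by (simp add: r_def)
    have "2 / \<epsilon> \<le> r" unfolding r_def by linarith
    then have r\<epsilon>: "2 * (1 / r) \<le> \<epsilon>" using r \<epsilon> by (simp add: field_simps)
    obtain l :: "nat \<Rightarrow> 'a \<Rightarrow> real" and h :: "nat \<Rightarrow> 'a \<Rightarrow> int" where L:
      "\<And>i. locally_constant X (l i)" "\<And>i. locally_constant X (h i)"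
      "\<And>i x. x \<in> topspace X \<Longrightarrow> 0 \<le> l i x" "\<And>i x. x \<in> topspace X \<Longrightarrow> l i x \<le> 1"
      "\<And>x. x \<in> topspace X \<Longrightarrow> \<exists>i\<le>13 ^ d. l i x = 1"
      "\<And>i x y. (x, y) \<in> generator_pairs \<Longrightarrow> \<bar>l i y - l i x\<bar> \<le> 1 / r"
      "\<And>i x y. (x, y) \<in> generator_pairs \<Longrightarrow> 0 < l i x \<Longrightarrow> 0 < l i y \<Longrightarrow> h i y = h i x + 1"
      using marker_weights[OF r] by blast
    define w where "w x = of_real (l 0 x) * unit_root q (h 0 x)" for x
    have norm_w: "cmod (w x) = l 0 x" if "x \<in> topspace X" for x
      using L(3)[OF that] by (simp add: w_def norm_mult)
    have "slow_structure X generator_pairs q (13 ^ d) 1 \<epsilon> w (\<lambda>i. l (Suc i)) (\<lambda>i. h (Suc i))"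
      unfolding slow_structure_def
    proof (intro conjI ballI allI impI)
      show "locally_constant X w"
        using locally_constant_comp2[OF L(1,2), of "\<lambda>s a. of_real s * unit_root q a" 0 0]
        by (simp add: w_def[abs_def])
      fix x assume x: "x \<in> topspace X"
      show "cmod (w x) \<le> 1" using L(4)[OF x] by (simp add: norm_w[OF x])
      obtain i where i: "i \<le> 13 ^ d" "l i x = 1" using L(5)[OF x] by blast
      show "1 \<le> cmod (w x) \<or> (\<exists>i<13 ^ d. 1 \<le> l (Suc i) x)"
      proof (cases i)
        case 0
        then show ?thesis using i by (simp add: norm_w[OF x])
      next
        case (Suc k)
        then show ?thesis using i by (intro disjI2 exI[of _ k]) auto
      qed
    next
      fix p assume p: "p \<in> generator_pairs"
      obtain x y where xy: "p = (x, y)" by (cases p)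
      then have xyE: "(x, y) \<in> generator_pairs" using p by simp
      then have X: "x \<in> topspace X" "y \<in> topspace X" using generator_pairs_subset by auto
      \<comment> \<open>A second label of weight 0 specializes the estimate to a single
        label.\<close>
      have "cmod ((of_real (l 0 y) * unit_root q (1 * h 0 y) + of_real 0 * 1 * unit_root q (1 * 0))
        - unit_root q 1 * (of_real (l 0 x) * unit_root q (1 * h 0 x) + of_real 0 * 1 * unit_root q (1 * 0)))
        \<le> 2 * (1 / r)"
        using L(3)[OF X(1)] L(3)[OF X(2)] L(6)[OF xyE] L(7)[OF xyE] assms r
        by (intro two_labels_to_circle) auto
      then have "cmod (w y - unit_root q 1 * w x) \<le> \<epsilon>"
        using r\<epsilon> by (simp add: w_def)
      moreover have "\<bar>l (Suc i) y - l (Suc i) x\<bar> \<le> \<epsilon>" for i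
      proof -
        have "0 \<le> 1 / real_of_int r" using r by simp
        then show ?thesis using L(6)[OF xyE, of "Suc i"] r\<epsilon> by linarith
      qed
      ultimately show "case p of (x, y) \<Rightarrow> cmod (w y - unit_root q 1 * w x) \<le> \<epsilon> \<and>
        (\<forall>i<13 ^ d. \<bar>l (Suc i) y - l (Suc i) x\<bar> \<le> \<epsilon> \<and>
           (0 < l (Suc i) x \<and> 0 < l (Suc i) y \<longrightarrow> [h (Suc i) y = h (Suc i) x + 1] (mod int q)))"
        using L(7)[OF xyE] xy by simp
    qed (use L in auto)
    then show ?thesis by blast
  qed
  then show ?thesis unfolding has_slow_structures_def by (intro exI[of _ 1]) auto
qed

theorem continuous_H_coloring:
  "\<exists>c. continuous_graph_hom X (schreier_graph d X act) H_graph c"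
proof -
  have "has_slow_structures X generator_pairs q (Suc (13 ^ d - 1))" if "q > 0" for q
    using has_slow_structures_markers[OF that] by simp
  then have "has_slow_structures X generator_pairs 4 1"
    using has_slow_structures_one_label[OF generator_pairs_subset, of "13 ^ d - 1" 4] by simp
  then obtain c where c: "locally_constant X c" "\<And>x. c x \<in> verts H_graph"
    "\<And>x y. (x, y) \<in> generator_pairs \<Longrightarrow> adj H_graph (c x) (c y)"
    using H_coloring_of_slow_structures[OF generator_pairs_subset] by blast
  have sym: "adj H_graph u v \<Longrightarrow> adj H_graph v u" for u v
    by (simp add: H_graph_def insert_commute)
  have "continuous_map X (discrete_topology (verts H_graph)) c"
    unfolding continuous_map_def
  proof (intro conjI allI impI)
    show "c \<in> topspace X \<rightarrow> topspace (discrete_topology (verts H_graph))" using c(2) by simp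
    fix U
    show "openin X {x \<in> topspace X. c x \<in> U}"
    proof (subst openin_subopen, intro ballI)
      fix x assume x: "x \<in> {x \<in> topspace X. c x \<in> U}"
      then obtain V where V: "openin X V" "x \<in> V" "\<forall>y\<in>V. c y = c x"
        using c(1) unfolding locally_constant_def by blast
      have "y \<in> topspace X \<and> c y \<in> U" if "y \<in> V" for y
        using bspec[OF V(3) that] openin_subset[OF V(1)] that x by auto
      then show "\<exists>T. openin X T \<and> x \<in> T \<and> T \<subseteq> {x \<in> topspace X. c x \<in> U}"
        using V(1,2) by blast
    qed
  qed
  moreover have "adj H_graph (c x) (c y)" if xy: "adj (schreier_graph d X act) x y" for x y
  proof -
    obtain i where "x \<in> topspace X" "y \<in> topspace X" "i < d"
      "y = act (unit_vec d i) x \<or> x = act (unit_vec d i) y"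
      using xy unfolding schreier_graph_def graph.simps by blast
    then have "(x, y) \<in> generator_pairs \<or> (y, x) \<in> generator_pairs"
      by (auto simp: generator_pairs_def)
    then show ?thesis using c(3) sym by blast
  qed
  ultimately show ?thesis unfolding continuous_graph_hom_def by blast
qed

end

section \<open>Walks modulo spurs\<close>

lemma walk_Nil [simp]: "\<not> walk \<Gamma> []"
  by (simp add: walk_def)

lemma walk_singleton [simp]: "walk \<Gamma> [u] \<longleftrightarrow> u \<in> verts \<Gamma>"
  by (simp add: walk_def)

lemma walk_Cons_Cons: "walk \<Gamma> (u # v # p) \<longleftrightarrow> u \<in> verts \<Gamma> \<and> adj \<Gamma> u v \<and> walk \<Gamma> (v # p)"
  by (auto simp: walk_def)

lemma walk_concat_eq:
  assumes "p \<noteq> []" "q \<noteq> []" "last p = hd q"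
  shows "walk_concat p q = butlast p @ q"
proof -
  have "p @ tl q = (butlast p @ [last p]) @ tl q"
    by (simp only: append_butlast_last_id[OF assms(1)])
  also have "\<dots> = butlast p @ (hd q # tl q)" by (simp add: assms(3))
  also have "hd q # tl q = q" using assms(2) by simp
  finally show ?thesis by (simp add: walk_concat_def)
qed

lemma walk_concat_assoc:
  assumes "q \<noteq> []"
  shows "walk_concat (walk_concat p q) r = walk_concat p (walk_concat q r)"
  using assms by (cases q) (auto simp: walk_concat_def)

lemma walk_concat_ne [simp]: "p \<noteq> [] \<Longrightarrow> walk_concat p q \<noteq> []"
  by (simp add: walk_concat_def)

lemma hd_walk_concat [simp]: "p \<noteq> [] \<Longrightarrow> hd (walk_concat p q) = hd p"
  by (simp add: walk_concat_def)

lemma last_walk_concat: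
  "p \<noteq> [] \<Longrightarrow> q \<noteq> [] \<Longrightarrow> last p = hd q \<Longrightarrow> last (walk_concat p q) = last q"
  by (simp add: walk_concat_eq)

lemma walk_concat_singleton_right [simp]: "walk_concat p [u] = p"
  by (simp add: walk_concat_def)

lemma walk_concat_singleton_left: "q \<noteq> [] \<Longrightarrow> hd q = u \<Longrightarrow> walk_concat [u] q = q"
  by (auto simp: walk_concat_def)

lemma walk_concat_Cons: "walk_concat (u # v # p) q = u # walk_concat (v # p) q"
  by (simp add: walk_concat_def)

lemma walk_walk_concat:
  assumes "walk \<Gamma> p" "walk \<Gamma> q" "last p = hd q"
  shows "walk \<Gamma> (walk_concat p q)"
  using assms
proof (induction p rule: induct_list012)
  case (2 u)
  then have "q \<noteq> []" by auto
  with 2 show ?case by (simp add: walk_concat_singleton_left)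
next
  case (3 u v p)
  then have "walk \<Gamma> (walk_concat (v # p) q)" by (simp add: walk_Cons_Cons)
  moreover have "walk_concat (v # p) q = v # tl (walk_concat (v # p) q)" by (simp add: walk_concat_def)
  ultimately show ?case
    using 3(3) unfolding walk_concat_Cons by (metis walk_Cons_Cons)
qed simp

lemma walk_append_middle:
  "walk \<Gamma> (xs @ [u] @ ys) \<longleftrightarrow> walk \<Gamma> (xs @ [u]) \<and> walk \<Gamma> (u # ys)"
  by (auto simp: walk_def successively_append_iff successively_Cons)

lemma spur_delE:
  assumes "spur_del \<Gamma> p q"
  obtains xs u v ys where "p = xs @ [u, v, u] @ ys" "q = xs @ [u] @ ys" "walk \<Gamma> p"
  using assms unfolding spur_del_def by blast

lemma spur_del_ends:
  assumes "spur_del \<Gamma> p q"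
  shows "walk \<Gamma> p \<and> walk \<Gamma> q \<and> hd p = hd q \<and> last p = last q"
  using assms
proof (rule spur_delE)
  fix xs u v ys assume p: "p = xs @ [u, v, u] @ ys" and q: "q = xs @ [u] @ ys" and w: "walk \<Gamma> p"
  have "walk \<Gamma> (xs @ [u])" "walk \<Gamma> (u # ys)"
    using w walk_append_middle[of \<Gamma> xs u "[v, u] @ ys"] walk_append_middle[of \<Gamma> "xs @ [u, v]" u ys]
    by (auto simp: p)
  then have "walk \<Gamma> q" using walk_append_middle[of \<Gamma> xs u ys] by (simp add: q)
  moreover have "hd p = hd q" "last p = last q" by (auto simp: p q hd_append)
  ultimately show ?thesis using w by simp
qed

lemma spur_del_concat_right:
  assumes "spur_del \<Gamma> p p'" "walk \<Gamma> q" "last p = hd q"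
  shows "spur_del \<Gamma> (walk_concat p q) (walk_concat p' q)"
  using assms(1)
proof (rule spur_delE)
  fix xs u v ys assume p: "p = xs @ [u, v, u] @ ys" and p': "p' = xs @ [u] @ ys" and w: "walk \<Gamma> p"
  show ?thesis
    unfolding spur_del_def
    using walk_walk_concat[OF w assms(2,3)] p p'
    by (intro conjI exI[of _ xs] exI[of _ u] exI[of _ v] exI[of _ "ys @ tl q"]) (auto simp: walk_concat_def)
qed

lemma spur_del_concat_left:
  assumes "spur_del \<Gamma> p p'" "walk \<Gamma> q" "last q = hd p"
  shows "spur_del \<Gamma> (walk_concat q p) (walk_concat q p')"
  using assms(1)
proof (rule spur_delE)
  fix xs u v ys assume p: "p = xs @ [u, v, u] @ ys" and p': "p' = xs @ [u] @ ys" and w: "walk \<Gamma> p"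
  have e: "hd p = hd p'" "walk \<Gamma> p'" using spur_del_ends[OF assms(1)] by auto
  have ne: "q \<noteq> []" "p \<noteq> []" "p' \<noteq> []" using assms(2) p p' by auto
  have "walk_concat q p = butlast q @ p" "walk_concat q p' = butlast q @ p'"
    using ne assms(3) e by (auto intro: walk_concat_eq)
  then show ?thesis
    unfolding spur_del_def
    using walk_walk_concat[OF assms(2) w assms(3)] p p'
    by (intro conjI exI[of _ "butlast q @ xs"] exI[of _ u] exI[of _ v] exI[of _ ys]) auto
qed

abbreviation spur_eq :: "('a, 'm) graph_scheme \<Rightarrow> 'a list \<Rightarrow> 'a list \<Rightarrow> bool" where
  "spur_eq \<Gamma> \<equiv> equivclp (spur_del \<Gamma>)"

lemma spur_eq_ends:
  assumes "spur_eq \<Gamma> p q" "walk \<Gamma> p"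
  shows "walk \<Gamma> q \<and> hd q = hd p \<and> last q = last p"
  using assms by (induction rule: equivclp_induct) (auto dest: spur_del_ends)

lemma spur_eq_concat_right:
  assumes "spur_eq \<Gamma> p p'" "walk \<Gamma> p" "walk \<Gamma> q" "last p = hd q"
  shows "spur_eq \<Gamma> (walk_concat p q) (walk_concat p' q)"
  using assms(1)
proof (induction rule: equivclp_induct)
  case (step y z)
  have "last y = hd q" "last z = hd q"
    using step(2) spur_eq_ends[OF step(1) assms(2)] assms(4) by (auto dest: spur_del_ends)
  then have "spur_eq \<Gamma> (walk_concat y q) (walk_concat z q)"
    using step(2) assms(3) spur_del_concat_right
    by (metis converse_r_into_equivclp r_into_equivclp)
  then show ?case using step(3) equivclp_trans by metis
qed simp

lemma spur_eq_concat_left: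
  assumes "spur_eq \<Gamma> p p'" "walk \<Gamma> p" "walk \<Gamma> q" "last q = hd p"
  shows "spur_eq \<Gamma> (walk_concat q p) (walk_concat q p')"
  using assms(1)
proof (induction rule: equivclp_induct)
  case (step y z)
  have "last q = hd y" "last q = hd z"
    using step(2) spur_eq_ends[OF step(1) assms(2)] assms(4) by (auto dest: spur_del_ends)
  then have "spur_eq \<Gamma> (walk_concat q y) (walk_concat q z)"
    using step(2) assms(3) spur_del_concat_left
    by (metis converse_r_into_equivclp r_into_equivclp)
  then show ?case using step(3) equivclp_trans by metis
qed simp

lemma spur_eq_concat:
  assumes "spur_eq \<Gamma> p p'" "spur_eq \<Gamma> q q'" "walk \<Gamma> p" "walk \<Gamma> q" "last p = hd q"
  shows "spur_eq \<Gamma> (walk_concat p q) (walk_concat p' q')"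
proof -
  have "walk \<Gamma> p'" "last p' = hd q" using spur_eq_ends[OF assms(1,3)] assms(5) by auto
  then show ?thesis
    using spur_eq_concat_right[OF assms(1,3,4,5)] spur_eq_concat_left[OF assms(2,4)] equivclp_trans by metis
qed

fun walk_sum :: "('a \<Rightarrow> 'a \<Rightarrow> int) \<Rightarrow> 'a list \<Rightarrow> int" where
  "walk_sum s (u # v # p) = s u v + walk_sum s (v # p)"
| "walk_sum s p = 0"

lemma walk_sum_append: "walk_sum s (xs @ [u] @ ys) = walk_sum s (xs @ [u]) + walk_sum s (u # ys)"
  by (induction xs rule: induct_list012) auto

lemma walk_sum_concat:
  assumes "p \<noteq> []" "q \<noteq> []" "last p = hd q"
  shows "walk_sum s (walk_concat p q) = walk_sum s p + walk_sum s q"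
proof -
  have "walk_concat p q = butlast p @ [last p] @ tl q"
    by (simp only: walk_concat_def append_assoc[symmetric] append_butlast_last_id[OF assms(1)])
  moreover have "last p # tl q = q" using assms by auto
  ultimately show ?thesis
    using walk_sum_append[of s "butlast p" "last p" "tl q"]
    by (simp only: append_butlast_last_id[OF assms(1)])
qed

locale symmetric_graph =
  fixes \<Gamma> :: "('a, 'm) graph_scheme" (structure)
  assumes sym: "adj \<Gamma> u v \<Longrightarrow> adj \<Gamma> v u"
begin

lemma walk_rev: "walk \<Gamma> p \<Longrightarrow> walk \<Gamma> (rev p)"
  unfolding walk_def using sym by (auto simp: elim: successively_mono)

text \<open>The walk there and back collapses from its turning point: by induction the inner part
  shrinks to \<open>[v]\<close>, and the spur \<open>[u, v, u]\<close> remains.\<close>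

lemma spur_eq_concat_rev:
  assumes "walk \<Gamma> p"
  shows "spur_eq \<Gamma> (walk_concat p (rev p)) [hd p]"
  using assms
proof (induction p rule: induct_list012)
  case (3 u v p)
  define q where "q = walk_concat (v # p) (rev (v # p))"
  have w: "walk \<Gamma> (v # p)" "adj \<Gamma> u v" "u \<in> verts \<Gamma>" "v \<in> verts \<Gamma>"
    using 3(3) by (auto simp: walk_Cons_Cons walk_def)
  have uvu: "walk \<Gamma> [u, v, u]" using w sym by (auto simp: walk_def)
  have q: "walk \<Gamma> q" "hd q = v" "last q = v"
    unfolding q_def
  proof -
    have r: "last (v # p) = hd (rev (v # p))" "last (rev (v # p)) = v"
      by (simp only: hd_rev) (simp add: last_rev)
    show "walk \<Gamma> (walk_concat (v # p) (rev (v # p)))" by (rule walk_walk_concat[OF w(1) walk_rev[OF w(1)] r(1)])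
    show "hd (walk_concat (v # p) (rev (v # p))) = v" by simp
    show "last (walk_concat (v # p) (rev (v # p))) = v" using last_walk_concat[OF _ _ r(1)] r(2) by simp
  qed
  have "walk_concat (u # v # p) (rev (u # v # p)) = walk_concat (walk_concat [u, v] q) [v, u]"
    by (simp add: q_def walk_concat_def tl_append split: list.split)
  also have "spur_eq \<Gamma> \<dots> (walk_concat (walk_concat [u, v] [v]) [v, u])"
  proof (rule spur_eq_concat_right)
    have uv: "walk \<Gamma> [u, v]" "walk \<Gamma> [v, u]" using w sym by (auto simp: walk_def)
    show "spur_eq \<Gamma> (walk_concat [u, v] q) (walk_concat [u, v] [v])"
      using 3(2)[OF w(1)] w q uv by (intro spur_eq_concat_left) (auto simp: q_def)
    show "walk \<Gamma> (walk_concat [u, v] q)" using uv q by (intro walk_walk_concat) auto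
    show "last (walk_concat [u, v] q) = hd [v, u]" using q by (subst last_walk_concat) auto
  qed (use w sym in \<open>auto simp: walk_def\<close>)
  also have "walk_concat (walk_concat [u, v] [v]) [v, u] = [u, v, u]" by (simp add: walk_concat_def)
  also have "spur_eq \<Gamma> [u, v, u] [u]"
    using uvu unfolding spur_del_def by (intro r_into_equivclp) force
  finally show ?case by simp
qed (auto simp: walk_concat_def)

text \<open>By antisymmetry the two steps of a spur cancel.\<close>

lemma walk_sum_spur_eq:
  assumes "spur_eq \<Gamma> p q" and s: "\<And>u v. adj \<Gamma> u v \<Longrightarrow> s v u = - s u v"
  shows "walk_sum s p = walk_sum s q"
  using assms(1)
proof (induction rule: equivclp_induct)
  case (step y z)
  have *: "walk_sum s p = walk_sum s q" if "spur_del \<Gamma> p q" for p q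
    using that
  proof (rule spur_delE)
    fix xs u v ys assume p: "p = xs @ [u, v, u] @ ys" and q: "q = xs @ [u] @ ys" and w: "walk \<Gamma> p"
    have "adj \<Gamma> u v" using w by (auto simp: p walk_def successively_append_iff)
    then show ?thesis
      using s walk_sum_append[of s xs u "[v, u] @ ys"] walk_sum_append[of s xs u ys] by (simp add: p q)
  qed
  show ?case using step(2,3) * by metis
qed simp

lemma walk_sum_rev:
  assumes "walk \<Gamma> p" and s: "\<And>u v. adj \<Gamma> u v \<Longrightarrow> s v u = - s u v"
  shows "walk_sum s (rev p) = - walk_sum s p"
proof -
  have "p \<noteq> []" using assms(1) by auto
  then have "walk_sum s p + walk_sum s (rev p) = walk_sum s [hd p]"
    using walk_sum_spur_eq[OF spur_eq_concat_rev[OF assms(1)] s]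
    by (subst (asm) walk_sum_concat) (auto simp: hd_rev)
  then show ?thesis by simp
qed

section \<open>The group \<open>\<Pi>\<^sub>1\<close>\<close>

lemma equiv_spur_equiv: "equiv (closed_walks \<Gamma> b) (spur_equiv \<Gamma> b)"
proof (rule equivI)
  show "spur_equiv \<Gamma> b \<subseteq> closed_walks \<Gamma> b \<times> closed_walks \<Gamma> b" by (auto simp: spur_equiv_def)
  show "refl_on (closed_walks \<Gamma> b) (spur_equiv \<Gamma> b)" by (auto simp: refl_on_def spur_equiv_def)
  show "Relation.sym (spur_equiv \<Gamma> b)" by (auto simp: sym_def spur_equiv_def intro: equivclp_sym)
  show "trans (spur_equiv \<Gamma> b)" by (auto simp: trans_def spur_equiv_def intro: equivclp_trans)
qed

lemma closed_walksD:
  assumes "p \<in> closed_walks \<Gamma> b"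
  shows "walk \<Gamma> p" "hd p = b" "last p = b" "p \<noteq> []"
  using assms by (auto simp: closed_walks_def)

lemma closed_walks_concat [simp]:
  "p \<in> closed_walks \<Gamma> b \<Longrightarrow> q \<in> closed_walks \<Gamma> b \<Longrightarrow> walk_concat p q \<in> closed_walks \<Gamma> b"
proof -
  assume "p \<in> closed_walks \<Gamma> b" "q \<in> closed_walks \<Gamma> b"
  note p = closed_walksD[OF this(1)] and q = closed_walksD[OF this(2)]
  have "walk \<Gamma> (walk_concat p q)" using p q by (intro walk_walk_concat) auto
  then show ?thesis using p q by (simp add: closed_walks_def last_walk_concat)
qed

lemma closed_walks_rev: "p \<in> closed_walks \<Gamma> b \<Longrightarrow> rev p \<in> closed_walks \<Gamma> b"
  by (auto simp: closed_walks_def hd_rev last_rev intro: walk_rev)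

lemma pi1_class_eq:
  assumes "p \<in> closed_walks \<Gamma> b" "q \<in> closed_walks \<Gamma> b" "spur_eq \<Gamma> p q"
  shows "pi1_class \<Gamma> b p = pi1_class \<Gamma> b q"
  unfolding pi1_class_def using assms
  by (intro equiv_class_eq[OF equiv_spur_equiv]) (auto simp: spur_equiv_def)

lemma pi1_classD: "q \<in> pi1_class \<Gamma> b p \<Longrightarrow> q \<in> closed_walks \<Gamma> b \<and> spur_eq \<Gamma> p q"
  by (auto simp: pi1_class_def spur_equiv_def)

lemma pi1_class_self: "p \<in> closed_walks \<Gamma> b \<Longrightarrow> p \<in> pi1_class \<Gamma> b p"
  unfolding pi1_class_def by (rule equiv_class_self[OF equiv_spur_equiv])

lemma carrier_pi1: "carrier (pi1 \<Gamma> b) = pi1_class \<Gamma> b ` closed_walks \<Gamma> b"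
  by (auto simp: pi1_def quotient_def pi1_class_def)

lemma one_pi1: "\<one>\<^bsub>pi1 \<Gamma> b\<^esub> = pi1_class \<Gamma> b [b]"
  by (simp add: pi1_def)

lemma mult_pi1:
  assumes "p \<in> closed_walks \<Gamma> b" "q \<in> closed_walks \<Gamma> b"
  shows "pi1_class \<Gamma> b p \<otimes>\<^bsub>pi1 \<Gamma> b\<^esub> pi1_class \<Gamma> b q = pi1_class \<Gamma> b (walk_concat p q)"
proof -
  have "pi1_class \<Gamma> b (walk_concat p' q') = pi1_class \<Gamma> b (walk_concat p q)"
    if "p' \<in> pi1_class \<Gamma> b p" "q' \<in> pi1_class \<Gamma> b q" for p' q'
    using that assms pi1_classD[OF that(1)] pi1_classD[OF that(2)] closed_walksD
    by (intro pi1_class_eq[symmetric] spur_eq_concat closed_walks_concat) metis+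
  then have "(\<Union>p'\<in>pi1_class \<Gamma> b p. \<Union>q'\<in>pi1_class \<Gamma> b q. pi1_class \<Gamma> b (walk_concat p' q'))
      = pi1_class \<Gamma> b (walk_concat p q)"
    using pi1_class_self[OF assms(1)] pi1_class_self[OF assms(2)] by blast
  then show ?thesis by (simp add: pi1_def)
qed

lemma group_pi1:
  assumes "b \<in> verts \<Gamma>"
  shows "group (pi1 \<Gamma> b)"
proof (rule groupI)
  have b: "[b] \<in> closed_walks \<Gamma> b" using assms by (simp add: closed_walks_def)
  then show "\<one>\<^bsub>pi1 \<Gamma> b\<^esub> \<in> carrier (pi1 \<Gamma> b)" by (auto simp: one_pi1 carrier_pi1)
  fix x assume "x \<in> carrier (pi1 \<Gamma> b)"
  then obtain p where p: "p \<in> closed_walks \<Gamma> b" "x = pi1_class \<Gamma> b p" by (auto simp: carrier_pi1)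
  show "\<one>\<^bsub>pi1 \<Gamma> b\<^esub> \<otimes>\<^bsub>pi1 \<Gamma> b\<^esub> x = x"
    using closed_walksD[OF p(1)] b p(1) by (simp add: one_pi1 p(2) mult_pi1 walk_concat_singleton_left)
  have "pi1_class \<Gamma> b (rev p) \<otimes>\<^bsub>pi1 \<Gamma> b\<^esub> x = pi1_class \<Gamma> b (walk_concat (rev p) (rev (rev p)))"
    using p closed_walks_rev by (simp add: mult_pi1)
  also have "\<dots> = \<one>\<^bsub>pi1 \<Gamma> b\<^esub>"
    unfolding one_pi1
    using spur_eq_concat_rev[of "rev p"] closed_walks_rev[OF p(1)] b p(1) closed_walksD[OF closed_walks_rev[OF p(1)]]
    by (intro pi1_class_eq) auto
  finally show "\<exists>y\<in>carrier (pi1 \<Gamma> b). y \<otimes>\<^bsub>pi1 \<Gamma> b\<^esub> x = \<one>\<^bsub>pi1 \<Gamma> b\<^esub>"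
    using closed_walks_rev[OF p(1)] by (auto simp: carrier_pi1)
  fix y assume "y \<in> carrier (pi1 \<Gamma> b)"
  then obtain q where q: "q \<in> closed_walks \<Gamma> b" "y = pi1_class \<Gamma> b q" by (auto simp: carrier_pi1)
  show "x \<otimes>\<^bsub>pi1 \<Gamma> b\<^esub> y \<in> carrier (pi1 \<Gamma> b)" using p q by (auto simp: mult_pi1 carrier_pi1)
  fix z assume "z \<in> carrier (pi1 \<Gamma> b)"
  then obtain r where r: "r \<in> closed_walks \<Gamma> b" "z = pi1_class \<Gamma> b r" by (auto simp: carrier_pi1)
  show "x \<otimes>\<^bsub>pi1 \<Gamma> b\<^esub> y \<otimes>\<^bsub>pi1 \<Gamma> b\<^esub> z = x \<otimes>\<^bsub>pi1 \<Gamma> b\<^esub> (y \<otimes>\<^bsub>pi1 \<Gamma> b\<^esub> z)"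
    using p q r closed_walksD(4)[OF q(1)] by (simp add: mult_pi1 walk_concat_assoc)
qed

end

lemma (in group) normal_normal_closure: "normal_closure G S \<lhd> G" if "S \<subseteq> carrier G"
proof -
  have "carrier G \<lhd> G" by (simp add: normal_inv_iff subgroup_self)
  then have ne: "{N. N \<lhd> G \<and> S \<subseteq> N} \<noteq> {}" using that by blast
  have "subgroup (normal_closure G S) G"
    unfolding normal_closure_def using ne by (intro subgroups_Inter) (auto intro: normal_imp_subgroup)
  moreover have "x \<otimes> h \<otimes> inv x \<in> normal_closure G S" if "x \<in> carrier G" "h \<in> normal_closure G S" for x h
    using that unfolding normal_closure_def by (auto simp: normal_inv_iff)
  ultimately show ?thesis by (simp add: normal_inv_iff)
qed

lemma subset_normal_closure: "S \<subseteq> normal_closure G S"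
  by (auto simp: normal_closure_def)

lemma normal_closure_least: "N \<lhd> G \<Longrightarrow> S \<subseteq> N \<Longrightarrow> normal_closure G S \<subseteq> N"
  by (auto simp: normal_closure_def)

section \<open>Loops relative to a choice of paths from the base point\<close>

text \<open>\<open>T b\<close> is required to be trivial only up to spurs, because the paths used in
  H run through the root 0 of the tree even when they return to \<open>b\<close>.\<close>

locale based_graph = symmetric_graph +
  fixes b and T :: "'a \<Rightarrow> 'a list"
  assumes T_walk: "u \<in> verts \<Gamma> \<Longrightarrow> walk \<Gamma> (T u)"
    and T_hd: "u \<in> verts \<Gamma> \<Longrightarrow> hd (T u) = b" and T_last: "u \<in> verts \<Gamma> \<Longrightarrow> last (T u) = u"
    and T_base: "spur_eq \<Gamma> (T b) [b]" and b: "b \<in> verts \<Gamma>"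
begin

text \<open>Makes every walk, in particular every single edge, an element of the group based at
  \<open>b\<close>.\<close>

definition loop_of :: "'a list \<Rightarrow> 'a list" where
  "loop_of p = walk_concat (walk_concat (T (hd p)) p) (rev (T (last p)))"

lemma walk_ends:
  assumes "walk \<Gamma> p"
  shows "p \<noteq> []" "hd p \<in> verts \<Gamma>" "last p \<in> verts \<Gamma>"
  using assms by (auto simp: walk_def)

lemma T_ne: "u \<in> verts \<Gamma> \<Longrightarrow> T u \<noteq> []"
  using T_walk by fastforce

lemma T_rev:
  assumes "u \<in> verts \<Gamma>"
  shows "walk \<Gamma> (rev (T u))" "hd (rev (T u)) = u" "last (rev (T u)) = b"
  using walk_rev[OF T_walk[OF assms]] T_hd[OF assms] T_last[OF assms] by (auto simp: hd_rev last_rev)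

lemma T_concat:
  assumes "walk \<Gamma> p"
  shows "walk \<Gamma> (walk_concat (T (hd p)) p)" "hd (walk_concat (T (hd p)) p) = b"
    "last (walk_concat (T (hd p)) p) = last p"
  using walk_ends[OF assms] assms T_walk T_hd T_last T_ne
  by (auto intro!: walk_walk_concat simp: last_walk_concat)

lemma loop_of_closed:
  assumes "walk \<Gamma> p"
  shows "loop_of p \<in> closed_walks \<Gamma> b"
proof -
  note e = walk_ends[OF assms] and c = T_concat[OF assms] and r = T_rev[OF walk_ends(3)[OF assms]]
  have ne: "walk_concat (T (hd p)) p \<noteq> []" "rev (T (last p)) \<noteq> []" using c(1) r(1) by force+
  show ?thesis
    using walk_walk_concat[OF c(1) r(1)] last_walk_concat[OF ne] hd_walk_concat[OF ne(1)] c r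
    by (simp add: loop_of_def closed_walks_def)
qed

lemma loop_of_spur_eq:
  assumes "spur_eq \<Gamma> p p'" "walk \<Gamma> p"
  shows "spur_eq \<Gamma> (loop_of p) (loop_of p')"
proof -
  have e: "walk \<Gamma> p'" "hd p' = hd p" "last p' = last p" using spur_eq_ends[OF assms] by auto
  have "spur_eq \<Gamma> (walk_concat (T (hd p)) p) (walk_concat (T (hd p)) p')"
    using assms T_walk T_last walk_ends[OF assms(2)] by (intro spur_eq_concat_left) auto
  then show ?thesis
    unfolding loop_of_def e
    using T_concat[OF assms(2)] T_rev walk_ends[OF assms(2)] by (intro spur_eq_concat_right) auto
qed

text \<open>The detour from the junction to the base point and back cancels.\<close>

lemma loop_of_concat:
  assumes p: "walk \<Gamma> p" and q: "walk \<Gamma> q" and pq: "last p = hd q"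
  shows "spur_eq \<Gamma> (loop_of (walk_concat p q)) (walk_concat (loop_of p) (loop_of q))"
proof -
  define x where "x = walk_concat (T (hd p)) p"
  define y where "y = walk_concat q (rev (T (last q)))"
  define v where "v = hd q"
  note ep = walk_ends[OF p] and eq = walk_ends[OF q]
  have v: "v \<in> verts \<Gamma>" using eq by (simp add: v_def)
  have x: "walk \<Gamma> x" "last x = v" "x \<noteq> []"
    using T_concat[OF p] walk_ends[OF T_concat(1)[OF p]] pq by (auto simp: x_def v_def)
  have r: "walk \<Gamma> (rev (T (last q)))" "hd (rev (T (last q))) = last q" using T_rev eq by auto
  have y: "walk \<Gamma> y" "hd y = v" "y \<noteq> []"
    using walk_walk_concat[OF q r(1)] r(2) eq by (auto simp: y_def v_def)
  have tv: "walk \<Gamma> (rev (T v))" "hd (rev (T v)) = v" "last (rev (T v)) = b"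
    "walk \<Gamma> (T v)" "hd (T v) = b" "last (T v) = v" "T v \<noteq> []" "rev (T v) \<noteq> []"
    using T_rev[OF v] T_walk[OF v] T_hd[OF v] T_last[OF v] T_ne[OF v] by auto
  have lhs: "loop_of (walk_concat p q) = walk_concat x y"
    using ep eq pq by (simp add: loop_of_def x_def y_def last_walk_concat walk_concat_assoc)
  have "walk_concat (loop_of p) (loop_of q)
      = walk_concat (walk_concat x (rev (T v))) (walk_concat (walk_concat (T v) q) (rev (T (last q))))"
    using pq by (simp add: loop_of_def x_def v_def)
  also have "\<dots> = walk_concat (walk_concat x (walk_concat (rev (T v)) (T v))) y"
    using eq tv by (simp add: y_def walk_concat_assoc)
  finally have rhs: "walk_concat (loop_of p) (loop_of q)
      = walk_concat (walk_concat x (walk_concat (rev (T v)) (T v))) y" .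
  have loop: "spur_eq \<Gamma> (walk_concat (rev (T v)) (T v)) [v]"
    using spur_eq_concat_rev[OF tv(1)] tv(2) by simp
  have w: "walk \<Gamma> (walk_concat (rev (T v)) (T v))" "hd (walk_concat (rev (T v)) (T v)) = v"
    "last (walk_concat (rev (T v)) (T v)) = v"
    using tv walk_walk_concat[OF tv(1,4)] last_walk_concat[of "rev (T v)" "T v"] by auto
  have ne: "walk_concat (rev (T v)) (T v) \<noteq> []" using walk_ends[OF w(1)] by simp
  have cancel: "spur_eq \<Gamma> (walk_concat (walk_concat x m) y) (walk_concat (walk_concat x [v]) y)"
    if m: "spur_eq \<Gamma> m [v]" "walk \<Gamma> m" "hd m = v" "last m = v" "m \<noteq> []" for m
  proof -
    have "spur_eq \<Gamma> (walk_concat x m) (walk_concat x [v])"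
      using m x by (intro spur_eq_concat_left) auto
    then show ?thesis
      using m x y by (intro spur_eq_concat_right walk_walk_concat) (auto simp: last_walk_concat)
  qed
  from cancel[OF loop w ne]
  show ?thesis unfolding lhs rhs by (simp add: equivclp_sym)
qed

lemma loop_of_closed_walk:
  assumes "p \<in> closed_walks \<Gamma> b"
  shows "spur_eq \<Gamma> (loop_of p) p"
proof -
  note p = closed_walksD[OF assms]
  have T: "walk \<Gamma> (T b)" "hd (T b) = b" "last (T b) = b" using T_walk T_hd T_last b by auto
  have 1: "spur_eq \<Gamma> (walk_concat (T b) p) p"
    using spur_eq_concat_right[OF T_base T(1) p(1)] T p by (simp add: walk_concat_singleton_left)
  have 2: "spur_eq \<Gamma> (rev (T b)) [b]"
  proof -
    have "spur_eq \<Gamma> (walk_concat (T b) (rev (T b))) (walk_concat [b] (rev (T b)))"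
      using T_base T T_rev[OF b] by (intro spur_eq_concat_right) auto
    moreover have "walk_concat [b] (rev (T b)) = rev (T b)"
      using T_rev[OF b] T_ne[OF b] by (intro walk_concat_singleton_left) auto
    moreover have "spur_eq \<Gamma> (walk_concat (T b) (rev (T b))) [b]"
      using spur_eq_concat_rev[OF T(1)] T(2) by simp
    ultimately show ?thesis using equivclp_sym equivclp_trans by metis
  qed
  have "spur_eq \<Gamma> (loop_of p) (walk_concat p [b])"
    unfolding loop_of_def p(2,3)
    using 1 2 T_concat[OF p(1)] T_rev[OF b] p by (intro spur_eq_concat) auto
  then show ?thesis by simp
qed

text \<open>The loop is \<open>T v\<close> followed by its own reverse.\<close>

lemma loop_of_tree_edge:
  assumes "walk \<Gamma> [u, v]" "T v = walk_concat (T u) [u, v]"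
  shows "spur_eq \<Gamma> (loop_of [u, v]) [b]"
  using spur_eq_concat_rev[OF T_walk, of v] T_hd[of v] walk_ends[OF assms(1)] assms(2)
  by (simp add: loop_of_def)

lemma loop_of_square:
  assumes "p \<in> closed_walks \<Gamma> u" "walk_length p = 4"
  shows "pi1_class \<Gamma> b (loop_of p) \<in> square_classes \<Gamma> b"
proof -
  note p = closed_walksD[OF assms(1)]
  have u: "u \<in> verts \<Gamma>" using walk_ends[OF p(1)] p by simp
  then show ?thesis
    unfolding square_classes_def loop_of_def p(2,3)
    by (intro CollectI exI[of _ "T u"] exI[of _ p]) (simp add: T_walk T_hd T_last assms)
qed

end

section \<open>The graph \<open>H\<close>\<close>

lemma H_symmetric: "symmetric_graph H_graph"
  by unfold_locales (simp add: H_graph_def insert_commute)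

interpretation H: symmetric_graph H_graph
  by (rule H_symmetric)

lemma H_verts: "verts H_graph = {..<21}"
proof -
  define vs where "vs = [H_array ! i ! j. i \<leftarrow> [0..<6], j \<leftarrow> [0..<6]]"
  have "list_all (\<lambda>v. v < 21) [H_array ! i ! j. i \<leftarrow> [0..<6], j \<leftarrow> [0..<6]]"
    "list_all (\<lambda>v. v \<in> set [H_array ! i ! j. i \<leftarrow> [0..<6], j \<leftarrow> [0..<6]]) [0..<21]"
    by code_simp+
  then have "set vs = {..<21}" unfolding vs_def[symmetric] list_all_iff by auto
  moreover have "verts H_graph = set vs" by (force simp: H_graph_def vs_def)
  ultimately show ?thesis by simp
qed

section \<open>Finite tables for H, checked by evaluation\<close>

definition H_edges :: "(nat \<times> nat) list" where
  "H_edges = [(H_array ! i ! j, H_array ! i ! Suc j). i \<leftarrow> [0..<6], j \<leftarrow> [0..<5]]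
     @ [(H_array ! i ! j, H_array ! Suc i ! j). i \<leftarrow> [0..<5], j \<leftarrow> [0..<6]]"

lemma H_adj_iff: "adj H_graph u v \<longleftrightarrow> (u, v) \<in> set H_edges \<or> (v, u) \<in> set H_edges"
proof -
  have "(u, v) \<in> set H_edges \<longleftrightarrow>
      (\<exists>i<6. \<exists>j<5. u = H_array ! i ! j \<and> v = H_array ! i ! Suc j) \<or>
      (\<exists>i<5. \<exists>j<6. u = H_array ! i ! j \<and> v = H_array ! Suc i ! j)" for u v
    by (force simp: H_edges_def)
  then show ?thesis by (simp add: H_graph_def doubleton_eq_iff) blast
qed

definition H_neighbours :: "nat list list" where
  "H_neighbours =
     [[1, 4], [0, 2, 5, 8, 17, 20], [1, 3, 6, 12, 13, 19], [2, 4, 7, 9, 16, 18], [0, 3, 5, 8,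
     17, 20], [1, 4, 6, 9], [2, 5, 7, 10], [3, 6, 8, 11], [1, 4, 7, 12], [3, 5, 10, 13], [6, 9,
     11, 14], [7, 10, 12, 15], [2, 8, 11, 16], [2, 9, 14, 17], [10, 13, 15, 18], [11, 14, 16,
     19], [3, 12, 15, 20], [1, 4, 13, 18], [3, 14, 17, 19], [2, 15, 18, 20], [1, 4, 16, 19]]"

lemma H_adj_neighbours: "adj H_graph u v \<longleftrightarrow> u < 21 \<and> v \<in> set (H_neighbours ! u)"
proof -
  have "list_all (\<lambda>(u, v). u < 21 \<and> v < 21 \<and> v \<in> set (H_neighbours ! u) \<and> u \<in> set (H_neighbours ! v)) H_edges"
    by code_simp
  then have "u < 21 \<and> v \<in> set (H_neighbours ! u)" if "(u, v) \<in> set H_edges \<or> (v, u) \<in> set H_edges"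
    using that by (auto simp: list_all_iff)
  moreover have "list_all (\<lambda>u. list_all (\<lambda>v. (u, v) \<in> set H_edges \<or> (v, u) \<in> set H_edges) (H_neighbours ! u)) [0..<21]"
    by code_simp
  then have "(u, v) \<in> set H_edges \<or> (v, u) \<in> set H_edges" if "u < 21" "v \<in> set (H_neighbours ! u)"
    using that by (auto simp: list_all_iff)
  ultimately show ?thesis unfolding H_adj_iff by blast
qed

definition H_negative :: "(nat \<times> nat) list" where
  "H_negative = [(5, 9), (9, 13), (9, 10), (13, 17), (15, 19), (17, 18), (18, 19), (19, 20)]"

text \<open>Obtained from the \<open>\<int>/4\<close>-valued cocycle dual to the boundary of the array by adding a
  coboundary that makes all values odd, so that sums along walks also give the length parity.\<close>

definition H_sign :: "nat \<Rightarrow> nat \<Rightarrow> int" where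
  "H_sign u v = (if (u < v) \<noteq> ((u, v) \<in> set H_negative \<or> (v, u) \<in> set H_negative) then 1 else - 1)"

lemma H_irrefl: "adj H_graph u v \<Longrightarrow> u \<noteq> v"
proof -
  have "list_all (\<lambda>(u, v). u \<noteq> v) H_edges" by code_simp
  then show "adj H_graph u v \<Longrightarrow> u \<noteq> v" by (auto simp: H_adj_iff list_all_iff)
qed

lemma H_sign_antisym: "adj H_graph u v \<Longrightarrow> H_sign v u = - H_sign u v"
  using H_irrefl[of u v] by (cases "u < v") (auto simp: H_sign_def)

text \<open>All closed walks of length four are checked, not only the 25 faces: H has other
  4-cycles, such as 1 5 4 8, and a bad sum on one of them would shrink the group.\<close>

lemma H_sign_square:
  assumes "adj H_graph u v" "adj H_graph v w" "adj H_graph w x" "adj H_graph x u"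
  shows "4 dvd H_sign u v + H_sign v w + H_sign w x + H_sign x u"
proof -
  have "list_all (\<lambda>u. list_all (\<lambda>v. list_all (\<lambda>w. list_all (\<lambda>x. u \<in> set (H_neighbours ! x) \<longrightarrow>
      (H_sign u v + H_sign v w + H_sign w x + H_sign x u) mod 4 = 0) (H_neighbours ! w)) (H_neighbours ! v))
      (H_neighbours ! u)) [0..<21]"
    by code_simp
  then show ?thesis
    using assms unfolding H_adj_neighbours list_all_iff dvd_eq_mod_eq_0 by simp
qed

text \<open>Paths from the root 0 in a spanning tree. It contains the outer 5-cycle except the edge
  between 3 and 2, whose element will be the generator.\<close>

definition H_tree :: "nat list list" where
  "H_tree =
     [[0], [0, 1], [0, 1, 2], [0, 4, 3], [0, 4], [0, 1, 5], [0, 1, 2, 6], [0, 1, 8, 7], [0, 1,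
     8], [0, 1, 5, 9], [0, 1, 2, 6, 10], [0, 1, 2, 12, 11], [0, 1, 2, 12], [0, 1, 2, 13], [0,
     1, 2, 13, 14], [0, 1, 2, 19, 15], [0, 1, 20, 16], [0, 1, 17], [0, 1, 17, 18], [0, 1, 2,
     19], [0, 1, 20]]"

lemma H_tree:
  assumes "u \<in> verts H_graph"
  shows "walk H_graph (H_tree ! u)" "hd (H_tree ! u) = 0" "last (H_tree ! u) = u"
proof -
  have "list_all (\<lambda>u. H_tree ! u \<noteq> [] \<and> list_all (\<lambda>v. v < 21) (H_tree ! u) \<and>
      successively (\<lambda>u v. v \<in> set (H_neighbours ! u)) (H_tree ! u) \<and> hd (H_tree ! u) = 0 \<and> last (H_tree ! u) = u) [0..<21]"
    by code_simp
  then have u: "H_tree ! u \<noteq> []" "\<forall>v\<in>set (H_tree ! u). v < 21"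
      "successively (\<lambda>u v. v \<in> set (H_neighbours ! u)) (H_tree ! u)" "hd (H_tree ! u) = 0" "last (H_tree ! u) = u"
    using assms by (auto simp: list_all_iff H_verts)
  have "successively (adj H_graph) (H_tree ! u)"
    using u(3) by (rule successively_mono) (use u(2) in \<open>auto simp: H_adj_neighbours\<close>)
  then show "walk H_graph (H_tree ! u)" "hd (H_tree ! u) = 0" "last (H_tree ! u) = u"
    using u by (auto simp: walk_def H_verts)
qed

text \<open>Normalizes the signs: \<open>H_sign u v + H_potential u - H_potential v\<close> is the
  sum of signs along the loop through the tree that crosses the edge, and vanishes on tree
  edges.\<close>

definition H_potential :: "nat \<Rightarrow> int" where
  "H_potential u = walk_sum H_sign (H_tree ! u)"

text \<open>One orientation of each of the 45 edges: the 20 tree edges, the generator, and the 24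
  edges settled by one face each. The entries agree with the normalized signs only modulo 4.\<close>

definition H_exponents :: "(nat \<times> nat \<times> int) list" where
  "H_exponents =
     [(0, 1, 0), (1, 2, 0), (4, 3, 0), (0, 4, 0), (1, 5, 0), (2, 6, 0), (8, 7, 0), (1, 8, 0),
     (5, 9, 0), (6, 10, 0), (12, 11, 0), (2, 12, 0), (2, 13, 0), (13, 14, 0), (19, 15, 0), (20,
     16, 0), (1, 17, 0), (17, 18, 0), (2, 19, 0), (1, 20, 0), (3, 2, 1), (4, 5, 0), (5, 6, 0),
     (4, 8, 0), (3, 9, 0), (9, 10, 0), (8, 12, 0), (17, 13, 0), (18, 14, 0), (4, 17, 0), (3,
     18, 0), (20, 19, 0), (4, 20, 0), (3, 7, 0), (7, 11, 0), (16, 15, 0), (3, 16, 0), (6, 7,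
     -1), (10, 11, -1), (13, 9, -1), (14, 10, -1), (12, 16, -1), (19, 18, -1), (11, 15, -1),
     (15, 14, -1)]"

text \<open>Every edge element is a power of the element of the edge from 3 to 2: starting from the
  spanning tree, each face in turn determines one new edge, and the last face forces the fourth
  power to be trivial.\<close>

lemma (in group) H_edge_powers:
  fixes e :: "nat \<Rightarrow> nat \<Rightarrow> 'a"
  assumes closed: "\<And>u v. adj H_graph u v \<Longrightarrow> e u v \<in> carrier G"
    and inverse: "\<And>u v. adj H_graph u v \<Longrightarrow> e v u = inv (e u v)"
    and square: "\<And>u v w x. adj H_graph u v \<Longrightarrow> adj H_graph v w \<Longrightarrow> adj H_graph w x \<Longrightarrow> adj H_graph x u
      \<Longrightarrow> e u v \<otimes> e v w \<otimes> e w x \<otimes> e x u = \<one>"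
    and tree_edge: "\<And>u v. adj H_graph u v \<Longrightarrow> H_tree ! v = H_tree ! u @ [v] \<Longrightarrow> e u v = \<one>"
  shows "\<exists>g\<in>carrier G. g [^] (4 :: int) = \<one> \<and>
    (\<forall>u v. adj H_graph u v \<longrightarrow> e u v = g [^] (H_sign u v + H_potential u - H_potential v))"
proof -
  define g where "g = e 3 2"
  have a32: "adj H_graph 3 2" by (simp add: H_adj_neighbours H_neighbours_def)
  have g: "g \<in> carrier G" using closed a32 by (simp add: g_def)
  define P where "P u v k \<longleftrightarrow> adj H_graph u v \<and> e u v = g [^] k" for u v and k :: int
  have rev: "P v u (- k)" if "P u v k" for u v k
    using that inverse[of u v] H.sym g by (simp add: P_def int_pow_neg)
  \<comment> \<open>Three known sides of a 4-cycle determine the fourth.\<close>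
  have face: "P u x k" if "P u v i" "P v w j" "P w x l" "adj H_graph u x" "k = i + j + l" for u v w x i j l k
  proof -
    have a: "adj H_graph x u" using H.sym that(4) .
    have "g [^] k \<otimes> e x u = \<one>"
      using square[of u v w x] that a g by (simp add: P_def int_pow_mult)
    then have "e x u = inv (g [^] k)"
      using closed[OF a] g by (metis int_pow_closed inv_equality inv_inv)
    then show ?thesis using inverse[OF a] that(4) g by (simp add: P_def)
  qed
  have tree: "P u v 0" if "adj H_graph u v" "H_tree ! v = H_tree ! u @ [v]" for u v
    using tree_edge[OF that] that(1) by (simp add: P_def)
  have e0_1: "P 0 1 0" by (rule tree) (simp_all add: H_adj_neighbours H_neighbours_def H_tree_def)
  have e1_2: "P 1 2 0" by (rule tree) (simp_all add: H_adj_neighbours H_neighbours_def H_tree_def)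
  have e4_3: "P 4 3 0" by (rule tree) (simp_all add: H_adj_neighbours H_neighbours_def H_tree_def)
  have e0_4: "P 0 4 0" by (rule tree) (simp_all add: H_adj_neighbours H_neighbours_def H_tree_def)
  have e1_5: "P 1 5 0" by (rule tree) (simp_all add: H_adj_neighbours H_neighbours_def H_tree_def)
  have e2_6: "P 2 6 0" by (rule tree) (simp_all add: H_adj_neighbours H_neighbours_def H_tree_def)
  have e8_7: "P 8 7 0" by (rule tree) (simp_all add: H_adj_neighbours H_neighbours_def H_tree_def)
  have e1_8: "P 1 8 0" by (rule tree) (simp_all add: H_adj_neighbours H_neighbours_def H_tree_def)
  have e5_9: "P 5 9 0" by (rule tree) (simp_all add: H_adj_neighbours H_neighbours_def H_tree_def)
  have e6_10: "P 6 10 0" by (rule tree) (simp_all add: H_adj_neighbours H_neighbours_def H_tree_def)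
  have e12_11: "P 12 11 0"
    by (rule tree) (simp_all add: H_adj_neighbours H_neighbours_def H_tree_def)
  have e2_12: "P 2 12 0" by (rule tree) (simp_all add: H_adj_neighbours H_neighbours_def H_tree_def)
  have e2_13: "P 2 13 0" by (rule tree) (simp_all add: H_adj_neighbours H_neighbours_def H_tree_def)
  have e13_14: "P 13 14 0"
    by (rule tree) (simp_all add: H_adj_neighbours H_neighbours_def H_tree_def)
  have e19_15: "P 19 15 0"
    by (rule tree) (simp_all add: H_adj_neighbours H_neighbours_def H_tree_def)
  have e20_16: "P 20 16 0"
    by (rule tree) (simp_all add: H_adj_neighbours H_neighbours_def H_tree_def)
  have e1_17: "P 1 17 0" by (rule tree) (simp_all add: H_adj_neighbours H_neighbours_def H_tree_def)
  have e17_18: "P 17 18 0"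
    by (rule tree) (simp_all add: H_adj_neighbours H_neighbours_def H_tree_def)
  have e2_19: "P 2 19 0" by (rule tree) (simp_all add: H_adj_neighbours H_neighbours_def H_tree_def)
  have e1_20: "P 1 20 0" by (rule tree) (simp_all add: H_adj_neighbours H_neighbours_def H_tree_def)
  have e3_2: "P 3 2 1" using a32 g by (simp add: P_def g_def)
  have e4_5: "P 4 5 0"
    by (rule face[OF rev[OF e0_4] e0_1 e1_5]) (simp_all add: H_adj_neighbours H_neighbours_def)
  have e5_6: "P 5 6 0"
    by (rule face[OF rev[OF e1_5] e1_2 e2_6]) (simp_all add: H_adj_neighbours H_neighbours_def)
  have e4_8: "P 4 8 0"
    by (rule face[OF rev[OF e0_4] e0_1 e1_8]) (simp_all add: H_adj_neighbours H_neighbours_def)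
  have e3_9: "P 3 9 0"
    by (rule face[OF rev[OF e4_3] e4_5 e5_9]) (simp_all add: H_adj_neighbours H_neighbours_def)
  have e9_10: "P 9 10 0"
    by (rule face[OF rev[OF e5_9] e5_6 e6_10]) (simp_all add: H_adj_neighbours H_neighbours_def)
  have e8_12: "P 8 12 0"
    by (rule face[OF rev[OF e1_8] e1_2 e2_12]) (simp_all add: H_adj_neighbours H_neighbours_def)
  have e17_13: "P 17 13 0"
    by (rule face[OF rev[OF e1_17] e1_2 e2_13]) (simp_all add: H_adj_neighbours H_neighbours_def)
  have e18_14: "P 18 14 0"
    by (rule face[OF rev[OF e17_18] e17_13 e13_14]) (simp_all add: H_adj_neighbours H_neighbours_def)
  have e4_17: "P 4 17 0"
    by (rule face[OF rev[OF e0_4] e0_1 e1_17]) (simp_all add: H_adj_neighbours H_neighbours_def)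
  have e3_18: "P 3 18 0"
    by (rule face[OF rev[OF e4_3] e4_17 e17_18]) (simp_all add: H_adj_neighbours H_neighbours_def)
  have e20_19: "P 20 19 0"
    by (rule face[OF rev[OF e1_20] e1_2 e2_19]) (simp_all add: H_adj_neighbours H_neighbours_def)
  have e4_20: "P 4 20 0"
    by (rule face[OF rev[OF e0_4] e0_1 e1_20]) (simp_all add: H_adj_neighbours H_neighbours_def)
  have e3_7: "P 3 7 0"
    by (rule face[OF rev[OF e4_3] e4_8 e8_7]) (simp_all add: H_adj_neighbours H_neighbours_def)
  have e7_11: "P 7 11 0"
    by (rule face[OF rev[OF e8_7] e8_12 e12_11]) (simp_all add: H_adj_neighbours H_neighbours_def)
  have e16_15: "P 16 15 0"
    by (rule face[OF rev[OF e20_16] e20_19 e19_15]) (simp_all add: H_adj_neighbours H_neighbours_def)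
  have e3_16: "P 3 16 0"
    by (rule face[OF rev[OF e4_3] e4_20 e20_16]) (simp_all add: H_adj_neighbours H_neighbours_def)
  have e6_7: "P 6 7 (-1)"
    by (rule face[OF rev[OF e2_6] rev[OF e3_2] e3_7]) (simp_all add: H_adj_neighbours H_neighbours_def)
  have e10_11: "P 10 11 (-1)"
    by (rule face[OF rev[OF e6_10] e6_7 e7_11]) (simp_all add: H_adj_neighbours H_neighbours_def)
  have e13_9: "P 13 9 (-1)"
    by (rule face[OF rev[OF e2_13] rev[OF e3_2] e3_9]) (simp_all add: H_adj_neighbours H_neighbours_def)
  have e14_10: "P 14 10 (-1)"
    by (rule face[OF rev[OF e13_14] e13_9 e9_10]) (simp_all add: H_adj_neighbours H_neighbours_def)
  have e12_16: "P 12 16 (-1)"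
    by (rule face[OF rev[OF e2_12] rev[OF e3_2] e3_16]) (simp_all add: H_adj_neighbours H_neighbours_def)
  have e19_18: "P 19 18 (-1)"
    by (rule face[OF rev[OF e2_19] rev[OF e3_2] e3_18]) (simp_all add: H_adj_neighbours H_neighbours_def)
  have e11_15: "P 11 15 (-1)"
    by (rule face[OF rev[OF e12_11] e12_16 e16_15]) (simp_all add: H_adj_neighbours H_neighbours_def)
  have e15_14: "P 15 14 (-1)"
    by (rule face[OF rev[OF e19_15] e19_18 e18_14]) (simp_all add: H_adj_neighbours H_neighbours_def)
  \<comment> \<open>The central face, the only one left. It gives the exponent -3 to an edge whose
    exponent is already known to be 1, so the fourth power of \<open>g\<close> is trivial.\<close>
  have last: "P 10 14 (-3)"
    by (rule face[OF e10_11 e11_15 e15_14]) (simp_all add: H_adj_neighbours H_neighbours_def)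
  have "g [^] (- 3 :: int) = g [^] (1 :: int)" using last rev[OF e14_10] by (simp add: P_def)
  then have "g [^] (1 - (- 3) :: int) = \<one>" using g by (simp only: int_pow_diff) simp
  then have g4: "g [^] (4 :: int) = \<one>" by simp
  have pow_cong: "g [^] i = g [^] j" if dvd: "4 dvd i - j" for i j :: int
  proof -
    obtain m where "i - j = 4 * m" using dvd by (elim dvdE)
    then have "g [^] (i - j) = (g [^] (4 :: int)) [^] m" using g by (simp add: int_pow_pow)
    then have "g [^] i \<otimes> inv (g [^] j) = \<one>" using g g4 by (simp add: int_pow_diff)
    then show ?thesis using g by (metis int_pow_closed inv_closed inv_equality inv_inv)
  qed
  have all: "list_all (\<lambda>(u, v, k). P u v k) H_exponents"
    unfolding H_exponents_def list.pred_inject prod.case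
    by (intro conjI list.pred_inject(1)
      e0_1 e1_2 e4_3 e0_4 e1_5 e2_6 e8_7 e1_8 e5_9 e6_10 e12_11 e2_12 e2_13 e13_14 e19_15 e20_16
      e1_17 e17_18 e2_19 e1_20 e3_2 e4_5 e5_6 e4_8 e3_9 e9_10 e8_12 e17_13 e18_14 e4_17
      e3_18 e20_19 e4_20 e3_7 e7_11 e16_15 e3_16 e6_7 e10_11 e13_9 e14_10 e12_16 e19_18
      e11_15 e15_14)
  have pot: "list_all (\<lambda>(u, v, k). (k - (H_sign u v + H_potential u - H_potential v)) mod 4 = 0) H_exponents"
    by code_simp
  have cover: "list_all (\<lambda>(u, v). list_ex (\<lambda>(u', v', k). (u' = u \<and> v' = v) \<or> (u' = v \<and> v' = u)) H_exponents)
      H_edges"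
    by code_simp
  have main: "e u v = g [^] (H_sign u v + H_potential u - H_potential v)"
    if "(u, v, k) \<in> set H_exponents" for u v k
    using that all pot pow_cong[of k] by (fastforce simp: list_all_iff P_def dvd_eq_mod_eq_0)
  have "e u v = g [^] (H_sign u v + H_potential u - H_potential v)" if uv: "adj H_graph u v" for u v
  proof -
    have "\<exists>k. (u, v, k) \<in> set H_exponents \<or> (v, u, k) \<in> set H_exponents"
      using uv cover unfolding H_adj_iff list_all_iff list_ex_iff by fastforce
    then consider k where "(u, v, k) \<in> set H_exponents" | k where "(v, u, k) \<in> set H_exponents" by blast
    then show ?thesis
    proof cases
      case 1
      then show ?thesis by (rule main)
    next
      case 2
      then have "e v u = g [^] (H_sign v u + H_potential v - H_potential u)" by (rule main)
      moreover have "e u v = inv (e v u)" using inverse H.sym uv by blast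
      moreover have "H_sign u v + H_potential u - H_potential v = - (H_sign v u + H_potential v - H_potential u)"
        using H_sign_antisym[OF uv] by simp
      ultimately show ?thesis using g by (simp only: int_pow_neg)
    qed
  qed
  then show ?thesis using g g4 by blast
qed

section \<open>The computation of \<open>\<Pi>\<^sub>1\<^sup>*(H)\<close>\<close>

text \<open>Passing through the root lets one tree serve all base points. Along a tree edge the path
  is still extended only at its end.\<close>

definition H_path :: "nat \<Rightarrow> nat \<Rightarrow> nat list" where
  "H_path b u = walk_concat (rev (H_tree ! b)) (H_tree ! u)"

lemma walk_sum_H_spur_eq: "spur_eq H_graph p q \<Longrightarrow> walk_sum H_sign p = walk_sum H_sign q"
  using H.walk_sum_spur_eq H_sign_antisym by blast

lemma walk_sum_H_rev: "walk H_graph p \<Longrightarrow> walk_sum H_sign (rev p) = - walk_sum H_sign p"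
  using H.walk_sum_rev H_sign_antisym by blast

lemma walk_sum_H_square:
  assumes "p \<in> closed_walks H_graph u" "walk_length p = 4"
  shows "4 dvd walk_sum H_sign p"
proof -
  note p = H.closed_walksD[OF assms(1)]
  have "length p = 5" using assms(2) p(4) by (cases p) (auto simp: walk_length_def)
  then obtain a0 a1 a2 a3 a4 where p_eq: "p = [a0, a1, a2, a3, a4]"
    by (auto simp: numeral_eq_Suc length_Suc_conv)
  then have "a4 = a0" using p by simp
  then show ?thesis
    using p(1) H_sign_square[of a0 a1 a2 a3] by (simp add: p_eq walk_Cons_Cons add.assoc)
qed

lemma walk_sum_H_parity:
  assumes "p \<noteq> []"
  shows "even (walk_sum H_sign p) \<longleftrightarrow> even (walk_length p)"
  using assms
proof (induction p rule: induct_list012)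
  case (3 u v p)
  have "odd (H_sign u v)" by (simp add: H_sign_def)
  then show ?case using 3(2) by (simp add: walk_length_def)
qed (auto simp: walk_length_def)

lemma based_graph_H:
  assumes b: "b \<in> verts H_graph"
  shows "based_graph H_graph b (H_path b)"
proof
  note tb = H_tree[OF b]
  have r: "walk H_graph (rev (H_tree ! b))" "hd (rev (H_tree ! b)) = b" "last (rev (H_tree ! b)) = 0"
    "rev (H_tree ! b) \<noteq> []"
    using tb H.walk_rev[OF tb(1)] by (auto simp: hd_rev last_rev)
  fix u assume u: "u \<in> verts H_graph"
  note tu = H_tree[OF u]
  have ne: "H_tree ! u \<noteq> []" using tu(1) by auto
  show "walk H_graph (H_path b u)" unfolding H_path_def using r tu by (intro walk_walk_concat) auto
  show "hd (H_path b u) = b" unfolding H_path_def using r by (simp del: rev_is_Nil_conv)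
  show "last (H_path b u) = u"
    unfolding H_path_def using last_walk_concat[OF r(4) ne] r(3) tu by simp
next
  note tb = H_tree[OF b]
  show "spur_eq H_graph (H_path b b) [b]"
    using H.spur_eq_concat_rev[OF H.walk_rev[OF tb(1)]] tb(3) by (simp add: H_path_def hd_rev)
qed (rule b)

lemma H_path_tree_edge:
  assumes "u \<in> verts H_graph" "H_tree ! v = H_tree ! u @ [v]"
  shows "H_path b v = walk_concat (H_path b u) [u, v]"
proof -
  have "H_tree ! u \<noteq> []" using H_tree(1)[OF assms(1)] by auto
  then show ?thesis by (simp add: H_path_def walk_concat_def assms(2))
qed

lemma (in monoid) m_assoc4:
  assumes "x \<in> carrier G" "y \<in> carrier G" "z \<in> carrier G" "w \<in> carrier G"
  shows "x \<otimes> (y \<otimes> (z \<otimes> (w \<otimes> \<one>))) = x \<otimes> y \<otimes> z \<otimes> w"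
  using assms by (simp add: m_assoc)

locale H_based =
  fixes b :: nat
  assumes b: "b \<in> verts H_graph"
begin

sublocale based_graph H_graph b "H_path b"
  by (rule based_graph_H[OF b])

abbreviation "G \<equiv> pi1 H_graph b"
abbreviation "cls \<equiv> pi1_class H_graph b"
abbreviation "N \<equiv> normal_closure G (square_classes H_graph b)"

lemma group_G: "group G"
  by (rule H.group_pi1[OF b])

lemma square_walks:
  assumes "walk H_graph l" "hd l = b" "p \<in> closed_walks H_graph (last l)"
  shows "walk_concat (walk_concat l p) (rev l) \<in> closed_walks H_graph b"
    "walk_sum H_sign (walk_concat (walk_concat l p) (rev l)) = walk_sum H_sign p"
proof -
  have ne: "l \<noteq> []" "rev l \<noteq> []" using assms(1) by auto
  note p = H.closed_walksD[OF assms(3)]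
  have r: "walk H_graph (rev l)" "hd (rev l) = last l" "last (rev l) = b"
    using H.walk_rev[OF assms(1)] assms(2) ne by (auto simp: hd_rev last_rev)
  have lp: "walk H_graph (walk_concat l p)" "hd (walk_concat l p) = b" "last (walk_concat l p) = last l"
    "walk_concat l p \<noteq> []"
    using assms p ne by (auto intro: walk_walk_concat simp: last_walk_concat)
  show "walk_concat (walk_concat l p) (rev l) \<in> closed_walks H_graph b"
    using walk_walk_concat[OF lp(1) r(1)] last_walk_concat[OF lp(4) ne(2)] hd_walk_concat[OF lp(4)] lp r
    by (simp add: closed_walks_def)
  show "walk_sum H_sign (walk_concat (walk_concat l p) (rev l)) = walk_sum H_sign p"
    using walk_sum_concat[OF lp(4) ne(2)] walk_sum_concat[OF ne(1) p(4)] lp r p walk_sum_H_rev[OF assms(1)]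
    by simp
qed

lemma square_classes_subset: "square_classes H_graph b \<subseteq> carrier G"
  using square_walks(1) by (auto simp: square_classes_def H.carrier_pi1)

lemma normal_N: "N \<lhd> G"
  using group.normal_normal_closure[OF group_G square_classes_subset] .

definition volt :: "nat list set \<Rightarrow> int" where
  "volt A = the_elem ((\<lambda>p. walk_sum H_sign p mod 4) ` A)"

lemma volt_class:
  assumes "p \<in> closed_walks H_graph b"
  shows "volt (cls p) = walk_sum H_sign p mod 4"
proof -
  have "(\<lambda>p. walk_sum H_sign p mod 4) ` cls p = {walk_sum H_sign p mod 4}"
    using H.pi1_class_self[OF assms] H.pi1_classD walk_sum_H_spur_eq by (auto simp: image_def) metis+
  then show ?thesis by (simp add: volt_def)
qed

lemma volt_hom: "volt \<in> hom G (integer_mod_group 4)"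
proof (rule homI)
  fix x assume "x \<in> carrier G"
  then obtain p where p: "p \<in> closed_walks H_graph b" "x = cls p" by (auto simp: H.carrier_pi1)
  then show "volt x \<in> carrier (integer_mod_group 4)" by (simp add: volt_class carrier_integer_mod_group)
  fix y assume "y \<in> carrier G"
  then obtain q where q: "q \<in> closed_walks H_graph b" "y = cls q" by (auto simp: H.carrier_pi1)
  have "walk_sum H_sign (walk_concat p q) = walk_sum H_sign p + walk_sum H_sign q"
    using H.closed_walksD[OF p(1)] H.closed_walksD[OF q(1)] by (intro walk_sum_concat) auto
  then show "volt (x \<otimes>\<^bsub>G\<^esub> y) = volt x \<otimes>\<^bsub>integer_mod_group 4\<^esub> volt y"
    using p q by (simp add: H.mult_pi1 volt_class mod_add_eq)
qed

sublocale volt: group_hom G "integer_mod_group 4" volt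
  using group_G volt_hom by (simp add: group_hom_def group_hom_axioms_def)

lemma volt_surj: "volt ` carrier G = carrier (integer_mod_group 4)"
proof
  show "volt ` carrier G \<subseteq> carrier (integer_mod_group 4)" using volt_hom by (auto simp: hom_def)
  have 0: "0 \<in> verts H_graph" by (simp add: H_verts)
  define l where "l = rev (H_tree ! b)"
  have l: "walk H_graph l" "hd l = b" "last l = 0"
    using H_tree[OF b] H.walk_rev by (auto simp: l_def hd_rev last_rev)
  have "k \<in> volt ` carrier G"
    if "walk H_graph p" "hd p = 0" "last p = 0" "walk_sum H_sign p mod 4 = k" for p k
  proof -
    have "p \<in> closed_walks H_graph (last l)" using that l by (simp add: closed_walks_def)
    from square_walks[OF l(1,2) this] show ?thesis
      using that(4) volt_class by (force simp: H.carrier_pi1)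
  qed
  note * = this
  have "0 \<in> volt ` carrier G" by (rule *[of "[0]"]) (simp_all add: 0)
  \<comment> \<open>The outer 5-cycle has sum 3; traversed twice it gives 2, and reversed 1.\<close>
  moreover have "3 \<in> volt ` carrier G"
    by (rule *[of "[0, 1, 2, 3, 4, 0]"])
      (simp_all add: walk_def H_adj_neighbours H_neighbours_def H_verts H_sign_def H_negative_def)
  moreover have "2 \<in> volt ` carrier G"
    by (rule *[of "[0, 1, 2, 3, 4, 0, 1, 2, 3, 4, 0]"])
      (simp_all add: walk_def H_adj_neighbours H_neighbours_def H_verts H_sign_def H_negative_def)
  moreover have "1 \<in> volt ` carrier G"
    by (rule *[of "[0, 4, 3, 2, 1, 0]"])
      (simp_all add: walk_def H_adj_neighbours H_neighbours_def H_verts H_sign_def H_negative_def)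
  moreover have "carrier (integer_mod_group 4) = {0, 1, 2, 3}"
    by (auto simp: carrier_integer_mod_group)
  ultimately show "carrier (integer_mod_group 4) \<subseteq> volt ` carrier G" by simp
qed

text \<open>The class of a walk in the quotient, after joining its ends to the base point, is a power
  of a single element of order four with exponent the sum of the signs, up to a coboundary.\<close>

lemma kernel_subset:
  assumes p: "p \<in> closed_walks H_graph b" and zero: "4 dvd walk_sum H_sign p"
  shows "cls p \<in> N"
proof -
  interpret N: normal N G by (rule normal_N)
  interpret Q: group "G Mod N" by (rule N.factorgroup_is_group)
  define \<epsilon> where "\<epsilon> q = N #>\<^bsub>G\<^esub> cls (loop_of q)" for q
  have cl: "cls (loop_of q) \<in> carrier G" if "walk H_graph q" for q
    using loop_of_closed[OF that] by (auto simp: H.carrier_pi1)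
  have \<epsilon>_closed: "\<epsilon> q \<in> carrier (G Mod N)" if "walk H_graph q" for q
    using cl[OF that] by (auto simp: \<epsilon>_def carrier_FactGroup)
  have \<epsilon>_concat: "\<epsilon> (walk_concat q r) = \<epsilon> q \<otimes>\<^bsub>G Mod N\<^esub> \<epsilon> r"
    if "walk H_graph q" "walk H_graph r" "last q = hd r" for q r
  proof -
    have "cls (loop_of (walk_concat q r)) = cls (walk_concat (loop_of q) (loop_of r))"
      by (intro H.pi1_class_eq loop_of_concat loop_of_closed H.closed_walks_concat walk_walk_concat that)
    also have "\<dots> = cls (loop_of q) \<otimes>\<^bsub>G\<^esub> cls (loop_of r)"
      using that loop_of_closed by (simp add: H.mult_pi1)
    finally show ?thesis using cl that by (simp add: \<epsilon>_def N.rcos_sum)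
  qed
  have b_closed: "[b] \<in> closed_walks H_graph b" using b by (simp add: closed_walks_def)
  have one_coset: "N #>\<^bsub>G\<^esub> \<one>\<^bsub>G\<^esub> = \<one>\<^bsub>G Mod N\<^esub>"
    using group.coset_mult_one[OF group_G N.subset] by simp
  have \<epsilon>_one: "\<epsilon> q = \<one>\<^bsub>G Mod N\<^esub>" if "walk H_graph q" "spur_eq H_graph (loop_of q) [b]" for q
  proof -
    have "cls (loop_of q) = \<one>\<^bsub>G\<^esub>"
      unfolding H.one_pi1 using that loop_of_closed b_closed by (intro H.pi1_class_eq) auto
    then show ?thesis using one_coset by (simp add: \<epsilon>_def)
  qed
  have \<epsilon>_spur: "\<epsilon> q = \<epsilon> q'" if "spur_eq H_graph q q'" "walk H_graph q" for q q'
    using that loop_of_spur_eq[OF that] loop_of_closed spur_eq_ends[OF that]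
    unfolding \<epsilon>_def by (metis H.pi1_class_eq)
  have single: "\<epsilon> [u] = \<one>\<^bsub>G Mod N\<^esub>" if "u \<in> verts H_graph" for u
  proof (rule \<epsilon>_one)
    show "walk H_graph [u]" using that by simp
    show "spur_eq H_graph (loop_of [u]) [b]"
      using H.spur_eq_concat_rev[OF T_walk[OF that]] T_hd[OF that] by (simp add: loop_of_def)
  qed
  define e where "e u v = \<epsilon> [u, v]" for u v
  have edge: "walk H_graph [u, v]" "u \<in> verts H_graph" "v \<in> verts H_graph" if "adj H_graph u v" for u v
    using that H.sym[OF that] by (auto simp: walk_def H_adj_neighbours H_verts)
  have e_closed: "e u v \<in> carrier (G Mod N)" if "adj H_graph u v" for u v
    using \<epsilon>_closed edge(1)[OF that] by (simp add: e_def)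
  have e_inv: "e v u = inv\<^bsub>G Mod N\<^esub> (e u v)" if "adj H_graph u v" for u v
  proof -
    have "e v u \<otimes>\<^bsub>G Mod N\<^esub> e u v = \<epsilon> (walk_concat [v, u] [u, v])"
      using edge(1)[OF that] edge(1)[OF H.sym[OF that]] by (simp add: e_def \<epsilon>_concat)
    also have "walk_concat [v, u] [u, v] = walk_concat [v, u] (rev [v, u])" by (simp add: walk_concat_def)
    also have "\<epsilon> \<dots> = \<epsilon> [hd [v, u]]"
      using edge(1)[OF that] edge(1)[OF H.sym[OF that]]
      by (intro \<epsilon>_spur H.spur_eq_concat_rev walk_walk_concat H.walk_rev) auto
    also have "\<dots> = \<one>\<^bsub>G Mod N\<^esub>" using single edge(3)[OF that] by simp
    finally show ?thesis
      using Q.inv_equality e_closed[OF that] e_closed[OF H.sym[OF that]] by simp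
  qed
  have \<epsilon>_Cons: "\<epsilon> (u # v # q) = e u v \<otimes>\<^bsub>G Mod N\<^esub> \<epsilon> (v # q)" if "walk H_graph (u # v # q)" for u v q
  proof -
    have a: "adj H_graph u v" "walk H_graph (v # q)" using that by (auto simp: walk_Cons_Cons)
    have "u # v # q = walk_concat [u, v] (v # q)" by (simp add: walk_concat_def)
    then show ?thesis unfolding e_def using \<epsilon>_concat[OF edge(1)[OF a(1)] a(2)] by simp
  qed
  have e_square: "e u v \<otimes>\<^bsub>G Mod N\<^esub> e v w \<otimes>\<^bsub>G Mod N\<^esub> e w x \<otimes>\<^bsub>G Mod N\<^esub> e x u = \<one>\<^bsub>G Mod N\<^esub>"
    if a: "adj H_graph u v" "adj H_graph v w" "adj H_graph w x" "adj H_graph x u" for u v w x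
  proof -
    have w: "walk H_graph [u, v, w, x, u]"
      using a edge by (simp add: walk_Cons_Cons)
    then have "\<epsilon> [u, v, w, x, u] = e u v \<otimes>\<^bsub>G Mod N\<^esub> (e v w \<otimes>\<^bsub>G Mod N\<^esub> (e w x \<otimes>\<^bsub>G Mod N\<^esub> (e x u \<otimes>\<^bsub>G Mod N\<^esub> \<epsilon> [u])))"
      by (simp add: \<epsilon>_Cons walk_Cons_Cons)
    also have "\<dots> = e u v \<otimes>\<^bsub>G Mod N\<^esub> e v w \<otimes>\<^bsub>G Mod N\<^esub> e w x \<otimes>\<^bsub>G Mod N\<^esub> e x u"
      unfolding single[OF edge(2)[OF a(1)]]
      by (rule Q.m_assoc4[OF e_closed[OF a(1)] e_closed[OF a(2)] e_closed[OF a(3)] e_closed[OF a(4)]])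
    finally have 1: "\<epsilon> [u, v, w, x, u] = e u v \<otimes>\<^bsub>G Mod N\<^esub> e v w \<otimes>\<^bsub>G Mod N\<^esub> e w x \<otimes>\<^bsub>G Mod N\<^esub> e x u" .
    have "cls (loop_of [u, v, w, x, u]) \<in> square_classes H_graph b"
      using w by (intro loop_of_square[of _ u]) (auto simp: closed_walks_def walk_length_def)
    then have "cls (loop_of [u, v, w, x, u]) \<in> N" by (rule subsetD[OF subset_normal_closure])
    then have "\<epsilon> [u, v, w, x, u] = N"
      unfolding \<epsilon>_def using cl[OF w] N.is_subgroup by (intro group.coset_join2[OF group_G])
    then show ?thesis unfolding 1[symmetric] by simp
  qed
  have e_tree: "e u v = \<one>\<^bsub>G Mod N\<^esub>" if "adj H_graph u v" "H_tree ! v = H_tree ! u @ [v]" for u v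
    unfolding e_def using edge(1)[OF that(1)]
    by (rule \<epsilon>_one[OF _ loop_of_tree_edge]) (use edge[OF that(1)] that(2) H_path_tree_edge in auto)
  have "\<exists>g\<in>carrier (G Mod N). g [^]\<^bsub>G Mod N\<^esub> (4 :: int) = \<one>\<^bsub>G Mod N\<^esub> \<and> (\<forall>u v. adj H_graph u v \<longrightarrow>
      e u v = g [^]\<^bsub>G Mod N\<^esub> (H_sign u v + H_potential u - H_potential v))"
    by (rule Q.H_edge_powers[OF e_closed e_inv e_square e_tree])
  then obtain g where g1: "g \<in> carrier (G Mod N)" and g2: "g [^]\<^bsub>G Mod N\<^esub> (4 :: int) = \<one>\<^bsub>G Mod N\<^esub> \<and>
      (\<forall>u v. adj H_graph u v \<longrightarrow> e u v = g [^]\<^bsub>G Mod N\<^esub> (H_sign u v + H_potential u - H_potential v))"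
    by (rule bexE)
  note g = g1 conjunct1[OF g2]
  note e_pow = conjunct2[OF g2, rule_format]
  have \<epsilon>_pow: "\<epsilon> q = g [^]\<^bsub>G Mod N\<^esub> (walk_sum H_sign q + H_potential (hd q) - H_potential (last q))"
    if "walk H_graph q" for q
    using that
  proof (induction q rule: induct_list012)
    case (2 u)
    then show ?case using single by (simp del: one_FactGroup)
  next
    case (3 u v q)
    then have a: "adj H_graph u v" "walk H_graph (v # q)" by (auto simp: walk_Cons_Cons)
    have "\<epsilon> (u # v # q) = g [^]\<^bsub>G Mod N\<^esub> (H_sign u v + H_potential u - H_potential v)
        \<otimes>\<^bsub>G Mod N\<^esub> g [^]\<^bsub>G Mod N\<^esub> (walk_sum H_sign (v # q) + H_potential (hd (v # q)) - H_potential (last (v # q)))"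
      using \<epsilon>_Cons[OF 3(3)] e_pow[OF a(1)] 3(2)[OF a(2)] by simp
    also have "\<dots> = g [^]\<^bsub>G Mod N\<^esub> ((H_sign u v + H_potential u - H_potential v)
        + (walk_sum H_sign (v # q) + H_potential (hd (v # q)) - H_potential (last (v # q))))"
      using g(1) by (simp only: Q.int_pow_mult)
    also have "(H_sign u v + H_potential u - H_potential v)
        + (walk_sum H_sign (v # q) + H_potential (hd (v # q)) - H_potential (last (v # q)))
        = walk_sum H_sign (u # v # q) + H_potential (hd (u # v # q)) - H_potential (last (u # v # q))"
      by simp
    finally show ?case .
  qed simp
  note cp = H.closed_walksD[OF p]
  obtain m where m: "walk_sum H_sign p = 4 * m" using zero by (elim dvdE)
  \<comment> \<open>The ends of \<open>p\<close> coincide, so the potentials cancel and only the sum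
    of signs remains.\<close>
  have "\<epsilon> p = g [^]\<^bsub>G Mod N\<^esub> (4 * m)" using \<epsilon>_pow[OF cp(1)] cp m by simp
  also have "\<dots> = (g [^]\<^bsub>G Mod N\<^esub> (4 :: int)) [^]\<^bsub>G Mod N\<^esub> m" using g(1) by (simp add: Q.int_pow_pow)
  also have "\<dots> = \<one>\<^bsub>G Mod N\<^esub>" by (simp only: g(2) Q.int_pow_one)
  finally have "\<epsilon> p = N" by simp
  moreover have "\<epsilon> p = N #>\<^bsub>G\<^esub> cls p"
    unfolding \<epsilon>_def using loop_of_closed_walk[OF p] loop_of_closed[OF cp(1)] p H.pi1_class_eq by metis
  moreover have "cls p \<in> carrier G" using p by (auto simp: H.carrier_pi1)
  ultimately show ?thesis using group.rcos_self[OF group_G _ N.is_subgroup] by auto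
qed

text \<open>The kernel is normal and contains the square classes, whose sums are divisible by 4; the
  other inclusion is \<open>kernel_subset\<close>.\<close>

lemma kernel_volt: "kernel G (integer_mod_group 4) volt = N"
proof
  show "N \<subseteq> kernel G (integer_mod_group 4) volt"
  proof (rule normal_closure_least[OF volt.normal_kernel])
    show "square_classes H_graph b \<subseteq> kernel G (integer_mod_group 4) volt"
    proof
      fix A assume A: "A \<in> square_classes H_graph b"
      then obtain l s where ls: "A = cls (walk_concat (walk_concat l s) (rev l))"
        "walk H_graph l" "hd l = b" "s \<in> closed_walks H_graph (last l)" "walk_length s = 4"
        unfolding square_classes_def by blast
      have "volt A = 0"
        using square_walks[OF ls(2-4)] walk_sum_H_square[OF ls(4,5)] by (simp add: ls(1) volt_class)
      then show "A \<in> kernel G (integer_mod_group 4) volt"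
        using A square_classes_subset by (auto simp: kernel_def)
    qed
  qed
  show "kernel G (integer_mod_group 4) volt \<subseteq> N"
  proof
    fix x assume x: "x \<in> kernel G (integer_mod_group 4) volt"
    then obtain p where p: "p \<in> closed_walks H_graph b" "x = cls p"
      by (auto simp: kernel_def H.carrier_pi1)
    then have "4 dvd walk_sum H_sign p" using x by (auto simp: kernel_def volt_class)
    then show "x \<in> N" using kernel_subset p by simp
  qed
qed

definition star_volt :: "nat list set set \<Rightarrow> int" where
  "star_volt A = the_elem (volt ` A)"

lemma star_volt_iso: "star_volt \<in> iso (pi1_star H_graph b) (integer_mod_group 4)"
  using volt.FactGroup_iso_set[OF volt_surj] by (simp add: kernel_volt pi1_star_def star_volt_def[abs_def])

lemma carrier_pi1_star: "carrier (pi1_star H_graph b) = pi1_star_class H_graph b ` closed_walks H_graph b"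
  by (auto simp: pi1_star_def pi1_star_class_def carrier_FactGroup H.carrier_pi1)

lemma star_volt_class:
  assumes "p \<in> closed_walks H_graph b"
  shows "star_volt (pi1_star_class H_graph b p) = walk_sum H_sign p mod 4"
proof -
  interpret N: normal N G by (rule normal_N)
  have c: "cls p \<in> carrier G" using assms by (auto simp: H.carrier_pi1)
  have "volt y = volt (cls p)" if y: "y \<in> N #>\<^bsub>G\<^esub> cls p" for y
  proof -
    obtain n where n: "n \<in> N" "y = n \<otimes>\<^bsub>G\<^esub> cls p" using y by (auto simp: r_coset_def)
    then have "n \<in> carrier G" "volt n = 0" using kernel_volt by (auto simp: kernel_def)
    then show ?thesis using n c volt_class[OF assms] volt.hom_mult by simp
  qed
  moreover have "cls p \<in> N #>\<^bsub>G\<^esub> cls p" using group.rcos_self[OF group_G c N.is_subgroup] .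
  ultimately have "volt ` (N #>\<^bsub>G\<^esub> cls p) = {volt (cls p)}" by blast
  then show ?thesis by (simp add: star_volt_def pi1_star_class_def volt_class[OF assms])
qed

text \<open>The class fixes the sum of signs modulo 4, and since every sign is odd this sum has the
  parity of the length. So the set inside \<open>the_elem\<close> is a singleton.\<close>

lemma length_parity_class:
  assumes "p \<in> closed_walks H_graph b"
  shows "length_parity H_graph b (pi1_star_class H_graph b p) = int (walk_length p) mod 2"
proof -
  have par: "int (walk_length q) mod 2 = walk_sum H_sign q mod 4 mod 2" if "q \<in> closed_walks H_graph b" for q
  proof -
    have "walk_sum H_sign q mod 4 mod 2 = walk_sum H_sign q mod 2" by (simp add: mod_mod_cancel)
    then show ?thesis
      using walk_sum_H_parity[OF H.closed_walksD(4)[OF that]] by (simp add: mod_2_eq_odd)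
  qed
  have "int (walk_length q) mod 2 = int (walk_length p) mod 2"
    if "q \<in> closed_walks H_graph b" "pi1_star_class H_graph b q = pi1_star_class H_graph b p" for q
    using par[OF that(1)] par[OF assms] star_volt_class[OF that(1)] star_volt_class[OF assms] that(2) by simp
  then have "(\<lambda>q. int (walk_length q) mod 2) ` {q \<in> closed_walks H_graph b.
      pi1_star_class H_graph b q = pi1_star_class H_graph b p} = {int (walk_length p) mod 2}"
    using assms by blast
  then show ?thesis by (simp add: length_parity_def)
qed

lemma length_parity_star_volt:
  assumes "A \<in> carrier (pi1_star H_graph b)"
  shows "length_parity H_graph b A = star_volt A mod 2"
proof -
  obtain p where p: "p \<in> closed_walks H_graph b" "A = pi1_star_class H_graph b p"
    using assms carrier_pi1_star by auto
  have "walk_sum H_sign p mod 4 mod 2 = walk_sum H_sign p mod 2" by (simp add: mod_mod_cancel)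
  then show ?thesis
    using length_parity_class[OF p(1)] star_volt_class[OF p(1)] walk_sum_H_parity[OF H.closed_walksD(4)[OF p(1)]]
    by (simp add: p(2) mod_2_eq_odd)
qed

lemma star_volt_mult:
  assumes "A \<in> carrier (pi1_star H_graph b)" "B \<in> carrier (pi1_star H_graph b)"
  shows "star_volt (A \<otimes>\<^bsub>pi1_star H_graph b\<^esub> B) = (star_volt A + star_volt B) mod 4"
  using star_volt_iso assms by (simp add: iso_def hom_def)

lemma group_pi1_star: "group (pi1_star H_graph b)"
  unfolding pi1_star_def using normal.factorgroup_is_group[OF normal_N] .

lemma length_parity_hom: "length_parity H_graph b \<in> hom (pi1_star H_graph b) (integer_mod_group 2)"
proof (rule homI)
  fix A B assume A: "A \<in> carrier (pi1_star H_graph b)"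
  show "length_parity H_graph b A \<in> carrier (integer_mod_group 2)"
    using length_parity_star_volt[OF A] by (simp add: carrier_integer_mod_group)
  assume B: "B \<in> carrier (pi1_star H_graph b)"
  have "A \<otimes>\<^bsub>pi1_star H_graph b\<^esub> B \<in> carrier (pi1_star H_graph b)"
    using group.is_monoid[OF group_pi1_star] A B by (rule monoid.m_closed)
  then show "length_parity H_graph b (A \<otimes>\<^bsub>pi1_star H_graph b\<^esub> B)
      = length_parity H_graph b A \<otimes>\<^bsub>integer_mod_group 2\<^esub> length_parity H_graph b B"
    using A B by (simp add: length_parity_star_volt star_volt_mult mod_mod_cancel mod_add_eq)
qed

text \<open>An odd residue modulo 4 has double 2, not 0.\<close>

lemma no_odd_involution:
  assumes "p \<in> closed_walks H_graph b" "odd (walk_length p)"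
  shows "pi1_star_class H_graph b p [^]\<^bsub>pi1_star H_graph b\<^esub> (2::nat) \<noteq> \<one>\<^bsub>pi1_star H_graph b\<^esub>"
proof
  interpret S: group "pi1_star H_graph b" by (rule group_pi1_star)
  let ?A = "pi1_star_class H_graph b p"
  have A: "?A \<in> carrier (pi1_star H_graph b)" using assms carrier_pi1_star by auto
  assume "?A [^]\<^bsub>pi1_star H_graph b\<^esub> (2::nat) = \<one>\<^bsub>pi1_star H_graph b\<^esub>"
  then have "?A \<otimes>\<^bsub>pi1_star H_graph b\<^esub> ?A = \<one>\<^bsub>pi1_star H_graph b\<^esub>"
    using A by (simp add: numeral_2_eq_2)
  moreover have "star_volt \<one>\<^bsub>pi1_star H_graph b\<^esub> = 0"
    using hom_one[of star_volt "pi1_star H_graph b" "integer_mod_group 4"] star_volt_iso S.is_group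
    by (simp add: iso_def)
  ultimately have "(star_volt ?A + star_volt ?A) mod 4 = 0" using star_volt_mult[OF A A] by simp
  then have "even (star_volt ?A)" by presburger
  moreover have "odd (star_volt ?A)"
    using star_volt_class[OF assms(1)] walk_sum_H_parity[OF H.closed_walksD(4)[OF assms(1)]] assms(2)
    by (simp add: dvd_mod_iff)
  ultimately show False by simp
qed

end

section \<open>The theorem\<close>

theorem mainTheorem4:
  shows "(\<forall>b\<in>verts H_graph.
            length_parity H_graph b \<in> hom (pi1_star H_graph b) (integer_mod_group 2) \<and>
            (\<forall>\<gamma>\<in>closed_walks H_graph b.
               length_parity H_graph b (pi1_star_class H_graph b \<gamma>) = int (walk_length \<gamma>) mod 2) \<and>
            (\<exists>\<phi>\<in>iso (pi1_star H_graph b) (integer_mod_group 4).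
               \<forall>A\<in>carrier (pi1_star H_graph b). length_parity H_graph b A = \<phi> A mod 2)) \<and>
         \<not> (\<exists>b\<in>verts H_graph. \<exists>\<gamma>\<in>closed_walks H_graph b.
              odd (walk_length \<gamma>) \<and>
              pi1_star_class H_graph b \<gamma> [^]\<^bsub>pi1_star H_graph b\<^esub> (2::nat)
                = \<one>\<^bsub>pi1_star H_graph b\<^esub>) \<and>
         (\<forall>d\<ge>1. \<forall>(X :: 'a topology) act.
            polish X \<and> zero_dimensional X \<and>
            continuous_Zd_action d X act \<and> free_Zd_action d X act \<longrightarrow>
            (\<exists>c. continuous_graph_hom X (schreier_graph d X act) H_graph c))"
proof (intro conjI ballI allI impI)
  fix b assume "b \<in> verts H_graph"
  then interpret H_based b by unfold_locales
  show "length_parity H_graph b \<in> hom (pi1_star H_graph b) (integer_mod_group 2)"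
    by (rule length_parity_hom)
  show "length_parity H_graph b (pi1_star_class H_graph b \<gamma>) = int (walk_length \<gamma>) mod 2"
    if "\<gamma> \<in> closed_walks H_graph b" for \<gamma>
    using that by (rule length_parity_class)
  show "\<exists>\<phi>\<in>iso (pi1_star H_graph b) (integer_mod_group 4).
      \<forall>A\<in>carrier (pi1_star H_graph b). length_parity H_graph b A = \<phi> A mod 2"
    using star_volt_iso length_parity_star_volt by blast
next
  have "pi1_star_class H_graph b \<gamma> [^]\<^bsub>pi1_star H_graph b\<^esub> (2::nat) \<noteq> \<one>\<^bsub>pi1_star H_graph b\<^esub>"
    if "b \<in> verts H_graph" "\<gamma> \<in> closed_walks H_graph b" "odd (walk_length \<gamma>)" for b \<gamma>
    using H_based.no_odd_involution[OF H_based.intro[OF that(1)] that(2,3)] .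
  then show "\<not> (\<exists>b\<in>verts H_graph. \<exists>\<gamma>\<in>closed_walks H_graph b. odd (walk_length \<gamma>) \<and>
      pi1_star_class H_graph b \<gamma> [^]\<^bsub>pi1_star H_graph b\<^esub> (2::nat) = \<one>\<^bsub>pi1_star H_graph b\<^esub>)"
    by blast
next
  fix d and X :: "'a topology" and act
  assume "polish X \<and> zero_dimensional X \<and> continuous_Zd_action d X act \<and> free_Zd_action d X act"
  then have "free_Zd_space d X act" by (simp add: free_Zd_space_def)
  then show "\<exists>c. continuous_graph_hom X (schreier_graph d X act) H_graph c"
    by (rule free_Zd_space.continuous_H_coloring)
qed

end
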